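(* Let $G$ be a locally compact, second countable group, and let $\lambda$ be an invariant subgroup measure of $G$, i.e. a $\sigma$-finite Borel measure on $\mathrm{Sub}_G$ that is invariant under the conjugation action of $G$. Then for every $H$ in the topological support of $\lambda$ there exists a nontrivial $G$-invariant Radon measure on $G/H$.
   Context: Topological groups are Hausdorff. $\mathrm{Sub}_G$ is the space of closed subgroups of $G$ with the Chabauty topology, i.e. the topology with subbasis $\{H: H\cap K=\emptyset\}$ ($K\subset G$ compact) and $\{H: H\cap U\neq\emptyset\}$ ($U\subset G$ open). $G$ acts on $\mathrm{Sub}_G$ by conjugation, $H\mapsto kHk^{-1}$ for $k\in G$. The topological support of $\lambda$ is the set of $H\in\mathrm{Sub}_G$ all of whose neighborhoods have positive $\lambda$-measure. $G$ acts on $G/H$ by left multiplication; nontrivial means not identically zero. *)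

theory Defs
  imports "HOL-Analysis.Analysis"
begin

text \<open>
  Topological groups are those of the library class \<^class>\<open>topological_group_add\<close>. It is
  written additively but does not assume commutativity: \<open>g + h\<close> stands for the product \<open>gh\<close>, \<open>- g\<close>
  for the inverse, \<open>0\<close> for the identity element, and \<open>k + h - k\<close> for \<open>khk\<^sup>-\<^sup>1\<close>.
\<close>

definition is_subgroup :: "'a::group_add set \<Rightarrow> bool" where
  "is_subgroup H \<longleftrightarrow> 0 \<in> H \<and> (\<forall>x\<in>H. \<forall>y\<in>H. x + y \<in> H) \<and> (\<forall>x\<in>H. - x \<in> H)"

definition Sub :: "'a::topological_group_add set set" where
  "Sub = {H. is_subgroup H \<and> closed H}"

definition chabauty :: "'a::topological_group_add set topology" where
  "chabauty = topology_generated_by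
     ({{H \<in> Sub. H \<inter> K = {}} |K. compact K} \<union> {{H \<in> Sub. H \<inter> U \<noteq> {}} |U. open U})"

lemma topspace_chabauty: "topspace chabauty = Sub"
proof -
  have "{H \<in> Sub. H \<inter> {} = {}} = (Sub :: 'a set set)" by simp
  then have "(Sub :: 'a set set) \<in> {{H \<in> Sub. H \<inter> K = {}} |K. compact K}"
    using compact_empty by blast
  then show ?thesis unfolding chabauty_def topology_generated_by_topspace by blast
qed

definition conjugate :: "'a::group_add \<Rightarrow> 'a set \<Rightarrow> 'a set" where
  "conjugate k H = (\<lambda>h. k + h - k) ` H"

definition left_translate :: "'a::group_add \<Rightarrow> 'a set \<Rightarrow> 'a set" where
  "left_translate g C = (\<lambda>x. g + x) ` C"

definition left_cosets :: "'a::group_add set \<Rightarrow> 'a set set" where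
  "left_cosets H = range (\<lambda>g. left_translate g H)"

definition coset_topology :: "'a::topological_group_add set \<Rightarrow> 'a set topology" where
  "coset_topology H =
     topology (\<lambda>V. V \<subseteq> left_cosets H \<and> open ((\<lambda>g. left_translate g H) -` V))"

lemma openin_coset_topology:
  "openin (coset_topology H) V \<longleftrightarrow>
     V \<subseteq> left_cosets H \<and> open ((\<lambda>g. left_translate g H) -` V)"
proof -
  have "istopology (\<lambda>V. V \<subseteq> left_cosets H \<and> open ((\<lambda>g. left_translate g H) -` V))"
    unfolding istopology_def by (auto simp: vimage_Union)
  then show ?thesis by (simp add: coset_topology_def)
qed

lemma topspace_coset_topology: "topspace (coset_topology H) = left_cosets H"
proof -
  have "openin (coset_topology H) (left_cosets H)"
    by (auto simp: openin_coset_topology left_cosets_def vimage_def)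
  then show ?thesis
    by (metis openin_coset_topology openin_subset openin_topspace subset_antisym)
qed

lemma quotient_map_coset_topology:
  "quotient_map euclidean (coset_topology H) (\<lambda>g. left_translate g H)"
  by (auto simp: quotient_map_def topspace_coset_topology left_cosets_def openin_coset_topology
      vimage_def)

definition borel_on :: "'b topology \<Rightarrow> 'b measure" where
  "borel_on X = sigma (topspace X) {U. openin X U}"

definition topological_support :: "'b topology \<Rightarrow> 'b measure \<Rightarrow> 'b set" where
  "topological_support X M =
     {x \<in> topspace X. \<forall>U. openin X U \<longrightarrow> x \<in> U \<longrightarrow> emeasure M U > 0}"

text \<open>
  For the two actions used here every \<open>act g\<close> is a homeomorphism, so images of Borel sets are Borel
  and the value \<open>0\<close> of \<^const>\<open>emeasure\<close> on non-measurable sets plays no role.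
\<close>

definition invariant_under :: "('g \<Rightarrow> 'b \<Rightarrow> 'b) \<Rightarrow> 'b measure \<Rightarrow> bool" where
  "invariant_under act M \<longleftrightarrow> (\<forall>g. \<forall>A\<in>sets M. emeasure M (act g ` A) = emeasure M A)"

definition invariant_subgroup_measure :: "'a::topological_group_add set measure \<Rightarrow> bool" where
  "invariant_subgroup_measure M \<longleftrightarrow>
     sets M = sets (borel_on chabauty) \<and> sigma_finite_measure M \<and> invariant_under conjugate M"

text \<open>
  Finite on compact sets, outer regular on Borel sets, inner regular on open sets. On a locally compact
  second countable Hausdorff space, such as the quotient of \<open>G\<close> by a closed subgroup, this agrees with
  the other usual definitions; compact sets are closed there, hence measurable.
\<close>

definition radon_measure :: "'b topology \<Rightarrow> 'b measure \<Rightarrow> bool" where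
  "radon_measure X M \<longleftrightarrow>
     sets M = sets (borel_on X) \<and>
     (\<forall>K. compactin X K \<longrightarrow> emeasure M K < \<infinity>) \<and>
     (\<forall>A\<in>sets M. emeasure M A = (INF U\<in>{U. openin X U \<and> A \<subseteq> U}. emeasure M U)) \<and>
     (\<forall>U. openin X U \<longrightarrow>
        emeasure M U = (SUP K\<in>{K. compactin X K \<and> K \<subseteq> U}. emeasure M K))"

end

theory Submission
  imports Defs
begin

text \<open>
  Fix a left Haar measure \<open>m\<close> of \<open>G\<close> and, for every closed subgroup \<open>K\<close>, the left Haar measure \<open>\<nu>\<^sub>K\<close>
  normalised by \<open>\<nu>\<^sub>K(\<phi>) = 1\<close>, where \<open>\<phi> \<ge> 0\<close> is a fixed continuous function with compact support and
  \<open>\<phi>(0) > 0\<close>. Let \<open>P\<^sub>K f (g)\<close> be the integral of \<open>f(gk)\<close> over \<open>k \<in> K\<close>; it depends only on \<open>gK\<close>, and \<open>P\<^sub>K\<close>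
  maps the continuous functions with compact support on \<open>G\<close> onto those on \<open>G/K\<close>.

  The quotient \<open>G/H\<close> carries an invariant Radon measure as soon as the pairing
  \<open>(f\<^sub>1, f\<^sub>2) \<mapsto> m(f\<^sub>1 \<cdot> P\<^sub>H f\<^sub>2)\<close> is symmetric. Indeed, choose \<open>\<psi>\<close> with \<open>P\<^sub>H \<psi> = 1\<close> on the support of \<open>f\<close>; then
  \<open>m(f) = m(f \<cdot> P\<^sub>H \<psi>) = m(\<psi> \<cdot> P\<^sub>H f)\<close>, so \<open>m(f)\<close> depends only on \<open>P\<^sub>H f\<close>, monotonically, and
  \<open>P\<^sub>H f \<mapsto> m(f)\<close> is an invariant positive functional on the functions on \<open>G/H\<close>. This is
  \<open>invariant_radon_of_symmetric\<close>.

  It remains to prove the symmetry for \<open>H\<close> in the support of \<open>\<lambda>\<close>. By uniqueness of Haar measure and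
  compactness \<open>K \<mapsto> \<nu>\<^sub>K(f)\<close> is continuous for the Chabauty topology (\<open>unit_haar_tendsto\<close>), and therefore so is
  the pairing. Hence it suffices that the integral of \<open>u(K) m(f\<^sub>1 \<cdot> P\<^sub>K f\<^sub>2)\<close> against \<open>\<lambda>\<close> is symmetric in \<open>f\<^sub>1\<close>
  and \<open>f\<^sub>2\<close> for every measurable \<open>u \<ge> 0\<close>: if the two pairings differed at \<open>H\<close>, the indicator \<open>u\<close> of a small
  neighbourhood, cut down to finite measure, would distinguish the integrals. This symmetry is the mass transport
  principle \<open>mass_transport\<close>. For each fixed \<open>g\<close> the invariance of \<open>\<lambda>\<close> permits the substitution \<open>K = g\<^sup>-\<^sup>1Lg\<close>, which turns the
  left coset \<open>gK\<close> into the right coset \<open>Lg\<close>. For fixed \<open>L\<close> the measure transported from \<open>\<nu>\<^sub>K\<close> to \<open>Lg\<close> depends only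
  on the coset, and both it and \<open>m\<close> are invariant under left translation by \<open>L\<close>. Since invariant measures
  on a coset of \<open>L\<close> are proportional, the integral over pairs of points in a common right coset of \<open>L\<close> is
  symmetric (\<open>right_coset_average_symmetric\<close>).

  The supporting theory consists of the Riesz representation theorem for locally compact Hausdorff spaces,
  proved by way of outer measures (\<open>riesz_representation\<close>, \<open>riesz_integral\<close>), the existence of Haar measures on
  closed subgroups by Weil's covering numbers (\<open>left_haar_exists\<close>), and their uniqueness up to a factor
  (\<open>left_haar_unique\<close>). All functions are nonnegative, so that real and extended integrals are easily compared.
\<close>

section \<open>Borel sets and nonnegative functions with compact support\<close>

lemma space_borel_on [simp]: "space (borel_on X) = topspace X"
  unfolding borel_on_def by (rule space_measure_of) (auto dest: openin_subset)

lemma open_in_borel_on: "openin X U \<Longrightarrow> U \<in> sets (borel_on X)"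
  unfolding borel_on_def by (subst sets_measure_of) (auto dest: openin_subset)

lemma closed_in_borel_on: "closedin X A \<Longrightarrow> A \<in> sets (borel_on X)"
  using sets.compl_sets[OF open_in_borel_on[of X "topspace X - A"]]
  by (simp add: closedin_def double_diff)

lemma continuous_map_measurable:
  assumes "continuous_map X Y f"
  shows "f \<in> borel_on X \<rightarrow>\<^sub>M borel_on Y"
  unfolding borel_on_def[of Y]
proof (rule measurable_measure_of)
  show "f \<in> space (borel_on X) \<rightarrow> topspace Y"
    using continuous_map_image_subset_topspace[OF assms] by auto
  show "f -` U \<inter> space (borel_on X) \<in> sets (borel_on X)" if "U \<in> {U. openin Y U}" for U
  proof -
    have "openin X {x \<in> topspace X. f x \<in> U}"
      using that openin_continuous_map_preimage[OF assms] by auto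
    then show ?thesis
      using open_in_borel_on by (simp add: vimage_def Int_def conj_commute)
  qed
qed (auto dest: openin_subset)

text \<open>
  Vanishing outside the compact set is required at every element of the type, not only on the space. Thus
  members of the cone are determined by their values on the space, and pointwise sums and comparisons need
  no relativisation.
\<close>

definition Cc :: "'b topology \<Rightarrow> ('b \<Rightarrow> real) set" where
  "Cc X = {f. continuous_map X euclideanreal f \<and> (\<forall>x. 0 \<le> f x) \<and>
     (\<exists>C. compactin X C \<and> (\<forall>x. x \<notin> C \<longrightarrow> f x = 0))}"

text \<open>
  The usual relation \<open>f \<prec> U\<close>: the compact set off which \<open>f\<close> vanishes lies inside \<open>U\<close>, which is stronger
  than vanishing outside \<open>U\<close>.
\<close>

definition subordinate :: "'b topology \<Rightarrow> 'b set \<Rightarrow> ('b \<Rightarrow> real) \<Rightarrow> bool" where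
  "subordinate X U f \<longleftrightarrow> continuous_map X euclideanreal f \<and> (\<forall>x. 0 \<le> f x \<and> f x \<le> 1) \<and>
     (\<exists>C. compactin X C \<and> C \<subseteq> U \<and> (\<forall>x. x \<notin> C \<longrightarrow> f x = 0))"

definition positive_functional :: "'b topology \<Rightarrow> (('b \<Rightarrow> real) \<Rightarrow> real) \<Rightarrow> bool" where
  "positive_functional X I \<longleftrightarrow> (\<forall>f\<in>Cc X. 0 \<le> I f) \<and>
     (\<forall>f\<in>Cc X. \<forall>g\<in>Cc X. I (\<lambda>x. f x + g x) = I f + I g) \<and>
     (\<forall>f\<in>Cc X. \<forall>c\<ge>0. I (\<lambda>x. c * f x) = c * I f)"

lemma CcI:
  assumes "continuous_map X euclideanreal f" "\<And>x. 0 \<le> f x" "compactin X C" "\<And>x. x \<notin> C \<Longrightarrow> f x = 0"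
  shows "f \<in> Cc X"
  using assms unfolding Cc_def by auto

lemma CcE:
  assumes "f \<in> Cc X"
  obtains C where "compactin X C" "\<And>x. x \<notin> C \<Longrightarrow> f x = 0"
  using assms unfolding Cc_def by auto

lemma Cc_cont: "f \<in> Cc X \<Longrightarrow> continuous_map X euclideanreal f"
  and Cc_nonneg: "f \<in> Cc X \<Longrightarrow> 0 \<le> f x"
  unfolding Cc_def by auto

lemma subordinate_Cc: "subordinate X U f \<Longrightarrow> f \<in> Cc X"
  unfolding subordinate_def Cc_def by auto

lemma subordinate_mono: "subordinate X U f \<Longrightarrow> U \<subseteq> V \<Longrightarrow> subordinate X V f"
  unfolding subordinate_def by blast

lemma Cc_add:
  assumes "f \<in> Cc X" "g \<in> Cc X"
  shows "(\<lambda>x. f x + g x) \<in> Cc X"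
proof -
  obtain C D where C: "compactin X C" "\<And>x. x \<notin> C \<Longrightarrow> f x = 0"
    and D: "compactin X D" "\<And>x. x \<notin> D \<Longrightarrow> g x = 0" using assms by (metis CcE)
  show ?thesis
    by (rule CcI[where C = "C \<union> D"])
       (use assms C D in \<open>auto intro!: continuous_map_add compactin_Un simp: Cc_cont Cc_nonneg\<close>)
qed

lemma Cc_mult:
  assumes "f \<in> Cc X" "continuous_map X euclideanreal g" "\<And>x. f x \<noteq> 0 \<Longrightarrow> 0 \<le> g x"
  shows "(\<lambda>x. f x * g x) \<in> Cc X"
proof -
  obtain C where C: "compactin X C" "\<And>x. x \<notin> C \<Longrightarrow> f x = 0"
    using assms by (metis CcE)
  show ?thesis
  proof (rule CcI[where C = C])
    show "0 \<le> f x * g x" for x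
      using assms(3)[of x] Cc_nonneg[OF assms(1), of x] by (cases "f x = 0") auto
  qed (use assms C in \<open>auto intro!: continuous_map_real_mult simp: Cc_cont\<close>)
qed

lemma Cc_scale: "f \<in> Cc X \<Longrightarrow> 0 \<le> c \<Longrightarrow> (\<lambda>x. c * f x) \<in> Cc X"
  using Cc_mult[of f X "\<lambda>_. c"] by (simp add: mult.commute)

lemma Cc_diff:
  assumes "f \<in> Cc X" "g \<in> Cc X" "\<And>x. g x \<le> f x"
  shows "(\<lambda>x. f x - g x) \<in> Cc X"
proof -
  obtain C D where C: "compactin X C" "\<And>x. x \<notin> C \<Longrightarrow> f x = 0"
    and D: "compactin X D" "\<And>x. x \<notin> D \<Longrightarrow> g x = 0" using assms by (metis CcE)
  show ?thesis
    by (rule CcI[where C = "C \<union> D"])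
       (use assms C D in \<open>auto intro!: continuous_map_diff compactin_Un simp: Cc_cont Cc_nonneg\<close>)
qed

lemma Cc_zero: "(\<lambda>_. 0) \<in> Cc X"
  by (rule CcI[where C = "{}"]) auto

lemma Cc_bounded:
  assumes "f \<in> Cc X" obtains B where "0 < B" "\<And>x. f x \<le> B"
proof -
  obtain C where C: "compactin X C" "\<And>x. x \<notin> C \<Longrightarrow> f x = 0" using assms by (metis CcE)
  have "compact (f ` C)"
    using image_compactin[OF C(1) Cc_cont[OF assms]] by simp
  then obtain b where b: "\<And>x. x \<in> C \<Longrightarrow> norm (f x) \<le> b"
    using compact_imp_bounded[of "f ` C"] unfolding bounded_iff by auto
  show thesis
  proof (rule that[of "max b 1"])
    fix x show "f x \<le> max b 1"
      using b[of x] C(2)[of x] by (cases "x \<in> C") auto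
  qed auto
qed

lemma Cc_measurable:
  assumes "f \<in> Cc X" "sets M = sets (borel_on X)"
  shows "f \<in> borel_measurable M"
proof (rule borel_measurableI)
  fix S :: "real set" assume "open S"
  then have "openin X {x \<in> topspace X. f x \<in> S}"
    using openin_continuous_map_preimage[OF Cc_cont[OF assms(1)]] by auto
  moreover have "f -` S \<inter> space M = {x \<in> topspace X. f x \<in> S}"
    using sets_eq_imp_space_eq[OF assms(2)] by auto
  ultimately show "f -` S \<inter> space M \<in> sets M"
    unfolding assms(2) by (metis open_in_borel_on)
qed

lemma positive_functional_nonneg: "positive_functional X I \<Longrightarrow> f \<in> Cc X \<Longrightarrow> 0 \<le> I f"
  and positive_functional_add: "positive_functional X I \<Longrightarrow> f \<in> Cc X \<Longrightarrow> g \<in> Cc X \<Longrightarrow>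
    I (\<lambda>x. f x + g x) = I f + I g"
  and positive_functional_scale: "positive_functional X I \<Longrightarrow> f \<in> Cc X \<Longrightarrow> 0 \<le> c \<Longrightarrow>
    I (\<lambda>x. c * f x) = c * I f"
  unfolding positive_functional_def by blast+

lemma positive_functional_mono:
  assumes I: "positive_functional X I" and "f \<in> Cc X" "g \<in> Cc X" "\<And>x. f x \<le> g x"
  shows "I f \<le> I g"
proof -
  have d: "(\<lambda>x. g x - f x) \<in> Cc X" by (rule Cc_diff) (use assms in auto)
  have "I (\<lambda>x. f x + (g x - f x)) = I f + I (\<lambda>x. g x - f x)"
    by (rule positive_functional_add[OF I assms(2) d])
  then show ?thesis using positive_functional_nonneg[OF I d] by simp
qed

lemma positive_functional_zero: "positive_functional X I \<Longrightarrow> I (\<lambda>_. 0) = 0"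
  using positive_functional_scale[OF _ Cc_zero, of X I 0] by simp

lemma positive_functional_sum:
  assumes I: "positive_functional X I" and f: "\<And>i. f i \<in> Cc X"
  shows "(\<lambda>x. \<Sum>i<n. f i x) \<in> Cc X \<and> I (\<lambda>x. \<Sum>i<(n::nat). f i x) = (\<Sum>i<n. I (f i))"
proof (induction n)
  case 0
  then show ?case using positive_functional_zero[OF I] Cc_zero by simp
next
  case (Suc n)
  then show ?case
    using f[of n] Cc_add[of "\<lambda>x. \<Sum>i<n. f i x" X "f n"]
      positive_functional_add[OF I, of "\<lambda>x. \<Sum>i<n. f i x" "f n"] by simp
qed

lemma compact_between:
  assumes "locally_compact_space X" "Hausdorff_space X" "compactin X K" "openin X U" "K \<subseteq> U"
  obtains W D where "openin X W" "compactin X D" "closedin X D" "K \<subseteq> W" "W \<subseteq> D" "D \<subseteq> U"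
proof -
  have "locally_compact_space (subtopology X U)"
    using assms by (simp add: locally_compact_space_open_subset)
  moreover have "Hausdorff_space (subtopology X U)"
    using assms by (simp add: Hausdorff_space_subtopology)
  moreover have "compactin (subtopology X U) K"
    using assms by (simp add: compactin_subtopology)
  ultimately obtain W D where WD: "openin (subtopology X U) W" "compactin (subtopology X U) D"
     "K \<subseteq> W" "W \<subseteq> D"
    using iffD1[OF locally_compact_space_compact_closed_compact[OF disjI1]] by meson
  then have "openin X W" "compactin X D" "D \<subseteq> U"
    using assms by (auto simp: openin_open_subtopology compactin_subtopology)
  then show thesis using that WD assms compactin_imp_closedin by blast
qed

text \<open>
  Urysohn's lemma, applied to \<open>K\<close> and the complement of an open \<open>W \<supseteq> K\<close> with compact closure inside \<open>U\<close>;
  the function is reset to \<open>0\<close> outside the space.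
\<close>

lemma bump_function:
  assumes "locally_compact_space X" "Hausdorff_space X" "compactin X K" "openin X U" "K \<subseteq> U"
  obtains f where "subordinate X U f" "\<And>x. x \<in> K \<Longrightarrow> f x = 1"
proof -
  obtain W D where WD: "openin X W" "compactin X D" "K \<subseteq> W" "W \<subseteq> D" "D \<subseteq> U"
    using compact_between[OF assms] by metis
  have "completely_regular_space X"
    using assms locally_compact_Hausdorff_or_regular
      locally_compact_regular_imp_completely_regular_space by blast
  moreover have "closedin X (topspace X - W)" using WD by blast
  moreover have "disjnt (topspace X - W) K" using WD by (auto simp: disjnt_def)
  ultimately obtain f where f: "continuous_map X (subtopology euclidean {0..1::real}) f"
    "f ` (topspace X - W) \<subseteq> {0}" "f ` K \<subseteq> {1}"
    using Urysohn_completely_regular_compact_closed[of 0 1 X K "topspace X - W"] assms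
    by (metis disjnt_sym zero_le_one)
  define g where "g x = (if x \<in> topspace X then f x else 0)" for x
  have fr: "f x \<in> {0..1}" if "x \<in> topspace X" for x
    using f(1) that by (auto simp: continuous_map_in_subtopology)
  show thesis
  proof (rule that[of g])
    have "continuous_map X euclideanreal g"
      using f(1) continuous_map_eq[of X euclideanreal f g]
      by (auto simp: continuous_map_in_subtopology g_def)
    moreover have "g x = 0" if "x \<notin> D" for x
      using f(2) that WD by (auto simp: g_def)
    ultimately show "subordinate X U g"
      unfolding subordinate_def using WD fr by (intro conjI allI exI[of _ D]) (auto simp: g_def)
    show "g x = 1" if "x \<in> K" for x
      using that f(3) compactin_subset_topspace[OF assms(3)] by (auto simp: g_def)
  qed
qed

section \<open>The Riesz representation theorem\<close>

definition open_content :: "'b topology \<Rightarrow> (('b \<Rightarrow> real) \<Rightarrow> real) \<Rightarrow> 'b set \<Rightarrow> ennreal" where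
  "open_content X I U = (SUP f\<in>Collect (subordinate X U). ennreal (I f))"

definition riesz_outer :: "'b topology \<Rightarrow> (('b \<Rightarrow> real) \<Rightarrow> real) \<Rightarrow> 'b set \<Rightarrow> ennreal" where
  "riesz_outer X I A = (INF U\<in>{U. openin X U \<and> A \<subseteq> U}. open_content X I U)"

text \<open>
  These two properties determine the Borel measure from the functional, so symmetries of the functional are
  inherited by the measure.
\<close>

definition riesz_measure :: "'b topology \<Rightarrow> (('b \<Rightarrow> real) \<Rightarrow> real) \<Rightarrow> 'b measure \<Rightarrow> bool" where
  "riesz_measure X I M \<longleftrightarrow> sets M = sets (borel_on X) \<and>
     (\<forall>U. openin X U \<longrightarrow> emeasure M U = open_content X I U) \<and>
     (\<forall>A\<in>sets M. emeasure M A = (INF U\<in>{U. openin X U \<and> A \<subseteq> U}. emeasure M U))"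

lemma riesz_measure_sets: "riesz_measure X I M \<Longrightarrow> sets M = sets (borel_on X)"
  and riesz_measure_open: "riesz_measure X I M \<Longrightarrow> openin X U \<Longrightarrow> emeasure M U = open_content X I U"
  and riesz_measure_outer_regular: "riesz_measure X I M \<Longrightarrow> A \<in> sets M \<Longrightarrow>
    emeasure M A = (INF U\<in>{U. openin X U \<and> A \<subseteq> U}. emeasure M U)"
  unfolding riesz_measure_def by blast+

lemma open_content_upper: "subordinate X U f \<Longrightarrow> ennreal (I f) \<le> open_content X I U"
  unfolding open_content_def by (rule SUP_upper) auto

lemma open_content_mono: "U \<subseteq> V \<Longrightarrow> open_content X I U \<le> open_content X I V"
  unfolding open_content_def by (rule SUP_subset_mono) (auto intro: subordinate_mono)

lemma riesz_outer_open: "openin X U \<Longrightarrow> riesz_outer X I U = open_content X I U"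
  unfolding riesz_outer_def
  by (rule antisym) (auto intro!: INF_lower INF_greatest open_content_mono)

lemma riesz_outer_mono: "A \<subseteq> B \<Longrightarrow> riesz_outer X I A \<le> riesz_outer X I B"
  unfolding riesz_outer_def by (rule INF_superset_mono) auto

lemma subordinate_empty: "subordinate X {} f \<longleftrightarrow> f = (\<lambda>_. 0)"
  unfolding subordinate_def by auto

text \<open>
  A partition of unity for two sets: with \<open>p \<prec> U\<close> equal to \<open>1\<close> near the part of the support that \<open>V\<close> misses,
  \<open>f = f p + f (1 - p)\<close>.
\<close>

lemma subordinate_Un_split:
  assumes X: "locally_compact_space X" "Hausdorff_space X"
    and U: "openin X U" "openin X V" and f: "subordinate X (U \<union> V) f"
  obtains g h where "subordinate X U g" "subordinate X V h" "f = (\<lambda>x. g x + h x)"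
proof -
  obtain C where C: "compactin X C" "C \<subseteq> U \<union> V" "\<And>x. x \<notin> C \<Longrightarrow> f x = 0"
    using f unfolding subordinate_def by auto
  have fc: "continuous_map X euclideanreal f" and f01: "\<And>x. 0 \<le> f x \<and> f x \<le> 1"
    using f unfolding subordinate_def by auto
  have "closedin X C" using C X compactin_imp_closedin by blast
  have K: "compactin X (C - V)"
    using closed_compactin[OF C(1), of "C - V"] \<open>closedin X C\<close> U by blast
  moreover have "C - V \<subseteq> U" using C by blast
  ultimately obtain W D where WD: "openin X W" "compactin X D" "C - V \<subseteq> W" "W \<subseteq> D" "D \<subseteq> U"
    using compact_between[OF X K U(1)] by metis
  obtain p where p: "subordinate X U p" "\<And>x. x \<in> D \<Longrightarrow> p x = 1"
    using bump_function[OF X WD(2) U(1) WD(5)] by metis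
  obtain P where P: "compactin X P" "P \<subseteq> U" "\<And>x. x \<notin> P \<Longrightarrow> p x = 0"
    using p unfolding subordinate_def by auto
  have pc: "continuous_map X euclideanreal p" and p01: "\<And>x. 0 \<le> p x \<and> p x \<le> 1"
    using p unfolding subordinate_def by auto
  show thesis
  proof (rule that[of "\<lambda>x. f x * p x" "\<lambda>x. f x * (1 - p x)"])
    show "subordinate X U (\<lambda>x. f x * p x)"
      unfolding subordinate_def
      using P f01 p01 fc pc
      by (auto intro!: continuous_map_real_mult exI[of _ P] mult_le_one)
    have "compactin X (C - W)"
      using closed_compactin[OF C(1), of "C - W"] \<open>closedin X C\<close> WD by blast
    moreover have "f x * (1 - p x) = 0" if "x \<notin> C - W" for x
      using that C(3) p(2) WD by (cases "x \<in> C") auto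
    ultimately show "subordinate X V (\<lambda>x. f x * (1 - p x))"
      unfolding subordinate_def
      using f01 p01 fc pc WD
      by (intro conjI exI[of _ "C - W"] allI)
         (auto intro!: continuous_map_real_mult continuous_map_diff mult_le_one mult_nonneg_nonneg)
    show "f = (\<lambda>x. f x * p x + f x * (1 - p x))" by (auto simp: algebra_simps)
  qed
qed

context
  fixes X :: "'b topology" and I :: "('b \<Rightarrow> real) \<Rightarrow> real"
  assumes lcX: "locally_compact_space X" and hausX: "Hausdorff_space X"
    and posI: "positive_functional X I"
begin

lemma open_content_empty: "open_content X I {} = 0"
  unfolding open_content_def subordinate_empty by (simp add: positive_functional_zero[OF posI])

lemma open_content_Un:
  assumes "openin X U" "openin X V"
  shows "open_content X I (U \<union> V) \<le> open_content X I U + open_content X I V"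
  unfolding open_content_def[of X I "U \<union> V"]
proof (rule SUP_least)
  fix f assume "f \<in> Collect (subordinate X (U \<union> V))"
  then obtain g h where gh: "subordinate X U g" "subordinate X V h" "f = (\<lambda>x. g x + h x)"
    using subordinate_Un_split[OF lcX hausX assms] by blast
  then have "ennreal (I f) = ennreal (I g) + ennreal (I h)"
    using positive_functional_add[OF posI] positive_functional_nonneg[OF posI] subordinate_Cc by (metis ennreal_plus)
  also have "\<dots> \<le> open_content X I U + open_content X I V"
    using gh by (intro add_mono open_content_upper)
  finally show "ennreal (I f) \<le> open_content X I U + open_content X I V" .
qed

lemma open_content_UN_finite:
  assumes "\<And>i. openin X (U i)"
  shows "open_content X I (\<Union>i<(n::nat). U i) \<le> (\<Sum>i<n. open_content X I (U i))"
proof (induction n)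
  case (Suc n)
  have "open_content X I (\<Union>i<Suc n. U i) \<le> open_content X I (\<Union>i<n. U i) + open_content X I (U n)"
    using open_content_Un[of "\<Union>i<n. U i" "U n"] assms
    by (simp add: lessThan_Suc Un_commute openin_clauses(3))
  then show ?case using Suc by (auto intro: order_trans add_right_mono)
qed (simp add: open_content_empty)

text \<open>
  A compact support is covered by finitely many of the sets, so countable subadditivity reduces to the splitting
  of functions.
\<close>

lemma open_content_UN:
  assumes "\<And>i::nat. openin X (U i)"
  shows "open_content X I (\<Union>i. U i) \<le> (\<Sum>i. open_content X I (U i))"
  unfolding open_content_def[of X I "\<Union>i. U i"]
proof (rule SUP_least)
  fix f assume "f \<in> Collect (subordinate X (\<Union>i. U i))"
  then obtain C where C: "compactin X C" "C \<subseteq> (\<Union>i. U i)" "\<And>x. x \<notin> C \<Longrightarrow> f x = 0"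
    and f: "subordinate X (\<Union>i. U i) f"
    unfolding subordinate_def by auto
  obtain F where F: "finite F" "F \<subseteq> range U" "C \<subseteq> \<Union>F"
    using C assms compactinD[OF C(1), of "range U"] by auto
  then obtain J where J: "finite J" "F = U ` J"
    by (metis finite_subset_image subset_UNIV)
  then obtain n where n: "J \<subseteq> {..<n}"
    using finite_nat_bounded by (metis lessThan_def)
  have "C \<subseteq> (\<Union>i<n. U i)" using F J n by blast
  then have "subordinate X (\<Union>i<n. U i) f"
    using f C unfolding subordinate_def by blast
  then have "ennreal (I f) \<le> open_content X I (\<Union>i<n. U i)" by (rule open_content_upper)
  also have "\<dots> \<le> (\<Sum>i<n. open_content X I (U i))" by (rule open_content_UN_finite[OF assms])
  also have "\<dots> \<le> (\<Sum>i. open_content X I (U i))" by (intro sum_le_suminf) auto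
  finally show "ennreal (I f) \<le> (\<Sum>i. open_content X I (U i))" .
qed

lemma riesz_outer_close:
  assumes "riesz_outer X I A < c"
  obtains U where "openin X U" "A \<subseteq> U" "open_content X I U < c"
  using assms unfolding riesz_outer_def INF_less_iff by blast

lemma outer_measure_space_riesz: "outer_measure_space (Pow (topspace X)) (riesz_outer X I)"
  unfolding outer_measure_space_def
proof (intro conjI)
  show "positive (Pow (topspace X)) (riesz_outer X I)"
    unfolding positive_def using riesz_outer_open[of X "{}" I] open_content_empty by simp
  show "increasing (Pow (topspace X)) (riesz_outer X I)"
    unfolding increasing_def by (auto intro: riesz_outer_mono)
  show "countably_subadditive (Pow (topspace X)) (riesz_outer X I)"
  proof (simp only: countably_subadditive_def, safe)
    fix A :: "nat \<Rightarrow> 'b set"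
    show "riesz_outer X I (\<Union>i. A i) \<le> (\<Sum>n. riesz_outer X I (A n))"
    proof (rule ennreal_le_epsilon)
      fix b and e :: real
      assume e: "0 < e" and fin: "(\<Sum>n. riesz_outer X I (A n)) < top"
      have *: "\<exists>U. openin X U \<and> A n \<subseteq> U \<and> open_content X I U < riesz_outer X I (A n) + e * (1/2)^Suc n" for n
      proof -
        have "riesz_outer X I (A n) < top" using fin
          by (metis ennreal_suminf_lessD)
        then have "riesz_outer X I (A n) < riesz_outer X I (A n) + e * (1/2)^Suc n"
          using e by (auto simp: less_top)
        then show ?thesis using riesz_outer_close by metis
      qed
      obtain U where U: "\<And>n. openin X (U n)" "\<And>n. A n \<subseteq> U n"
        "\<And>n. open_content X I (U n) < riesz_outer X I (A n) + e * (1/2)^Suc n"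
        using * by metis
      have "riesz_outer X I (\<Union>i. A i) \<le> riesz_outer X I (\<Union>i. U i)"
        using U by (intro riesz_outer_mono) blast
      also have "\<dots> = open_content X I (\<Union>i. U i)"
        using U by (intro riesz_outer_open) blast
      also have "\<dots> \<le> (\<Sum>n. open_content X I (U n))" by (rule open_content_UN[OF U(1)])
      also have "\<dots> \<le> (\<Sum>n. riesz_outer X I (A n) + e * (1/2)^Suc n)"
        using U by (intro suminf_le) (auto simp: less_imp_le)
      also have "\<dots> = (\<Sum>n. riesz_outer X I (A n)) + (\<Sum>n. ennreal e * ennreal ((1/2) ^ Suc n))"
      proof -
        have "ennreal (e * (1/2)^Suc n) = ennreal e * ennreal ((1/2)^Suc n)" for n
          using e by (intro ennreal_mult) auto
        then show ?thesis by (simp only: suminf_add[OF summableI summableI, symmetric])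
      qed
      also have "\<dots> = (\<Sum>n. riesz_outer X I (A n)) + e"
        unfolding ennreal_suminf_cmult
        by (subst suminf_ennreal_eq[OF zero_le_power power_half_series]) auto
      finally show "riesz_outer X I (\<Union>i. A i) \<le> (\<Sum>n. riesz_outer X I (A n)) + e" .
    qed
  qed
qed

text \<open>
  For open \<open>V\<close> and \<open>f \<prec> V \<inter> U\<close> with support in the compact set \<open>C\<close>, every \<open>g \<prec> V - C\<close> satisfies \<open>f + g \<prec> V\<close>,
  because the supports are disjoint. Taking suprema over \<open>g\<close> and then over \<open>f\<close> yields Caratheodory's condition for
  open test sets, and outer regularity extends it to all test sets.
\<close>

lemma open_in_lambda_system:
  assumes U: "openin X U"
  shows "U \<in> lambda_system (topspace X) (Pow (topspace X)) (riesz_outer X I)"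
proof -
  interpret sigma_algebra "topspace X" "Pow (topspace X)" by (rule sigma_algebra_Pow)
  let ?m = "riesz_outer X I" and ?c = "open_content X I"
  have split: "?c (V \<inter> U) + ?m (V - U) \<le> ?c V" if V: "openin X V" for V
  proof -
    have "ennreal (I f) + ?m (V - U) \<le> ?c V" if f: "subordinate X (V \<inter> U) f" for f
    proof -
      obtain C where C: "compactin X C" "C \<subseteq> V \<inter> U" "\<And>x. x \<notin> C \<Longrightarrow> f x = 0"
        using f unfolding subordinate_def by auto
      have VC: "openin X (V - C)"
        using V C hausX compactin_imp_closedin by blast
      have *: "ennreal (I f) + ennreal (I g) \<le> ?c V" if g: "subordinate X (V - C) g" for g
      proof -
        obtain D where D: "compactin X D" "D \<subseteq> V - C" "\<And>x. x \<notin> D \<Longrightarrow> g x = 0"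
          using g unfolding subordinate_def by auto
        have "f x + g x \<le> 1" for x
          using C(3)[of x] D(2) D(3)[of x] f g unfolding subordinate_def by (cases "x \<in> C") auto
        then have "subordinate X V (\<lambda>x. f x + g x)"
          using f g C D unfolding subordinate_def
          by (intro conjI exI[of _ "C \<union> D"] allI)
             (auto intro!: continuous_map_add compactin_Un)
        then have "ennreal (I (\<lambda>x. f x + g x)) \<le> ?c V" by (rule open_content_upper)
        then show ?thesis
          using positive_functional_add[OF posI subordinate_Cc[OF f] subordinate_Cc[OF g]]
            positive_functional_nonneg[OF posI subordinate_Cc[OF f]] positive_functional_nonneg[OF posI subordinate_Cc[OF g]] by simp
      qed
      have "?m (V - U) \<le> ?c (V - C)"
        unfolding riesz_outer_def using VC C by (intro INF_lower) auto
      then have "ennreal (I f) + ?m (V - U) \<le> ennreal (I f) + ?c (V - C)" by (rule add_left_mono)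
      also have "\<dots> = (SUP g\<in>Collect (subordinate X (V - C)). ennreal (I f) + ennreal (I g))"
        unfolding open_content_def
        by (rule ennreal_SUP_add_right) (auto simp: subordinate_def intro!: exI[of _ "\<lambda>_. 0"])
      also have "\<dots> \<le> ?c V" using * by (intro SUP_least) auto
      finally show ?thesis .
    qed
    moreover have "?c (V \<inter> U) + ?m (V - U) =
        (SUP f\<in>Collect (subordinate X (V \<inter> U)). ennreal (I f) + ?m (V - U))"
      unfolding open_content_def[of X I "V \<inter> U"]
      by (rule ennreal_SUP_add_left[symmetric]) (auto simp: subordinate_def intro!: exI[of _ "\<lambda>_. 0"])
    ultimately show ?thesis by (simp only:) (rule SUP_least, auto)
  qed
  have "?m (A \<inter> U) + ?m (A - U) = ?m A" if A: "A \<subseteq> topspace X" for A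
  proof (rule antisym)
    show "?m (A \<inter> U) + ?m (A - U) \<le> ?m A"
      unfolding riesz_outer_def[of X I A]
    proof (rule INF_greatest, safe)
      fix V assume V: "openin X V" "A \<subseteq> V"
      have "?m (A \<inter> U) + ?m (A - U) \<le> ?m (V \<inter> U) + ?m (V - U)"
        using V by (intro add_mono riesz_outer_mono) auto
      also have "\<dots> \<le> ?c V" using split[OF V(1)] riesz_outer_open[OF openin_Int[OF V(1) U]] by simp
      finally show "?m (A \<inter> U) + ?m (A - U) \<le> ?c V" .
    qed
    have "subadditive (Pow (topspace X)) ?m"
      using outer_measure_space_riesz countably_subadditive_subadditive[of ?m]
      unfolding outer_measure_space_def by blast
    then have "?m ((A \<inter> U) \<union> (A - U)) \<le> ?m (A \<inter> U) + ?m (A - U)"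
      by (rule subadditiveD) (use A in auto)
    moreover have "(A \<inter> U) \<union> (A - U) = A" by blast
    ultimately show "?m A \<le> ?m (A \<inter> U) + ?m (A - U)" by simp
  qed
  then show ?thesis
    using openin_subset[OF U] by (auto simp: lambda_system_eq)
qed

theorem riesz_representation:
  obtains M where "riesz_measure X I M"
proof -
  let ?S = "{U. openin X U}" and ?m = "riesz_outer X I"
  let ?L = "lambda_system (topspace X) (Pow (topspace X)) ?m"
  define M where "M = measure_of (topspace X) ?S ?m"
  have SP: "?S \<subseteq> Pow (topspace X)" by (auto dest: openin_subset)
  have ms: "measure_space (topspace X) ?L ?m"
    using sigma_algebra.caratheodory_lemma[OF sigma_algebra_Pow outer_measure_space_riesz] .
  then have sa: "sigma_algebra (topspace X) ?L" and ca: "countably_additive ?L ?m"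
    and po: "positive ?L ?m"
    unfolding measure_space_def by auto
  have sets: "sets M = sigma_sets (topspace X) ?S"
    unfolding M_def using SP by (rule sets_measure_of)
  have sub: "sets M \<subseteq> ?L"
    unfolding sets
    by (rule sigma_algebra.sigma_sets_subset[OF sa]) (auto intro: open_in_lambda_system)
  have em: "emeasure M A = ?m A" if "A \<in> sets M" for A
    using M_def SP
  proof (rule emeasure_measure_of)
    show "positive (sets M) ?m" using po unfolding positive_def .
    show "countably_additive (sets M) ?m" using ca sub unfolding countably_additive_def by blast
  qed fact
  have o: "emeasure M U = open_content X I U" if "openin X U" for U
    using that sets by (subst em) (auto simp: riesz_outer_open)
  have "sets M = sets (borel_on X)"
    unfolding sets borel_on_def using SP by (simp add: sets_measure_of)
  moreover have "emeasure M A = (INF U\<in>{U. openin X U \<and> A \<subseteq> U}. emeasure M U)" if "A \<in> sets M" for A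
    using that o by (simp add: em riesz_outer_def)
  ultimately show thesis using that[of M] o unfolding riesz_measure_def by blast
qed

text \<open>
  For \<open>d < c\<close> the set \<open>{g > d}\<close> is an open neighbourhood of \<open>A\<close>, and \<open>h \<prec> {g > d}\<close> forces \<open>h \<le> g / d\<close>. Let
  \<open>d\<close> tend to \<open>c\<close>.
\<close>

lemma riesz_upper:
  assumes R: "riesz_measure X I M"
    and g: "g \<in> Cc X" "0 < c" "\<And>x. x \<in> A \<Longrightarrow> c \<le> g x" and A: "A \<subseteq> topspace X"
  shows "ennreal c * emeasure M A \<le> ennreal (I g)"
proof -
  note sets = riesz_measure_sets[OF R] and M = riesz_measure_open[OF R]
  have le: "ennreal d * emeasure M A \<le> ennreal (I g)" if d: "0 < d" "d < c" for d
  proof -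
    define V where "V = {x \<in> topspace X. g x \<in> {d<..}}"
    have V: "openin X V"
      unfolding V_def using Cc_cont[OF g(1)] by (rule openin_continuous_map_preimage) auto
    have "ennreal (I h) \<le> ennreal (I g / d)" if h: "subordinate X V h" for h
    proof -
      have "h x \<le> (1/d) * g x" for x
      proof (cases "x \<in> V")
        case True
        then have "1 \<le> g x / d" using d by (auto simp: V_def)
        then show ?thesis using h unfolding subordinate_def by (auto intro: order_trans)
      next
        case False
        then have "h x = 0" using h unfolding subordinate_def by auto
        then show ?thesis using Cc_nonneg[OF g(1)] d by simp
      qed
      then have "I h \<le> I (\<lambda>x. (1/d) * g x)"
        using d by (intro positive_functional_mono[OF posI] subordinate_Cc[OF h] Cc_scale g) auto
      also have "\<dots> = I g / d" using positive_functional_scale[OF posI g(1), of "1/d"] d by simp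
      finally show ?thesis by (rule ennreal_leI)
    qed
    then have "open_content X I V \<le> ennreal (I g / d)"
      unfolding open_content_def by (intro SUP_least) auto
    moreover have "emeasure M A \<le> emeasure M V"
    proof (rule emeasure_mono)
      show "A \<subseteq> V" using A g d unfolding V_def by fastforce
      show "V \<in> sets M" using V unfolding sets by (rule open_in_borel_on)
    qed
    ultimately have "ennreal d * emeasure M A \<le> ennreal d * ennreal (I g / d)"
      using M[OF V] by (intro mult_left_mono) auto
    also have "\<dots> = ennreal (I g)"
      using d positive_functional_nonneg[OF posI g(1)] by (subst ennreal_mult[symmetric]) auto
    finally show ?thesis .
  qed
  have fin: "emeasure M A < top"
  proof -
    have "ennreal (c/2) * emeasure M A < top"
      using le[of "c/2"] g(2) by (auto intro: le_less_trans)
    then show ?thesis using g(2) by (auto simp: ennreal_mult_less_top)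
  qed
  then obtain m where m: "emeasure M A = ennreal m" "0 \<le> m" by (metis less_top ennreal_cases)
  have "c * m \<le> I g"
  proof (rule field_le_mult_one_interval)
    fix z :: real assume z: "0 < z" "z < 1"
    have "ennreal ((z * c) * m) \<le> ennreal (I g)"
      using le[of "z * c"] z g(2) m by (simp add: ennreal_mult)
    then show "z * (c * m) \<le> I g" using positive_functional_nonneg[OF posI g(1)] by (simp add: mult.assoc)
  qed
  then show ?thesis using m g(2) by (simp add: ennreal_mult[symmetric] ennreal_leI)
qed

text \<open>
  The function \<open>g / c\<close> is subordinate to every open \<open>U \<supseteq> C\<close>; outer regularity of \<open>C\<close> does the rest.
\<close>

lemma riesz_lower:
  assumes R: "riesz_measure X I M" and C: "compactin X C" "C \<in> sets M"
    and g: "g \<in> Cc X" "0 < c" "\<And>x. g x \<le> c" "\<And>x. x \<notin> C \<Longrightarrow> g x = 0"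
  shows "ennreal (I g) \<le> ennreal c * emeasure M C"
proof -
  note M = riesz_measure_open[OF R] and reg = riesz_measure_outer_regular[OF R]
  define h where "h = (\<lambda>x. (1/c) * g x)"
  have hC: "h \<in> Cc X" unfolding h_def using g by (intro Cc_scale) auto
  have "ennreal (I h) \<le> emeasure M U" if U: "openin X U" "C \<subseteq> U" for U
  proof -
    have "subordinate X U h"
      unfolding subordinate_def
      using Cc_cont[OF hC] g U C Cc_nonneg[OF g(1)] by (auto simp: h_def)
    then show ?thesis using open_content_upper M[OF U(1)] by metis
  qed
  then have "ennreal (I h) \<le> emeasure M C" unfolding reg[OF C(2)] by (intro INF_greatest) auto
  then have "ennreal c * ennreal (I h) \<le> ennreal c * emeasure M C" by (rule mult_left_mono) simp
  moreover have "ennreal c * ennreal (I h) = ennreal (I g)"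
    using positive_functional_scale[OF posI g(1), of "1/c"] g(2) positive_functional_nonneg[OF posI g(1)] unfolding h_def
    by (subst ennreal_mult[symmetric]) auto
  ultimately show ?thesis by simp
qed

lemma riesz_finite:
  assumes R: "riesz_measure X I M" and C: "compactin X C"
  shows "emeasure M C < top"
proof -
  obtain f where f: "subordinate X (topspace X) f" "\<And>x. x \<in> C \<Longrightarrow> f x = 1"
    using bump_function[OF lcX hausX C openin_topspace compactin_subset_topspace[OF C]] by metis
  have "ennreal 1 * emeasure M C \<le> ennreal (I f)"
    using f by (intro riesz_upper[OF R subordinate_Cc[OF f(1)]] compactin_subset_topspace[OF C]) auto
  then show ?thesis by (simp add: le_less_trans[OF _ ennreal_less_top])
qed

text \<open>
  Cut \<open>f\<close> into horizontal layers of height \<open>e\<close>. The layer between \<open>ie\<close> and \<open>(i+1)e\<close> equals \<open>e\<close> where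
  \<open>f \<ge> (i+1)e\<close> and vanishes where \<open>f < ie\<close>, so both its integral and the value of \<open>I\<close> at it lie between
  \<open>e\<close> times the measures of these two sets. Summed over the layers, the bounds telescope to
  a total error of at most \<open>e\<close> times the measure of the support.
\<close>

lemma riesz_integral:
  assumes R: "riesz_measure X I M" and f: "f \<in> Cc X"
  shows "(\<integral>\<^sup>+x. ennreal (f x) \<partial>M) = ennreal (I f)"
proof -
  note sets = riesz_measure_sets[OF R]
  obtain C where C: "compactin X C" "\<And>x. x \<notin> C \<Longrightarrow> f x = 0" using f by (metis CcE)
  obtain B where B: "0 < B" "\<And>x. f x \<le> B" using Cc_bounded[OF f] by metis
  have closed_sets: "A \<in> sets M" if "closedin X A" for A
    using closed_in_borel_on[OF that] sets by simp
  have key: "\<exists>v. (\<integral>\<^sup>+x. ennreal (f x) \<partial>M) = ennreal v \<and> 0 \<le> v \<and> \<bar>I f - v\<bar> \<le> e * measure M C"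
    if e: "0 < e" for e :: real
  proof -
    obtain n :: nat where n: "B \<le> real n * e"
      using e by (metis reals_Archimedean3 less_imp_le)
    \<comment> \<open>The set at index \<open>0\<close> is the compact support, since \<open>{f \<ge> 0}\<close> is the whole space.\<close>
    define A where "A i = (if i = 0 then C else {x \<in> topspace X. f x \<in> {real i * e..}})" for i
    define g where "g i x = min (max (f x - real i * e) 0) e" for i x
    have Csub: "A i \<subseteq> C" for i
    proof
      fix x assume x: "x \<in> A i"
      show "x \<in> C"
      proof (rule ccontr)
        assume n: "x \<notin> C"
        then have "0 < real i * e" using x e by (auto simp: A_def split: if_splits)
        then show False using x n C(2)[OF n] by (auto simp: A_def split: if_splits)
      qed
    qed
    have Ac: "closedin X (A i)" for i
      using compactin_imp_closedin[OF hausX C(1)]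
        closedin_continuous_map_preimage[OF Cc_cont[OF f], of "{real i * e..}"]
      by (auto simp: A_def)
    have AC: "compactin X (A i)" for i using closed_compactin[OF C(1) Csub Ac] .
    have As: "A i \<in> sets M" for i using closed_sets[OF Ac] .
    have gC: "g i \<in> Cc X" for i
    proof (rule CcI[OF _ _ C(1)])
      show "continuous_map X euclideanreal (g i)"
        unfolding g_def using Cc_cont[OF f]
        by (intro continuous_map_real_min continuous_map_real_max continuous_map_diff) auto
      show "g i x = 0" if "x \<notin> C" for x using C(2)[OF that] e by (simp add: g_def)
    qed (use e in \<open>auto simp: g_def\<close>)
    have gz: "g i x = 0" if "x \<notin> A i" for i x
    proof (cases "x \<in> C")
      case True
      then have "x \<in> topspace X" using compactin_subset_topspace[OF C(1)] by blast
      then have "f x < real i * e" using that True by (auto simp: A_def split: if_splits)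
      then show ?thesis using e by (simp add: g_def)
    next
      case False
      then show ?thesis using C(2)[OF False] e by (simp add: g_def)
    qed
    have gub: "g i x \<le> e" for i x by (simp add: g_def)
    have glb: "e \<le> g i x" if "x \<in> A (Suc i)" for i x
      using that by (auto simp: A_def g_def algebra_simps max_def)
    have gsum: "(\<Sum>i<k. g i x) = min (f x) (real k * e)" for k x
    proof (induction k)
      case 0 then show ?case using Cc_nonneg[OF f, of x] by simp
    next
      case (Suc k) then show ?case using e by (auto simp: g_def min_def max_def algebra_simps)
    qed
    have fsum: "f = (\<lambda>x. \<Sum>i<n. g i x)"
      unfolding gsum using B(2) n by (auto simp: min_def fun_eq_iff intro: order_trans antisym)
    define m where "m i = measure M (A i)" for i
    have em: "emeasure M (A i) = ennreal (m i)" for i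
      unfolding m_def using riesz_finite[OF R AC] by (simp add: emeasure_eq_ennreal_measure less_top)
    have m0: "0 \<le> m i" for i unfolding m_def by simp
    have I1: "I (g i) \<le> e * m i" for i
    proof -
      have "ennreal (I (g i)) \<le> ennreal e * emeasure M (A i)"
        using riesz_lower[OF R AC As gC e gub gz] by simp
      then show ?thesis using e m0 by (simp add: em ennreal_mult[symmetric])
    qed
    have I2: "e * m (Suc i) \<le> I (g i)" for i
    proof -
      have "ennreal e * emeasure M (A (Suc i)) \<le> ennreal (I (g i))"
        using riesz_upper[OF R gC e glb] closedin_subset[OF Ac] by simp
      then show ?thesis using e m0 positive_functional_nonneg[OF posI gC] by (simp add: em ennreal_mult[symmetric])
    qed
    have gm: "(\<lambda>x. ennreal (g i x)) \<in> borel_measurable M" for i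
      using Cc_measurable[OF gC sets] by simp
    have J1: "(\<integral>\<^sup>+x. ennreal (g i x) \<partial>M) \<le> ennreal (e * m i)" for i
    proof -
      have "(\<integral>\<^sup>+x. ennreal (g i x) \<partial>M) \<le> (\<integral>\<^sup>+x. ennreal e * indicator (A i) x \<partial>M)"
        using gub gz by (intro nn_integral_mono) (auto simp: indicator_def intro: ennreal_leI)
      also have "\<dots> = ennreal (e * m i)"
        using As e m0 by (simp add: nn_integral_cmult_indicator em ennreal_mult)
      finally show ?thesis .
    qed
    have J2: "ennreal (e * m (Suc i)) \<le> (\<integral>\<^sup>+x. ennreal (g i x) \<partial>M)" for i
    proof -
      have "ennreal (e * m (Suc i)) = (\<integral>\<^sup>+x. ennreal e * indicator (A (Suc i)) x \<partial>M)"
        using As e m0 by (simp add: nn_integral_cmult_indicator em ennreal_mult)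
      also have "\<dots> \<le> (\<integral>\<^sup>+x. ennreal (g i x) \<partial>M)"
        using glb by (intro nn_integral_mono) (auto simp: indicator_def intro: ennreal_leI)
      finally show ?thesis .
    qed
    define v where "v i = enn2real (\<integral>\<^sup>+x. ennreal (g i x) \<partial>M)" for i
    have vi: "(\<integral>\<^sup>+x. ennreal (g i x) \<partial>M) = ennreal (v i)" for i
      unfolding v_def using le_less_trans[OF J1[of i] ennreal_less_top] by simp
    have v0: "0 \<le> v i" for i by (simp add: v_def)
    have v1: "v i \<le> e * m i" and v2: "e * m (Suc i) \<le> v i" for i
      using J1[of i] J2[of i] v0[of i] m0[of i] e by (simp_all add: vi)
    have "(\<integral>\<^sup>+x. ennreal (f x) \<partial>M) = (\<integral>\<^sup>+x. (\<Sum>i<n. ennreal (g i x)) \<partial>M)"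
      using Cc_nonneg[OF gC] by (subst fsum) (simp add: sum_ennreal)
    also have "\<dots> = (\<Sum>i<n. ennreal (v i))"
      using gm by (simp add: nn_integral_sum vi)
    also have "\<dots> = ennreal (\<Sum>i<n. v i)" using v0 by (simp add: sum_ennreal)
    finally have int: "(\<integral>\<^sup>+x. ennreal (f x) \<partial>M) = ennreal (\<Sum>i<n. v i)" .
    have If: "I f = (\<Sum>i<n. I (g i))"
      using positive_functional_sum[where f = g and n = n, OF posI gC] fsum by metis
    have tel: "(\<Sum>i<n. e * m i) \<le> e * m 0 + (\<Sum>i<n. e * m (Suc i))"
      using sum.lessThan_Suc_shift[of "\<lambda>i. e * m i" n] sum.lessThan_Suc[of "\<lambda>i. e * m i" n] e m0[of n]
        mult_nonneg_nonneg[of e "m n"] by linarith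
    have "(\<Sum>i<n. I (g i)) \<le> (\<Sum>i<n. e * m i)" "(\<Sum>i<n. v i) \<le> (\<Sum>i<n. e * m i)"
      "(\<Sum>i<n. e * m (Suc i)) \<le> (\<Sum>i<n. I (g i))" "(\<Sum>i<n. e * m (Suc i)) \<le> (\<Sum>i<n. v i)"
      using I1 I2 v1 v2 by (auto intro!: sum_mono)
    then have "\<bar>I f - (\<Sum>i<n. v i)\<bar> \<le> e * m 0" using tel If by linarith
    moreover have "m 0 = measure M C" by (simp add: m_def A_def)
    ultimately show ?thesis using int v0 by (auto intro!: exI[of _ "\<Sum>i<n. v i"] sum_nonneg)
  qed
  obtain v where v: "(\<integral>\<^sup>+x. ennreal (f x) \<partial>M) = ennreal v" "0 \<le> v" using key[of 1] by auto
  have "\<bar>I f - v\<bar> \<le> e" if e: "0 < e" for e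
  proof -
    define d where "d = e / (measure M C + 1)"
    have d: "0 < d" unfolding d_def using e by (simp add: add_nonneg_pos)
    have "\<bar>I f - v\<bar> \<le> d * measure M C" using key[OF d] v by auto
    also have "\<dots> \<le> e"
    proof -
      have "0 < measure M C + 1" by (simp add: add_nonneg_pos)
      then show ?thesis unfolding d_def using e by (simp add: pos_divide_le_eq)
    qed
    finally show ?thesis .
  qed
  then have "\<bar>I f - v\<bar> \<le> 0 + e" if "0 < e" for e using that by simp
  then have "\<bar>I f - v\<bar> \<le> 0" by (rule field_le_epsilon)
  then show ?thesis using v by simp
qed

lemma open_content_invariant:
  assumes T: "continuous_map X X T" "continuous_map X X S" "\<And>x. T (S x) = x" "\<And>x. S (T x) = x"
    and inv: "\<And>f. f \<in> Cc X \<Longrightarrow> I (\<lambda>x. f (T x)) = I f"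
  shows "open_content X I (T ` U) \<le> open_content X I U"
  unfolding open_content_def[of X I "T ` U"]
proof (rule SUP_least)
  fix f assume "f \<in> Collect (subordinate X (T ` U))"
  then have f: "subordinate X (T ` U) f" by simp
  then obtain C where C: "compactin X C" "C \<subseteq> T ` U" "\<And>x. x \<notin> C \<Longrightarrow> f x = 0"
    unfolding subordinate_def by auto
  have "compactin X (S ` C)" by (rule image_compactin[OF C(1) T(2)])
  moreover have "S ` C \<subseteq> U" using C(2) T(4) by auto
  moreover have "f (T x) = 0" if "x \<notin> S ` C" for x using that C(3) T(4) by (metis imageI)
  moreover have "continuous_map X euclideanreal (\<lambda>x. f (T x))"
    using continuous_map_compose[OF T(1), of euclideanreal f] f by (simp add: subordinate_def o_def)
  ultimately have "subordinate X U (\<lambda>x. f (T x))"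
    using f unfolding subordinate_def by blast
  then show "ennreal (I f) \<le> open_content X I U"
    using inv[OF subordinate_Cc[OF f]] open_content_upper[of X U "\<lambda>x. f (T x)" I] by simp
qed

lemma riesz_invariant:
  assumes R: "riesz_measure X I M"
    and T: "continuous_map X X T" "continuous_map X X S" "\<And>x. T (S x) = x" "\<And>x. S (T x) = x"
    and inv: "\<And>f. f \<in> Cc X \<Longrightarrow> I (\<lambda>x. f (T x)) = I f"
    and A: "A \<in> sets M"
  shows "emeasure M (T ` A) = emeasure M A"
proof -
  note sets = riesz_measure_sets[OF R] and M = riesz_measure_open[OF R] and reg = riesz_measure_outer_regular[OF R]
  have image_eq: "F ` B = G -` B \<inter> topspace X"
    if "continuous_map X X F" "\<And>x. F (G x) = x" "\<And>x. G (F x) = x" "B \<subseteq> topspace X" for F G B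
  proof (intro equalityI subsetI IntI vimageI2)
    fix x assume x: "x \<in> F ` B"
    then show "G x \<in> B" using that(3) by auto
    show "x \<in> topspace X" using x that(4) continuous_map_image_subset_topspace[OF that(1)] by blast
  next
    fix x assume "x \<in> G -` B \<inter> topspace X"
    then show "x \<in> F ` B" using that(2) by (metis IntD1 imageI vimage_eq)
  qed
  have le: "emeasure M (F ` B) \<le> emeasure M B"
    if F: "continuous_map X X F" "continuous_map X X G" "\<And>x. F (G x) = x" "\<And>x. G (F x) = x"
      "\<And>f. f \<in> Cc X \<Longrightarrow> I (\<lambda>x. f (F x)) = I f" and B: "B \<in> sets M" for F G B
    unfolding reg[OF B]
  proof (rule INF_greatest, safe)
    fix U assume U: "openin X U" "B \<subseteq> U"
    have "F ` U = {x \<in> topspace X. G x \<in> U}"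
      using image_eq[OF F(1,3,4) openin_subset[OF U(1)]] by auto
    then have o: "openin X (F ` U)"
      using openin_continuous_map_preimage[OF F(2) U(1)] by simp
    then have "emeasure M (F ` B) \<le> emeasure M (F ` U)"
      using U(2) sets open_in_borel_on by (intro emeasure_mono) auto
    also have "\<dots> \<le> emeasure M U"
      using open_content_invariant[OF F] M o U by simp
    finally show "emeasure M (F ` B) \<le> emeasure M U" .
  qed
  have invS: "I (\<lambda>x. f (S x)) = I f" if f: "f \<in> Cc X" for f
  proof -
    obtain C where C: "compactin X C" "\<And>x. x \<notin> C \<Longrightarrow> f x = 0" using f by (metis CcE)
    have "(\<lambda>x. f (S x)) \<in> Cc X"
    proof (rule CcI)
      show "continuous_map X euclideanreal (\<lambda>x. f (S x))"
        using continuous_map_compose[OF T(2) Cc_cont[OF f]] by (simp add: o_def)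
      show "compactin X (T ` C)" by (rule image_compactin[OF C(1) T(1)])
      show "f (S x) = 0" if "x \<notin> T ` C" for x using that C(2) T(3) by (metis imageI)
    qed (use Cc_nonneg[OF f] in auto)
    then have "I (\<lambda>x. f (S (T x))) = I (\<lambda>x. f (S x))" by (rule inv)
    then show ?thesis using T(4) by simp
  qed
  have sp: "A \<subseteq> topspace X" using sets.sets_into_space[OF A] sets_eq_imp_space_eq[OF sets] by simp
  have TA: "T ` A \<in> sets M"
    using measurable_sets[OF continuous_map_measurable[OF T(2)], of A] A
      image_eq[OF T(1,3,4) sp] sets by simp
  have "emeasure M (S ` (T ` A)) \<le> emeasure M (T ` A)"
    by (rule le[OF T(2,1,4,3) invS TA])
  moreover have "S ` (T ` A) = A" using T(4) by (auto simp: image_image)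
  moreover have "emeasure M (T ` A) \<le> emeasure M A" by (rule le[OF T inv A])
  ultimately show ?thesis by simp
qed

text \<open>
  Inner regularity on an open set is the definition of its measure as a supremum: if \<open>f \<prec> U\<close> has support in \<open>C\<close>
  then \<open>I f\<close> is at most the measure of \<open>C\<close>.
\<close>

lemma riesz_radon:
  assumes R: "riesz_measure X I M"
  shows "radon_measure X M"
  unfolding radon_measure_def
proof (intro conjI allI impI ballI)
  note sets = riesz_measure_sets[OF R] and M = riesz_measure_open[OF R] and reg = riesz_measure_outer_regular[OF R]
  show "emeasure M K < \<infinity>" if "compactin X K" for K
    using riesz_finite[OF R that] by simp
  fix U assume U: "openin X U"
  show "emeasure M U = (SUP K\<in>{K. compactin X K \<and> K \<subseteq> U}. emeasure M K)"
  proof (rule antisym)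
    show "emeasure M U \<le> (SUP K\<in>{K. compactin X K \<and> K \<subseteq> U}. emeasure M K)"
      unfolding M[OF U] open_content_def
    proof (rule SUP_least)
      fix f assume "f \<in> Collect (subordinate X U)"
      then obtain C where f: "subordinate X U f"
        and C: "compactin X C" "C \<subseteq> U" "\<And>x. x \<notin> C \<Longrightarrow> f x = 0"
        unfolding subordinate_def by auto
      have "C \<in> sets M"
        using closed_in_borel_on[OF compactin_imp_closedin[OF hausX C(1)]] sets by simp
      then have "ennreal (I f) \<le> ennreal 1 * emeasure M C"
        using f C by (intro riesz_lower[OF R C(1)] subordinate_Cc[OF f]) (auto simp: subordinate_def)
      then show "ennreal (I f) \<le> (SUP K\<in>{K. compactin X K \<and> K \<subseteq> U}. emeasure M K)"
        using C by (intro SUP_upper2[of C]) auto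
    qed
    show "(SUP K\<in>{K. compactin X K \<and> K \<subseteq> U}. emeasure M K) \<le> emeasure M U"
    proof (rule SUP_least)
      fix K assume "K \<in> {K. compactin X K \<and> K \<subseteq> U}"
      then show "emeasure M K \<le> emeasure M U"
        using open_in_borel_on[OF U] sets by (intro emeasure_mono) auto
    qed
  qed
qed (use riesz_measure_sets[OF R] riesz_measure_outer_regular[OF R] in auto)

end

lemma sets_borel_on_euclidean: "sets (borel_on euclidean) = sets borel"
  by (simp add: borel_on_def borel_def)

lemma Cc_borel:
  assumes "f \<in> Cc euclidean" "sets M = sets borel"
  shows "(\<lambda>x. ennreal (f x)) \<in> borel_measurable M"
proof -
  have "sets M = sets (borel_on euclidean)" using assms(2) sets_borel_on_euclidean by blast
  from measurable_compose[OF Cc_measurable[OF assms(1) this] measurable_ennreal] show ?thesis .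
qed

section \<open>Cluster points of bounded families of functionals\<close>

text \<open>
  Tychonoff's theorem for the product of the intervals \<open>[-B i, B i]\<close>, phrased with filters: along a finer filter
  \<open>G\<close> every coordinate converges. Properties of the \<open>v k\<close> that hold eventually along \<open>F\<close>, exactly or
  approximately, pass to the limit \<open>J\<close> one coordinate at a time.
\<close>

lemma bounded_family_cluster:
  fixes v :: "'k \<Rightarrow> 'i \<Rightarrow> real"
  assumes F: "F \<noteq> bot" and B: "\<And>k i. \<bar>v k i\<bar> \<le> B i"
  obtains G J where "G \<le> F" "G \<noteq> bot" "\<And>i. ((\<lambda>k. v k i) \<longlongrightarrow> J i) G"
proof -
  have "compactin (product_topology (\<lambda>_. euclideanreal) UNIV) (PiE UNIV (\<lambda>i. {- B i..B i}))"
    by (subst compactin_PiE) auto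
  then have "compact (PiE UNIV (\<lambda>i. {- B i..B i}))"
    by (simp add: euclidean_product_topology)
  moreover have "eventually (\<lambda>y. y \<in> PiE UNIV (\<lambda>i. {- B i..B i})) (filtermap v F)"
    using B by (auto simp: eventually_filtermap PiE_UNIV_domain abs_le_iff minus_le_iff intro!: always_eventually)
  moreover have "filtermap v F \<noteq> bot" using F by (simp add: filtermap_bot_iff)
  ultimately obtain J where J: "inf (nhds J) (filtermap v F) \<noteq> bot"
    unfolding compact_filter by blast
  define G where "G = inf F (filtercomap v (nhds J))"
  have "G \<noteq> bot"
  proof
    assume "G = bot"
    then have "eventually (\<lambda>_. False) (inf F (filtercomap v (nhds J)))" by (simp add: G_def)
    then obtain P Q where P: "eventually P F" and Q: "eventually Q (filtercomap v (nhds J))"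
      and PQ: "\<And>k. P k \<Longrightarrow> Q k \<Longrightarrow> False"
      unfolding eventually_inf by auto
    obtain R where R: "eventually R (nhds J)" "\<And>k. R (v k) \<Longrightarrow> Q k"
      using Q unfolding eventually_filtercomap by auto
    have "eventually (\<lambda>y. \<not> R y) (filtermap v F)"
      unfolding eventually_filtermap using P by eventually_elim (use R(2) PQ in blast)
    then have "eventually (\<lambda>_. False) (inf (nhds J) (filtermap v F))"
      unfolding eventually_inf using R(1) by blast
    then show False using J by (simp add: trivial_limit_def)
  qed
  moreover have vJ: "filterlim v (nhds J) G"
    unfolding filterlim_def G_def
    by (meson filtermap_filtercomap filtermap_mono inf_le2 order_trans)
  moreover have "((\<lambda>k. v k i) \<longlongrightarrow> J i) G" for i
    proof (rule topological_tendstoI)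
      fix S :: "real set" assume S: "open S" "J i \<in> S"
      have "open ((\<lambda>y::'i \<Rightarrow> real. y i) -` S)"
        using open_vimage[OF S(1) continuous_on_product_coordinates] .
      then have "eventually (\<lambda>y. y \<in> (\<lambda>y. y i) -` S) (nhds J)"
        using S(2) by (intro eventually_nhds_in_open) auto
      then have "eventually (\<lambda>k. v k \<in> (\<lambda>y. y i) -` S) G"
        using vJ unfolding filterlim_iff by blast
      then show "eventually (\<lambda>k. v k i \<in> S) G" by simp
    qed
  ultimately show thesis using that[of G J] by (simp add: G_def)
qed

section \<open>Covering numbers\<close>

text \<open>
  Functions \<open>u\<close> that are finite sums of translates of \<open>\<phi>\<close> by elements of \<open>K\<close> with nonnegative coefficients; \<open>c\<close> is
  the sum of the coefficients. It is not determined by \<open>u\<close>, hence an argument of the relation.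
\<close>

inductive translate_sum :: "'a::group_add set \<Rightarrow> ('a \<Rightarrow> real) \<Rightarrow> real \<Rightarrow> ('a \<Rightarrow> real) \<Rightarrow> bool"
  for K \<phi> where
  zero: "translate_sum K \<phi> 0 (\<lambda>_. 0)"
| step: "translate_sum K \<phi> c u \<Longrightarrow> 0 \<le> a \<Longrightarrow> k \<in> K \<Longrightarrow>
    translate_sum K \<phi> (c + a) (\<lambda>x. u x + a * \<phi> (- k + x))"

lemma translate_sum_weight_nonneg: "translate_sum K \<phi> c u \<Longrightarrow> 0 \<le> c"
  by (induction rule: translate_sum.induct) auto

lemma translate_sum_nonneg: "translate_sum K \<phi> c u \<Longrightarrow> (\<And>x. 0 \<le> \<phi> x) \<Longrightarrow> 0 \<le> u x"
  by (induction rule: translate_sum.induct) auto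

lemma translate_sum_le: "translate_sum K \<phi> c u \<Longrightarrow> (\<And>x. \<phi> x \<le> B) \<Longrightarrow> u x \<le> c * B"
proof (induction rule: translate_sum.induct)
  case (step c u a k)
  have "a * \<phi> (- k + x) \<le> a * B" using step by (intro mult_left_mono) auto
  then show ?case using step by (simp add: algebra_simps)
qed simp

lemma translate_sum_add:
  assumes "translate_sum K \<phi> c u" "translate_sum K \<phi> d v"
  shows "translate_sum K \<phi> (c + d) (\<lambda>x. u x + v x)"
  using assms(2)
proof (induction rule: translate_sum.induct)
  case zero then show ?case using assms(1) by simp
next
  case (step d v a k)
  have "translate_sum K \<phi> ((c + d) + a) (\<lambda>x. (u x + v x) + a * \<phi> (- k + x))"
    using step by (intro translate_sum.step)
  then show ?case by (simp add: add.assoc)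
qed

lemma translate_sum_scale:
  assumes "translate_sum K \<phi> c u" "0 \<le> r"
  shows "translate_sum K \<phi> (r * c) (\<lambda>x. r * u x)"
  using assms(1)
proof (induction rule: translate_sum.induct)
  case zero then show ?case using translate_sum.zero by simp
next
  case (step c u a k)
  have "translate_sum K \<phi> (r * c + r * a) (\<lambda>x. r * u x + (r * a) * \<phi> (- k + x))"
    using step assms(2) by (intro translate_sum.step) auto
  then show ?case by (simp add: algebra_simps)
qed

lemma translate_sum_shift:
  assumes K: "is_subgroup K" and k: "k \<in> K" and "translate_sum K \<phi> c u"
  shows "translate_sum K \<phi> c (\<lambda>x. u (k + x))"
  using assms(3)
proof (induction rule: translate_sum.induct)
  case zero then show ?case by (rule translate_sum.zero)
next
  case (step c u a j)
  have "- k + j \<in> K" using K k step(3) unfolding is_subgroup_def by blast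
  from translate_sum.step[OF step(4) step(2) this]
  have "translate_sum K \<phi> (c + a) (\<lambda>x. u (k + x) + a * \<phi> (- (- k + j) + x))" .
  moreover have "- (- k + j) + x = - j + (k + x)" for x
    by (simp add: minus_add add.assoc)
  ultimately show ?case by simp
qed

lemma translate_sum_trans:
  assumes K: "is_subgroup K" and v: "translate_sum K \<phi> d v" "\<And>x. x \<in> K \<Longrightarrow> \<psi> x \<le> v x"
    and "translate_sum K \<psi> c u"
  shows "\<exists>w. translate_sum K \<phi> (c * d) w \<and> (\<forall>x\<in>K. u x \<le> w x)"
  using assms(4)
proof (induction rule: translate_sum.induct)
  case zero then show ?case using translate_sum.zero by (auto intro!: exI[of _ "\<lambda>_. 0"])
next
  case (step c u a k)
  then obtain w where w: "translate_sum K \<phi> (c * d) w" "\<And>x. x \<in> K \<Longrightarrow> u x \<le> w x" by blast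
  have mk: "- k \<in> K" using K step(3) unfolding is_subgroup_def by blast
  have "translate_sum K \<phi> (c * d + a * d) (\<lambda>x. w x + a * v (- k + x))"
    using translate_sum_add[OF w(1) translate_sum_scale[OF translate_sum_shift[OF K mk v(1)] step(2)]] .
  moreover have "u x + a * \<psi> (- k + x) \<le> w x + a * v (- k + x)" if "x \<in> K" for x
  proof -
    have "- k + x \<in> K" using K mk that unfolding is_subgroup_def by blast
    then show ?thesis using w(2)[OF that] v(2) step(2) by (intro add_mono mult_left_mono) auto
  qed
  ultimately show ?case by (auto simp: algebra_simps intro!: exI[of _ "\<lambda>x. w x + a * v (- k + x)"])
qed

text \<open>
  If \<open>\<phi>\<close> has small support and \<open>p\<close>, \<open>q\<close> are almost constant on its translates, then multiplying the term
  \<open>a \<cdot> \<phi>(-k + x)\<close> by \<open>p(x)\<close> amounts to multiplying its coefficient by \<open>p(k)\<close>, up to an error \<open>e\<close>. As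
  \<open>p + q \<le> 1\<close>, the total weight grows at most by the factor \<open>1 + 2e\<close>.
\<close>

lemma translate_sum_partition:
  assumes "translate_sum K \<phi> c u" and \<phi>: "\<And>x. 0 \<le> \<phi> x" and e: "0 \<le> e"
    and h: "\<And>x. 0 \<le> p x" "\<And>x. 0 \<le> q x" "\<And>x. p x + q x \<le> 1"
    and near: "\<And>k x. \<phi> (- k + x) \<noteq> 0 \<Longrightarrow> p x \<le> p k + e" "\<And>k x. \<phi> (- k + x) \<noteq> 0 \<Longrightarrow> q x \<le> q k + e"
  shows "\<exists>c1 c2 v1 v2. translate_sum K \<phi> c1 v1 \<and> translate_sum K \<phi> c2 v2 \<and>
    c1 + c2 \<le> c * (1 + 2 * e) \<and> (\<forall>x. u x * p x \<le> v1 x \<and> u x * q x \<le> v2 x)"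
  using assms(1)
proof (induction rule: translate_sum.induct)
  case zero
  then show ?case using translate_sum.zero by (intro exI[of _ 0] exI[of _ "\<lambda>_. 0"]) auto
next
  case (step c u a k)
  then obtain c1 c2 v1 v2 where v: "translate_sum K \<phi> c1 v1" "translate_sum K \<phi> c2 v2"
    "c1 + c2 \<le> c * (1 + 2 * e)" "\<And>x. u x * p x \<le> v1 x" "\<And>x. u x * q x \<le> v2 x" by blast
  let ?a1 = "a * (p k + e)" and ?a2 = "a * (q k + e)"
  have "translate_sum K \<phi> (c1 + ?a1) (\<lambda>x. v1 x + ?a1 * \<phi> (- k + x))"
    "translate_sum K \<phi> (c2 + ?a2) (\<lambda>x. v2 x + ?a2 * \<phi> (- k + x))"
    using step v h e by (auto intro!: translate_sum.step)
  moreover have "(c1 + ?a1) + (c2 + ?a2) \<le> (c + a) * (1 + 2 * e)"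
  proof -
    have "a * (p k + q k) \<le> a * 1" using h(3) step(2) by (intro mult_left_mono) auto
    then show ?thesis using v(3) by (simp add: algebra_simps)
  qed
  moreover have "(u x + a * \<phi> (- k + x)) * r x \<le> v x + a * (r k + e) * \<phi> (- k + x)"
    if "u x * r x \<le> v x" "\<phi> (- k + x) \<noteq> 0 \<Longrightarrow> r x \<le> r k + e" for x v r
  proof (cases "\<phi> (- k + x) = 0")
    case False
    then have "(a * \<phi> (- k + x)) * r x \<le> (a * \<phi> (- k + x)) * (r k + e)"
      using that(2) \<phi> step(2) by (intro mult_left_mono) auto
    then show ?thesis using that(1) by (simp add: algebra_simps)
  qed (use that in simp)
  ultimately show ?case using v(4,5) near by blast
qed

text \<open>
  Weil's covering number \<open>(f : \<phi>)\<close>, relative to the subgroup \<open>K\<close>: only the values of \<open>f\<close> on \<open>K\<close> have to be covered, by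
  translates along \<open>K\<close>.
\<close>

definition covering_number :: "'a::group_add set \<Rightarrow> ('a \<Rightarrow> real) \<Rightarrow> ('a \<Rightarrow> real) \<Rightarrow> real" where
  "covering_number K \<phi> f = Inf {c. \<exists>u. translate_sum K \<phi> c u \<and> (\<forall>x\<in>K. f x \<le> u x)}"

lemma covering_number_le:
  assumes "translate_sum K \<phi> c u" "\<And>x. x \<in> K \<Longrightarrow> f x \<le> u x"
  shows "covering_number K \<phi> f \<le> c"
  unfolding covering_number_def
  by (rule cInf_lower) (use assms in \<open>auto intro!: bdd_belowI[of _ 0] intro: translate_sum_weight_nonneg\<close>)

section \<open>Haar measures on subgroups and uniform continuity\<close>

text \<open>
  Measures on a subgroup \<open>K\<close> are represented as measures on the whole group for which the complement of
  \<open>K\<close> is null, so that different subgroups can be compared. The zero measure is included; the normalisation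
  of \<open>\<phi>\<close> below excludes it.
\<close>

definition left_haar :: "'a::topological_group_add set \<Rightarrow> 'a measure \<Rightarrow> bool" where
  "left_haar K M \<longleftrightarrow> sets M = sets borel \<and> emeasure M (- K) = 0 \<and>
     (\<forall>f\<in>Cc euclidean. (\<integral>\<^sup>+x. ennreal (f x) \<partial>M) < top) \<and>
     (\<forall>k\<in>K. \<forall>A\<in>sets borel. emeasure M ((+) k ` A) = emeasure M A)"

lemma haus_euclidean: "Hausdorff_space (euclidean :: 'a::t2_space topology)"
  unfolding Hausdorff_space_def disjnt_def using hausdorff by fastforce

lemma Cc_homeo:
  assumes "f \<in> Cc (euclidean :: 'a::topological_space topology)" "continuous_on UNIV T" "continuous_on UNIV S"
    "\<And>x. S (T x) = (x :: 'a)"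
  shows "(\<lambda>x. f (T x)) \<in> Cc euclidean"
proof -
  obtain C where C: "compact C" "\<And>x. x \<notin> C \<Longrightarrow> f x = 0"
    using assms(1) by (metis CcE compactin_euclidean_iff)
  show ?thesis
  proof (rule CcI)
    show "continuous_map euclidean euclideanreal (\<lambda>x. f (T x))"
      using continuous_on_compose2[OF _ assms(2), of UNIV f] Cc_cont[OF assms(1)] by auto
    show "compactin euclidean (S ` C)"
      using compact_continuous_image[OF continuous_on_subset[OF assms(3)] C(1)] by simp
    show "f (T x) = 0" if "x \<notin> S ` C" for x using that C(2) assms(4) by (metis imageI)
  qed (use Cc_nonneg[OF assms(1)] in auto)
qed

lemma Cc_shift_left: "f \<in> Cc euclidean \<Longrightarrow> (\<lambda>x::'a::topological_group_add. f (g + x)) \<in> Cc euclidean"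
  by (rule Cc_homeo[where S = "\<lambda>x. - g + x"]) (auto intro!: continuous_intros simp: add.assoc[symmetric])

lemma Cc_shift_right: "f \<in> Cc euclidean \<Longrightarrow> (\<lambda>x::'a::topological_group_add. f (x + g)) \<in> Cc euclidean"
  by (rule Cc_homeo[where S = "\<lambda>x. x - g"]) (auto intro!: continuous_intros)

lemma Cc_reflect: "f \<in> Cc euclidean \<Longrightarrow> (\<lambda>x::'a::topological_group_add. f (- x + g)) \<in> Cc euclidean"
  by (rule Cc_homeo[where S = "\<lambda>x. g - x"])
     (auto intro!: continuous_intros simp: diff_conv_add_uminus minus_add add.assoc[symmetric] simp del: add_uminus_conv_diff)

lemma left_haar_nn_integral_shift:
  assumes M: "left_haar K (M :: 'a::topological_group_add measure)" and k: "k \<in> K" and F: "F \<in> borel_measurable borel"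
    and K: "is_subgroup K"
  shows "(\<integral>\<^sup>+x. F (k + x) \<partial>M) = (\<integral>\<^sup>+x. F x \<partial>M)"
proof -
  have sM: "sets M = sets borel" using M by (simp add: left_haar_def)
  have sp: "space M = UNIV" using sets_eq_imp_space_eq[OF sM] by simp
  have mk: "- k \<in> K" using K k unfolding is_subgroup_def by blast
  have meas: "(\<lambda>x. k + x) \<in> M \<rightarrow>\<^sub>M borel"
    unfolding measurable_cong_sets[OF sM refl]
    by (intro borel_measurable_continuous_onI continuous_intros)
  have "distr M borel (\<lambda>x. k + x) = M"
  proof (rule measure_eqI)
    fix A assume "A \<in> sets (distr M borel (\<lambda>x. k + x))"
    then have A: "A \<in> sets borel" by simp
    have "(\<lambda>x. k + x) -` A \<inter> space M = (+) (- k) ` A"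
    proof (intro equalityI subsetI)
      fix x assume "x \<in> (\<lambda>x. k + x) -` A \<inter> space M"
      moreover have "x = - k + (k + x)" by (simp add: add.assoc[symmetric])
      ultimately show "x \<in> (+) (- k) ` A" by (metis IntD1 image_eqI vimageD)
    qed (auto simp: sp add.assoc[symmetric])
    then show "emeasure (distr M borel (\<lambda>x. k + x)) A = emeasure M A"
      using M mk A by (simp add: emeasure_distr[OF meas A] left_haar_def)
  qed (use sM in simp)
  then have "(\<integral>\<^sup>+x. F x \<partial>M) = (\<integral>\<^sup>+x. F x \<partial>distr M borel (\<lambda>x. k + x))" by simp
  also have "\<dots> = (\<integral>\<^sup>+x. F (k + x) \<partial>M)" using F by (intro nn_integral_distr[OF meas]) auto
  finally show ?thesis by simp
qed

lemma left_haar_AE: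
  assumes "left_haar K (M :: 'a::topological_group_add measure)" "closed K"
  shows "AE x in M. x \<in> K"
proof (rule AE_I[of _ _ "- K"])
  show "emeasure M (- K) = 0" "- K \<in> sets M" using assms by (auto simp: left_haar_def)
qed auto

context
  assumes lc: "locally_compact_space
    (euclidean :: 'a::{topological_group_add, t2_space, second_countable_topology} topology)"
begin

lemma group_bump:
  assumes "compact K" "open U" "K \<subseteq> (U :: 'a set)"
  obtains f where "f \<in> Cc euclidean" "\<And>x. x \<in> K \<Longrightarrow> f x = 1" "\<And>x. f x \<noteq> 0 \<Longrightarrow> x \<in> U" "\<And>x. f x \<le> 1"
proof -
  obtain f where "subordinate euclidean U f" "\<And>x. x \<in> K \<Longrightarrow> f x = 1"
    using bump_function[OF lc haus_euclidean, of K U] assms by auto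
  then show thesis using that[of f] subordinate_Cc[of euclidean U f] unfolding subordinate_def by blast
qed

text \<open>
  Uniform continuity of \<open>f\<close> under the operation \<open>p\<close>, which will be translation from the left or from the right. The error
  is bounded by a multiple of one fixed \<open>h\<close> with compact support instead of a constant, so that
  the estimate survives integration against measures of infinite total mass.
\<close>

lemma uniform_perturbation:
  fixes p q :: "'a \<Rightarrow> 'a \<Rightarrow> 'a"
  assumes p: "continuous_on UNIV (\<lambda>z. p (fst z) (snd z))" and q: "continuous_on UNIV (\<lambda>z. q (fst z) (snd z))"
    and p0: "\<And>x. p x 0 = x" and qp: "\<And>x v. q (p x v) v = x" and f: "f \<in> Cc euclidean"
  shows "\<exists>h\<in>Cc euclidean. \<forall>e>0. \<exists>V. open V \<and> 0 \<in> V \<and> (\<forall>v\<in>V. \<forall>x. \<bar>f (p x v) - f x\<bar> \<le> e * h x)"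
proof -
  obtain C where C: "compact C" "\<And>x. x \<notin> C \<Longrightarrow> f x = 0"
    using f by (metis CcE compactin_euclidean_iff)
  obtain W P where W: "open W" "compact P" "(0::'a) \<in> W" "W \<subseteq> P"
    using lc unfolding locally_compact_space_def by (metis UNIV_I compactin_euclidean_iff open_openin topspace_euclidean)
  define S where "S = C \<union> (\<lambda>z. q (fst z) (snd z)) ` (C \<times> P)"
  have "compact S" unfolding S_def
    using C W by (intro compact_Un compact_continuous_image continuous_on_subset[OF q] compact_Times) auto
  then obtain h where h: "h \<in> Cc euclidean" "\<And>x. x \<in> S \<Longrightarrow> h x = 1"
    using group_bump[OF _ open_UNIV subset_UNIV, of S] by metis
  show ?thesis
  proof (intro bexI[OF _ h(1)] allI impI)
    fix e :: real assume e: "0 < e"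
    have cf: "continuous_on UNIV f" using Cc_cont[OF f] by simp
    let ?F = "\<lambda>z. f (p (snd z) (fst z))"
    have c: "continuous_on (UNIV \<times> S) ?F"
      by (intro continuous_on_compose2[OF cf] continuous_on_compose2[OF p, of _ "\<lambda>z. (snd z, fst z)", simplified]
          continuous_intros) auto
    obtain X0 where X0': "0 \<in> X0" "open X0" "\<forall>x\<in>X0 \<inter> UNIV. \<forall>t\<in>S. dist (?F (x, t)) (?F (0, t)) \<le> e"
      by (rule continuous_on_prod_compactE[OF c \<open>compact S\<close> UNIV_I e])
    then have X0: "\<And>v x. v \<in> X0 \<Longrightarrow> x \<in> S \<Longrightarrow> \<bar>f (p x v) - f x\<bar> \<le> e"
      by (simp add: p0 dist_real_def)
    show "\<exists>V. open V \<and> 0 \<in> V \<and> (\<forall>v\<in>V. \<forall>x. \<bar>f (p x v) - f x\<bar> \<le> e * h x)"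
    \<comment> \<open>Outside \<open>S\<close> both values vanish: if \<open>p x v \<in> C\<close> with \<open>v \<in> W\<close> then \<open>x = q (p x v) v \<in> S\<close>.\<close>
    proof (intro exI[of _ "X0 \<inter> W"] conjI ballI allI)
      fix v x assume v: "v \<in> X0 \<inter> W"
      show "\<bar>f (p x v) - f x\<bar> \<le> e * h x"
      proof (cases "x \<in> S")
        case True
        then show ?thesis using X0 v h(2) by simp
      next
        case False
        then have "p x v \<notin> C"
          using v W(4) qp[of x v] unfolding S_def by (force intro!: rev_image_eqI)
        then show ?thesis using False C(2) Cc_nonneg[OF h(1), of x] e by (simp add: S_def)
      qed
    qed (use X0' W in auto)
  qed
qed

lemma uniform_right:
  assumes "f \<in> Cc euclidean"
  shows "\<exists>h\<in>Cc euclidean. \<forall>e>0. \<exists>V. open V \<and> 0 \<in> V \<and> (\<forall>v\<in>V. \<forall>x::'a. \<bar>f (x + v) - f x\<bar> \<le> e * h x)"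
  by (rule uniform_perturbation[where p = "\<lambda>x v. x + v" and q = "\<lambda>y v. y - v", OF _ _ _ _ assms])
     (auto intro!: continuous_intros)

lemma uniform_left:
  assumes "f \<in> Cc euclidean"
  shows "\<exists>h\<in>Cc euclidean. \<forall>e>0. \<exists>V. open V \<and> 0 \<in> V \<and> (\<forall>v\<in>V. \<forall>x::'a. \<bar>f (v + x) - f x\<bar> \<le> e * h x)"
  by (rule uniform_perturbation[where p = "\<lambda>x v. v + x" and q = "\<lambda>y v. - v + y", OF _ _ _ _ assms])
     (auto intro!: continuous_intros simp: add.assoc[symmetric])

section \<open>Uniform covers and almost additivity\<close>

text \<open>
  The bound does not depend on the subgroup. Cover the support of \<open>f\<close> by finitely many \<open>g + W\<close>, where
  \<open>\<phi>(-x + y) > t\<close> for all \<open>x, y \<in> W\<close>. If \<open>K\<close> meets \<open>g + W\<close> in a point \<open>k\<close>, the translate of \<open>\<phi>\<close> by \<open>k\<close>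
  exceeds \<open>t\<close> on all of \<open>g + W\<close>; otherwise there is nothing to cover there.
\<close>

lemma uniform_cover:
  assumes \<phi>: "\<phi> \<in> Cc euclidean" "0 < \<phi> (0::'a)" and f: "f \<in> Cc euclidean"
  obtains B where "0 \<le> B"
    "\<And>K. is_subgroup K \<Longrightarrow> \<exists>c u. translate_sum K \<phi> c u \<and> c \<le> B \<and> (\<forall>x. x \<in> K \<longrightarrow> f x \<le> u x)"
proof -
  obtain C where C: "compact C" "\<And>x. x \<notin> C \<Longrightarrow> f x = 0"
    using f by (metis CcE compactin_euclidean_iff)
  obtain b where b: "0 < b" "\<And>x. f x \<le> b" using Cc_bounded[OF f] by metis
  define t where "t = \<phi> 0 / 2"
  have t: "0 < t" using \<phi> by (simp add: t_def)
  have cphi: "continuous_on UNIV \<phi>" using Cc_cont[OF \<phi>(1)] by simp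
  have "open ((\<lambda>z. \<phi> (- fst z + snd z)) -` {t<..})"
    by (rule open_vimage) (auto intro!: continuous_intros continuous_on_compose2[OF cphi])
  moreover have "(0, 0) \<in> (\<lambda>z. \<phi> (- fst z + snd z)) -` {t<..}" using \<phi>(2) by (simp add: t_def)
  ultimately obtain W1 W2 where W12: "open W1" "open W2" "(0::'a, 0::'a) \<in> W1 \<times> W2"
    "W1 \<times> W2 \<subseteq> (\<lambda>z. \<phi> (- fst z + snd z)) -` {t<..}"
    by (rule open_prod_elim)
  define W where "W = W1 \<inter> W2"
  have W: "open W" "0 \<in> W" "\<And>x y. x \<in> W \<Longrightarrow> y \<in> W \<Longrightarrow> t < \<phi> (- x + y)"
    using W12 unfolding W_def by auto
  have opW: "open ((\<lambda>x. - g + x) -` W)" for g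
    by (rule open_vimage) (auto intro!: continuous_intros W)
  obtain F where F: "finite F" "C \<subseteq> (\<Union>g\<in>F. (\<lambda>x. - g + x) -` W)"
  proof (rule compactE_image[OF C(1), of C "\<lambda>g. (\<lambda>x. - g + x) -` W"])
    show "C \<subseteq> (\<Union>g\<in>C. (\<lambda>x. - g + x) -` W)" using W(2) by auto
  qed (use opW that in auto)
  have main: "\<exists>c u. translate_sum K \<phi> c u \<and> c \<le> real (card F) * (b / t) \<and>
      (\<forall>x\<in>K. (\<exists>g\<in>F. - g + x \<in> W) \<longrightarrow> b \<le> u x)" if K: "is_subgroup K" for K
    using F(1)
  proof (induction F rule: finite_induct)
    case empty
    then show ?case using translate_sum.zero by auto
  next
    case (insert g F)
    then obtain c u where u: "translate_sum K \<phi> c u" "c \<le> real (card F) * (b / t)"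
      "\<And>x g. x \<in> K \<Longrightarrow> g \<in> F \<Longrightarrow> - g + x \<in> W \<Longrightarrow> b \<le> u x" by blast
    have u0: "0 \<le> u x" for x using translate_sum_nonneg[OF u(1)] Cc_nonneg[OF \<phi>(1)] by blast
    show ?case
    proof (cases "\<exists>k\<in>K. - g + k \<in> W")
      case True
      then obtain k where k: "k \<in> K" "- g + k \<in> W" by blast
      have "translate_sum K \<phi> (c + b / t) (\<lambda>x. u x + (b / t) * \<phi> (- k + x))"
        using u(1) k(1) b t by (intro translate_sum.step) auto
      moreover have "c + b / t \<le> real (card (insert g F)) * (b / t)"
        using u(2) insert by (simp add: algebra_simps)
      moreover have "b \<le> u x + (b / t) * \<phi> (- k + x)"
        if x: "x \<in> K" "h \<in> insert g F" "- h + x \<in> W" for x h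
      proof (cases "h = g")
        case True
        have "- (- g + k) + (- g + x) = - k + x" by (simp add: minus_add add.assoc)
        then have "t < \<phi> (- k + x)" using W(3)[OF k(2), of "- g + x"] x True by simp
        then have "(b / t) * t \<le> (b / t) * \<phi> (- k + x)" using b t by (intro mult_left_mono) auto
        then show ?thesis using t u0[of x] by simp
      next
        case False
        then have "b \<le> u x" using u(3) x by blast
        moreover have "0 \<le> (b / t) * \<phi> (- k + x)" using b t Cc_nonneg[OF \<phi>(1)] by simp
        ultimately show ?thesis by linarith
      qed
      ultimately show ?thesis by blast
    next
      case False
      have "c \<le> real (card (insert g F)) * (b / t)"
        using u(2) insert b t by (simp add: algebra_simps) (smt (verit) divide_nonneg_nonneg)
      then show ?thesis using u False by blast
    qed
  qed
  show thesis
  proof (rule that[of "real (card F) * (b / t)"])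
    fix K :: "'a set" assume "is_subgroup K"
    from main[OF this] obtain c u where u: "translate_sum K \<phi> c u" "c \<le> real (card F) * (b / t)"
      "\<And>x g. x \<in> K \<Longrightarrow> g \<in> F \<Longrightarrow> - g + x \<in> W \<Longrightarrow> b \<le> u x" by blast
    have "f x \<le> u x" if "x \<in> K" for x
    proof (cases "x \<in> C")
      case True
      then obtain g where "g \<in> F" "- g + x \<in> W" using F(2) by blast
      then show ?thesis using u(3)[OF that] b(2)[of x] by force
    next
      case False
      then show ?thesis using C(2) translate_sum_nonneg[OF u(1)] Cc_nonneg[OF \<phi>(1)] by simp
    qed
    then show "\<exists>c u. translate_sum K \<phi> c u \<and> c \<le> real (card F) * (b / t) \<and> (\<forall>x. x \<in> K \<longrightarrow> f x \<le> u x)"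
      using u by blast
  qed (use b t in auto)
qed

context
  fixes K :: "'a set" and \<phi> :: "'a \<Rightarrow> real"
  assumes K: "is_subgroup K" and \<phi>: "\<phi> \<in> Cc euclidean" "0 < \<phi> 0"
begin

lemma covering_number_ge:
  assumes "f \<in> Cc euclidean" "\<And>c u. translate_sum K \<phi> c u \<Longrightarrow> (\<And>x. x \<in> K \<Longrightarrow> f x \<le> u x) \<Longrightarrow> b \<le> c"
  shows "b \<le> covering_number K \<phi> f"
  unfolding covering_number_def
proof (rule cInf_greatest)
  obtain B where "\<exists>c u. translate_sum K \<phi> c u \<and> c \<le> B \<and> (\<forall>x. x \<in> K \<longrightarrow> f x \<le> u x)"
    using uniform_cover[OF \<phi> assms(1)] K by metis
  then show "{c. \<exists>u. translate_sum K \<phi> c u \<and> (\<forall>x\<in>K. f x \<le> u x)} \<noteq> {}" by auto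
  fix c assume "c \<in> {c. \<exists>u. translate_sum K \<phi> c u \<and> (\<forall>x\<in>K. f x \<le> u x)}"
  then obtain u where "translate_sum K \<phi> c u" "\<forall>x\<in>K. f x \<le> u x" by auto
  then show "b \<le> c" using assms(2)[of c u] by simp
qed

lemma covering_number_nonneg: "f \<in> Cc euclidean \<Longrightarrow> 0 \<le> covering_number K \<phi> f"
  by (rule covering_number_ge) (auto intro: translate_sum_weight_nonneg)

lemma covering_number_add:
  assumes "f \<in> Cc euclidean" "g \<in> Cc euclidean"
  shows "covering_number K \<phi> (\<lambda>x. f x + g x) \<le> covering_number K \<phi> f + covering_number K \<phi> g"
proof -
  have "covering_number K \<phi> (\<lambda>x. f x + g x) - c \<le> covering_number K \<phi> g"
    if u: "translate_sum K \<phi> c u" "\<And>x. x \<in> K \<Longrightarrow> f x \<le> u x" for c u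
  proof (rule covering_number_ge[OF assms(2)])
    fix d v assume v: "translate_sum K \<phi> d v" "\<And>x. x \<in> K \<Longrightarrow> g x \<le> v x"
    have "covering_number K \<phi> (\<lambda>x. f x + g x) \<le> c + d"
      using u v by (intro covering_number_le[OF translate_sum_add[OF u(1) v(1)]] add_mono) auto
    then show "covering_number K \<phi> (\<lambda>x. f x + g x) - c \<le> d" by simp
  qed
  then have "covering_number K \<phi> (\<lambda>x. f x + g x) - covering_number K \<phi> g \<le> covering_number K \<phi> f"
    by (intro covering_number_ge[OF assms(1)]) (simp add: algebra_simps)
  then show ?thesis by simp
qed

lemma covering_number_scale_le:
  assumes "f \<in> Cc euclidean" "0 < r"
  shows "covering_number K \<phi> (\<lambda>x. r * f x) \<le> r * covering_number K \<phi> f"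
proof -
  have "covering_number K \<phi> (\<lambda>x. r * f x) / r \<le> covering_number K \<phi> f"
  proof (rule covering_number_ge[OF assms(1)])
    fix c u assume u: "translate_sum K \<phi> c u" "\<And>x. x \<in> K \<Longrightarrow> f x \<le> u x"
    have "covering_number K \<phi> (\<lambda>x. r * f x) \<le> r * c"
      using u assms(2) by (intro covering_number_le[OF translate_sum_scale[OF u(1)]]) auto
    then show "covering_number K \<phi> (\<lambda>x. r * f x) / r \<le> c" using assms(2) by (simp add: pos_divide_le_eq mult.commute)
  qed
  then show ?thesis using assms(2) by (simp add: pos_divide_le_eq mult.commute)
qed

lemma covering_number_zero: "covering_number K \<phi> (\<lambda>_. 0) = 0"
  using covering_number_le[OF translate_sum.zero, of K "\<lambda>_. 0" \<phi>] covering_number_nonneg[OF Cc_zero] by simp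

lemma covering_number_scale:
  assumes f: "f \<in> Cc euclidean" and r: "0 \<le> r"
  shows "covering_number K \<phi> (\<lambda>x. r * f x) = r * covering_number K \<phi> f"
proof (cases "r = 0")
  case False
  then have r: "0 < r" using r by simp
  have "covering_number K \<phi> (\<lambda>x. (1/r) * (r * f x)) \<le> (1/r) * covering_number K \<phi> (\<lambda>x. r * f x)"
    using r by (intro covering_number_scale_le Cc_scale f) auto
  then have "r * covering_number K \<phi> f \<le> covering_number K \<phi> (\<lambda>x. r * f x)"
    using r by (simp add: pos_le_divide_eq mult.commute)
  then show ?thesis using covering_number_scale_le[OF f r] by simp
qed (simp add: covering_number_zero)

lemma covering_number_shift:
  assumes f: "f \<in> Cc euclidean" and k: "k \<in> K"
  shows "covering_number K \<phi> (\<lambda>x. f (k + x)) = covering_number K \<phi> f"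
proof -
  have le: "covering_number K \<phi> (\<lambda>x. g (j + x)) \<le> covering_number K \<phi> g"
    if g: "g \<in> Cc euclidean" and j: "j \<in> K" for g j
  proof (rule covering_number_ge[OF g])
    fix c u assume u: "translate_sum K \<phi> c u" "\<And>x. x \<in> K \<Longrightarrow> g x \<le> u x"
    show "covering_number K \<phi> (\<lambda>x. g (j + x)) \<le> c"
      using u(2) K j by (intro covering_number_le[OF translate_sum_shift[OF K j u(1)]])
        (auto simp: is_subgroup_def)
  qed
  have mk: "- k \<in> K" using K k unfolding is_subgroup_def by blast
  have "covering_number K \<phi> (\<lambda>x. f (k + (- k + x))) \<le> covering_number K \<phi> (\<lambda>x. f (k + x))"
    by (rule le[OF Cc_shift_left[OF f] mk])
  then show ?thesis using le[OF f k] by (simp add: add.assoc[symmetric])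
qed

text \<open>
  This is \<open>(f : \<phi>) \<le> (f : \<psi>)(\<psi> : \<phi>)\<close>: cover every translate of \<open>\<psi>\<close> by translates of \<open>\<phi>\<close>.
\<close>

lemma covering_number_trans:
  assumes f: "f \<in> Cc euclidean" and \<psi>: "\<psi> \<in> Cc euclidean" "0 < \<psi> 0"
    and u: "translate_sum K \<psi> B u" "\<And>x. x \<in> K \<Longrightarrow> f x \<le> u x"
  shows "covering_number K \<phi> f \<le> covering_number K \<phi> \<psi> * B"
proof (cases "B = 0")
  case B: False
  then have B: "0 < B" using translate_sum_weight_nonneg[OF u(1)] by simp
  have "covering_number K \<phi> f / B \<le> covering_number K \<phi> \<psi>"
  proof (rule covering_number_ge[OF \<psi>(1)])
    fix d v assume v: "translate_sum K \<phi> d v" "\<And>x. x \<in> K \<Longrightarrow> \<psi> x \<le> v x"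
    obtain w where w: "translate_sum K \<phi> (B * d) w" "\<And>x. x \<in> K \<Longrightarrow> u x \<le> w x"
      using translate_sum_trans[OF K v u(1)] by blast
    have "covering_number K \<phi> f \<le> B * d"
      by (rule covering_number_le[OF w(1)]) (use w(2) u(2) order_trans in blast)
    then show "covering_number K \<phi> f / B \<le> d" using B by (simp add: pos_divide_le_eq mult.commute)
  qed
  then show ?thesis using B by (simp add: pos_divide_le_eq)
next
  case B: True
  obtain b where b: "\<And>x. \<psi> x \<le> b" using Cc_bounded[OF \<psi>(1)] by metis
  have "f x \<le> 0" if "x \<in> K" for x
    using translate_sum_le[OF u(1) b, of x] u(2)[OF that] B by simp
  then have "covering_number K \<phi> f \<le> 0" by (intro covering_number_le[OF translate_sum.zero]) auto
  then show ?thesis using B by simp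
qed

lemma covering_number_pos:
  assumes f: "f \<in> Cc euclidean" "0 < f 0"
  shows "0 < covering_number K \<phi> f"
proof -
  obtain b where b: "0 < b" "\<And>x. \<phi> x \<le> b" using Cc_bounded[OF \<phi>(1)] by metis
  have "f 0 / b \<le> covering_number K \<phi> f"
  proof (rule covering_number_ge[OF f(1)])
    fix c u assume u: "translate_sum K \<phi> c u" "\<And>x. x \<in> K \<Longrightarrow> f x \<le> u x"
    have "f 0 \<le> u 0" using u(2) K unfolding is_subgroup_def by blast
    also have "\<dots> \<le> c * b" using translate_sum_le[OF u(1) b(2)] .
    finally show "f 0 / b \<le> c" using b by (simp add: pos_divide_le_eq)
  qed
  moreover have "0 < f 0 / b" using f b by simp
  ultimately show ?thesis by linarith
qed

end

text \<open>
  Covering numbers are subadditive, and additive in the limit of small support of \<open>\<phi>\<close>. Write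
  \<open>t = f + g + eh\<close> and \<open>f = t \<cdot> (f/t)\<close>, \<open>g = t \<cdot> (g/t)\<close>, and split a cover of \<open>t\<close> by \<open>translate_sum_partition\<close>. The term
  \<open>eh\<close> keeps \<open>t\<close> positive on the supports, which makes the quotients continuous.
\<close>

lemma covering_number_almost_additive:
  assumes f: "f \<in> Cc (euclidean :: 'a topology)" "g \<in> Cc euclidean"
  obtains h where "h \<in> Cc euclidean"
    "\<And>e. 0 < e \<Longrightarrow> \<exists>V. open V \<and> 0 \<in> V \<and> (\<forall>K \<phi>. is_subgroup K \<longrightarrow> \<phi> \<in> Cc euclidean \<longrightarrow> 0 < \<phi> 0 \<longrightarrow>
       (\<forall>x. \<phi> x \<noteq> 0 \<longrightarrow> x \<in> V) \<longrightarrow>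
       covering_number K \<phi> f + covering_number K \<phi> g
         \<le> (1 + 2 * e) * (covering_number K \<phi> (\<lambda>x. f x + g x) + e * covering_number K \<phi> h))"
proof -
  obtain C where C: "compact C" "\<And>x. x \<notin> C \<Longrightarrow> f x = 0"
    using f(1) by (metis CcE compactin_euclidean_iff)
  obtain D where D: "compact D" "\<And>x. x \<notin> D \<Longrightarrow> g x = 0"
    using f(2) by (metis CcE compactin_euclidean_iff)
  define S where "S = C \<union> D"
  have S: "compact S" unfolding S_def using C D by (intro compact_Un)
  then obtain h where h: "h \<in> Cc euclidean" "\<And>x. x \<in> S \<Longrightarrow> h x = 1"
    using group_bump[OF _ open_UNIV subset_UNIV, of S] by metis
  have f0: "0 \<le> f x" "0 \<le> g x" "0 \<le> h x" for x
    using Cc_nonneg[OF f(1)] Cc_nonneg[OF f(2)] Cc_nonneg[OF h(1)] by simp_all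
  show thesis
  proof (rule that[OF h(1)])
    fix e :: real assume e: "0 < e"
    define t where "t x = f x + g x + e * h x" for x
    have tC: "t \<in> Cc euclidean" unfolding t_def using f h e by (intro Cc_add Cc_scale) auto
    have t0: "0 \<le> t x" for x using Cc_nonneg[OF tC] .
    have tS: "0 < t x" if "x \<in> S" for x
      using h(2)[OF that] e f0 unfolding t_def by (simp add: add_nonneg_pos)
    have ct: "continuous_on UNIV t" using Cc_cont[OF tC] by simp
    have ratio: "(\<lambda>x. p x / t x) \<in> Cc euclidean"
      if p: "p \<in> Cc euclidean" "\<And>x. x \<notin> S \<Longrightarrow> p x = 0" for p
    proof (rule CcI[of _ _ S])
      have cp: "continuous_on UNIV p" using Cc_cont[OF p(1)] by simp
      have "continuous_on (t -` {0<..}) (\<lambda>x. p x / t x)"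
        by (intro continuous_on_divide continuous_on_subset[OF cp] continuous_on_subset[OF ct]) auto
      moreover have "continuous_on (- S) (\<lambda>x. p x / t x)"
        using p(2) by (subst continuous_on_cong[of _ "- S" _ "\<lambda>_. 0"]) auto
      moreover have "open (t -` {0<..})" by (rule open_vimage[OF _ ct]) auto
      moreover have "open (- S)" using S compact_imp_closed by blast
      ultimately have "continuous_on (t -` {0<..} \<union> - S) (\<lambda>x. p x / t x)"
        by (intro continuous_on_open_Un) auto
      moreover have "t -` {0<..} \<union> - S = UNIV" using tS by auto
      ultimately show "continuous_map euclidean euclideanreal (\<lambda>x. p x / t x)" by simp
    qed (use p S t0 Cc_nonneg[OF p(1)] in auto)
    have near: "\<exists>V. open V \<and> 0 \<in> V \<and> (\<forall>v\<in>V. \<forall>x. r (x + v) \<le> r x + e)"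
      if r: "r \<in> Cc (euclidean :: 'a topology)" for r
    proof -
      obtain q where q: "q \<in> Cc euclidean" "\<And>e. 0 < e \<Longrightarrow>
        \<exists>V. open V \<and> 0 \<in> V \<and> (\<forall>v\<in>V. \<forall>x::'a. \<bar>r (x + v) - r x\<bar> \<le> e * q x)"
        using uniform_right[OF r] by blast
      obtain b where b: "0 < b" "\<And>x. q x \<le> b" using Cc_bounded[OF q(1)] by metis
      obtain V where V: "open V" "0 \<in> V" "\<And>v x. v \<in> V \<Longrightarrow> \<bar>r (x + v) - r x\<bar> \<le> (e / b) * q x"
        using q(2)[of "e / b"] e b by auto
      have "(e / b) * q x \<le> e" for x
      proof -
        have "(e / b) * q x \<le> (e / b) * b" using e b by (intro mult_left_mono) auto
        then show ?thesis using b by simp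
      qed
      then have "r (x + v) \<le> r x + e" if "v \<in> V" for v x
        using V(3)[OF that, of x] by (smt (verit, best))
      then show ?thesis using V(1,2) by blast
    qed
    have pC: "(\<lambda>x. f x / t x) \<in> Cc euclidean" and qC: "(\<lambda>x. g x / t x) \<in> Cc euclidean"
      using ratio f C D by (auto simp: S_def)
    obtain V1 V2 where V: "open V1" "0 \<in> V1" "open V2" "0 \<in> V2"
      "\<And>v x. v \<in> V1 \<Longrightarrow> f (x + v) / t (x + v) \<le> f x / t x + e"
      "\<And>v x. v \<in> V2 \<Longrightarrow> g (x + v) / t (x + v) \<le> g x / t x + e"
      using near[OF pC] near[OF qC] by auto
    show "\<exists>V. open V \<and> 0 \<in> V \<and> (\<forall>K \<phi>. is_subgroup K \<longrightarrow> \<phi> \<in> Cc euclidean \<longrightarrow> 0 < \<phi> 0 \<longrightarrow>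
       (\<forall>x. \<phi> x \<noteq> 0 \<longrightarrow> x \<in> V) \<longrightarrow>
       covering_number K \<phi> f + covering_number K \<phi> g
         \<le> (1 + 2 * e) * (covering_number K \<phi> (\<lambda>x. f x + g x) + e * covering_number K \<phi> h))"
    proof (intro exI[of _ "V1 \<inter> V2"] conjI allI impI)
      fix K :: "'a set" and \<phi> :: "'a \<Rightarrow> real"
      assume K: "is_subgroup K" and \<phi>: "\<phi> \<in> Cc euclidean" "0 < \<phi> 0"
        and supp: "\<forall>x. \<phi> x \<noteq> 0 \<longrightarrow> x \<in> V1 \<inter> V2"
      let ?c = "covering_number K \<phi>"
      have "(?c f + ?c g) / (1 + 2 * e) \<le> ?c t"
      proof (rule covering_number_ge[OF K \<phi> tC])
        fix c u assume u: "translate_sum K \<phi> c u" "\<And>x. x \<in> K \<Longrightarrow> t x \<le> u x"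
        have "\<exists>c1 c2 v1 v2. translate_sum K \<phi> c1 v1 \<and> translate_sum K \<phi> c2 v2 \<and>
          c1 + c2 \<le> c * (1 + 2 * e) \<and> (\<forall>x. u x * (f x / t x) \<le> v1 x \<and> u x * (g x / t x) \<le> v2 x)"
        proof (rule translate_sum_partition[OF u(1)])
          show "f x / t x + g x / t x \<le> 1" for x
          proof (cases "t x = 0")
            case False
            then have "f x / t x + g x / t x = (f x + g x) / t x" by (simp add: add_divide_distrib)
            also have "\<dots> \<le> 1"
          proof -
            have "0 < t x" using False t0[of x] by simp
            moreover have "f x + g x \<le> t x" using f0(3)[of x] e by (simp add: t_def)
            ultimately show ?thesis by (simp add: pos_divide_le_eq)
          qed
            finally show ?thesis .
          qed simp
          fix k x assume "\<phi> (- k + x) \<noteq> 0"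
          then have "- k + x \<in> V1" "- k + x \<in> V2" using supp by auto
          then show "f x / t x \<le> f k / t k + e" "g x / t x \<le> g k / t k + e"
            using V(5)[of "- k + x" k] V(6)[of "- k + x" k] by (simp_all add: add.assoc[symmetric])
        qed (use Cc_nonneg[OF \<phi>(1)] e f0 t0 in auto)
        then obtain c1 c2 v1 v2 where v: "translate_sum K \<phi> c1 v1" "translate_sum K \<phi> c2 v2"
          "c1 + c2 \<le> c * (1 + 2 * e)" "\<And>x. u x * (f x / t x) \<le> v1 x" "\<And>x. u x * (g x / t x) \<le> v2 x"
          by blast
        have dom: "p x \<le> v x" if "x \<in> K" "u x * (p x / t x) \<le> v x" "\<And>x. x \<notin> S \<Longrightarrow> p x = 0"
          "0 \<le> p x" "0 \<le> v x" for p v x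
        proof (cases "x \<in> S")
          case True
          then have "p x = t x * (p x / t x)" using tS by force
          also have "\<dots> \<le> u x * (p x / t x)" using u(2)[OF that(1)] that t0 by (intro mult_right_mono) auto
          finally show ?thesis using that(2) by simp
        qed (use that in auto)
        have vn: "0 \<le> v1 x" "0 \<le> v2 x" for x
          using translate_sum_nonneg[OF v(1)] translate_sum_nonneg[OF v(2)] Cc_nonneg[OF \<phi>(1)] by auto
        have "?c f \<le> c1"
          by (rule covering_number_le[OF v(1)], rule dom) (use v(4) C f0 vn in \<open>auto simp: S_def\<close>)
        moreover have "?c g \<le> c2"
          by (rule covering_number_le[OF v(2)], rule dom) (use v(5) D f0 vn in \<open>auto simp: S_def\<close>)
        ultimately have "?c f + ?c g \<le> c * (1 + 2 * e)" using v(3) by linarith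
        then show "(?c f + ?c g) / (1 + 2 * e) \<le> c" using e by (simp add: pos_divide_le_eq)
      qed
      then have "?c f + ?c g \<le> (1 + 2 * e) * ?c t" using e by (simp add: pos_divide_le_eq mult.commute)
      also have "?c t \<le> ?c (\<lambda>x. f x + g x) + ?c (\<lambda>x. e * h x)"
        unfolding t_def using f h e by (intro covering_number_add[OF K \<phi>] Cc_add Cc_scale) auto
      also have "?c (\<lambda>x. e * h x) = e * ?c h" using h e by (intro covering_number_scale[OF K \<phi>]) auto
      finally show "?c f + ?c g \<le> (1 + 2 * e) * (?c (\<lambda>x. f x + g x) + e * ?c h)"
        using e by (simp add: mult_left_mono)
    qed (use V in auto)
  qed
qed

section \<open>Existence of Haar measures on closed subgroups\<close>

text \<open>
  Only functions supported in a compact subset of the complement of \<open>K\<close> enter the hypothesis on vanishing, because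
  the measure of the open set \<open>- K\<close> is a supremum over exactly these. For functionals that are
  limits over varying subgroups nothing stronger is directly available.
\<close>

lemma left_haar_of_functional:
  assumes K: "is_subgroup K" "closed (K :: 'a set)" and J: "positive_functional euclidean J"
    and van: "\<And>f. subordinate euclidean (- K) f \<Longrightarrow> J f = 0"
    and inv: "\<And>k f. k \<in> K \<Longrightarrow> f \<in> Cc euclidean \<Longrightarrow> J (\<lambda>x. f (k + x)) = J f"
  obtains M where "left_haar K M" "\<And>f. f \<in> Cc euclidean \<Longrightarrow> (\<integral>\<^sup>+x. ennreal (f x) \<partial>M) = ennreal (J f)"
proof -
  obtain M where M: "riesz_measure euclidean J M"
    using riesz_representation[OF lc haus_euclidean J] by metis
  have int: "(\<integral>\<^sup>+x. ennreal (f x) \<partial>M) = ennreal (J f)" if "f \<in> Cc euclidean" for f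
    using riesz_integral[OF lc haus_euclidean J M that] .
  have "left_haar K M"
    unfolding left_haar_def
  proof (intro conjI ballI)
    show sM: "sets M = sets borel" using riesz_measure_sets[OF M] sets_borel_on_euclidean by simp
    have "emeasure M (- K) = open_content euclidean J (- K)"
      using K by (intro riesz_measure_open[OF M]) auto
    also have "\<dots> = 0"
    proof -
      have "ennreal (J f) = 0" if "subordinate euclidean (- K) f" for f
        using van[OF that] by simp
      then show ?thesis unfolding open_content_def by (auto intro!: antisym SUP_least)
    qed
    finally show "emeasure M (- K) = 0" .
    show "(\<integral>\<^sup>+x. ennreal (f x) \<partial>M) < top" if "f \<in> Cc euclidean" for f
      using int[OF that] by simp
    fix k A assume k: "k \<in> K" and A: "A \<in> sets (borel :: 'a measure)"
    show "emeasure M ((+) k ` A) = emeasure M A"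
      by (rule riesz_invariant[OF lc haus_euclidean J M, of "(+) k" "\<lambda>x. - k + x"])
         (use k A inv sM in \<open>auto intro!: continuous_intros simp: add.assoc[symmetric]\<close>)
  qed
  then show thesis using that int by blast
qed

text \<open>
  The functionals \<open>f \<mapsto> (f : \<phi>\<^sub>n) / (\<phi>0 : \<phi>\<^sub>n)\<close>, with the supports of \<open>\<phi>\<^sub>n\<close> shrinking to the identity, take values
  in \<open>[0, B f]\<close> with \<open>B f\<close> independent of \<open>n\<close>. They are invariant, homogeneous and subadditive; a cluster point is
  moreover additive by \<open>covering_number_almost_additive\<close>.
\<close>

theorem left_haar_exists:
  assumes K: "is_subgroup K" "closed (K :: 'a set)" and \<phi>0: "\<phi>0 \<in> Cc euclidean" "0 < \<phi>0 0"
  shows "\<exists>M. left_haar K M \<and> (\<integral>\<^sup>+x. ennreal (\<phi>0 x) \<partial>M) = 1"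
proof -
  obtain A :: "nat \<Rightarrow> 'a set" where A: "\<And>i. open (A i)" "\<And>i. 0 \<in> A i"
    "\<And>S. open S \<Longrightarrow> 0 \<in> S \<Longrightarrow> eventually (\<lambda>i. A i \<subseteq> S) sequentially"
    using countable_basis_at_decseq[of "0::'a"] by metis
  have "\<exists>f. f \<in> Cc euclidean \<and> 0 < f 0 \<and> (\<forall>x. f x \<noteq> 0 \<longrightarrow> x \<in> A n)" for n
  proof -
    obtain f where "f \<in> Cc euclidean" "\<And>x. x \<in> {0} \<Longrightarrow> f x = 1" "\<And>x. f x \<noteq> 0 \<Longrightarrow> x \<in> A n" "\<And>x. f x \<le> 1"
      by (rule group_bump[of "{0}" "A n"]) (use A(1,2)[of n] in auto)
    then show ?thesis by (intro exI[of _ f]) auto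
  qed
  then obtain p where p: "\<And>n. p n \<in> Cc euclidean" "\<And>n. 0 < p n (0::'a)" "\<And>n x. p n x \<noteq> 0 \<Longrightarrow> x \<in> A n"
    by metis
  define c where "c n = covering_number K (p n)" for n
  have c0: "0 < c n \<phi>0" for n unfolding c_def by (rule covering_number_pos[OF K(1) p(1,2) \<phi>0])
  define v where "v n f = (if f \<in> Cc euclidean then c n f / c n \<phi>0 else 0)" for n f
  have "\<exists>B. \<forall>n. \<bar>v n f\<bar> \<le> B" for f
  proof (cases "f \<in> Cc euclidean")
    case True
    obtain B where B: "0 \<le> B"
      "\<And>K. is_subgroup K \<Longrightarrow> \<exists>c u. translate_sum K \<phi>0 c u \<and> c \<le> B \<and> (\<forall>x. x \<in> K \<longrightarrow> f x \<le> u x)"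
      using uniform_cover[OF \<phi>0 True] by metis
    obtain d u where u: "translate_sum K \<phi>0 d u" "d \<le> B" "\<And>x. x \<in> K \<Longrightarrow> f x \<le> u x"
      using B(2)[OF K(1)] by blast
    have "\<bar>v n f\<bar> \<le> B" for n
    proof -
      have "c n f \<le> c n \<phi>0 * d"
        unfolding c_def by (rule covering_number_trans[OF K(1) p(1,2) True \<phi>0 u(1,3)])
      also have "\<dots> \<le> c n \<phi>0 * B" using u(2) c0[of n] by (intro mult_left_mono) auto
      finally have "c n f / c n \<phi>0 \<le> B" using c0[of n] by (simp add: pos_divide_le_eq mult.commute)
      moreover have "0 \<le> c n f" unfolding c_def by (rule covering_number_nonneg[OF K(1) p(1,2) True])
      ultimately show ?thesis using c0[of n] True by (simp add: v_def)
    qed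
    then show ?thesis by blast
  qed (auto simp: v_def)
  then obtain B where B: "\<And>n f. \<bar>v n f\<bar> \<le> B f" by metis
  obtain G J where G: "G \<le> sequentially" "G \<noteq> bot" "\<And>f. ((\<lambda>n. v n f) \<longlongrightarrow> J f) G"
    by (rule bounded_family_cluster[where v = v, OF sequentially_bot B]) (rule that)
  have J1: "J \<phi>0 = 1"
  proof -
    have "(\<lambda>n. v n \<phi>0) = (\<lambda>_. 1)" using c0 \<phi>0 by (auto simp: v_def fun_eq_iff less_imp_neq[symmetric])
    then show ?thesis using G(3)[of \<phi>0] tendsto_unique[OF G(2) _ tendsto_const] by metis
  qed
  have Jscale: "J (\<lambda>x. r * f x) = r * J f" if "f \<in> Cc euclidean" "0 \<le> r" for f r
  proof (rule tendsto_unique[OF G(2) G(3)])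
    have "(\<lambda>n. v n (\<lambda>x. r * f x)) = (\<lambda>n. r * v n f)"
      using that Cc_scale[OF that] covering_number_scale[OF K(1) p(1,2) that]
      by (auto simp: v_def c_def)
    then show "((\<lambda>n. v n (\<lambda>x. r * f x)) \<longlongrightarrow> r * J f) G"
      using tendsto_mult_left[OF G(3)[of f], of r] by simp
  qed
  have Jshift: "J (\<lambda>x. f (k + x)) = J f" if "k \<in> K" "f \<in> Cc euclidean" for f k
  proof (rule tendsto_unique[OF G(2) G(3)])
    have "(\<lambda>n. v n (\<lambda>x. f (k + x))) = (\<lambda>n. v n f)"
      using that Cc_shift_left[OF that(2), of k] covering_number_shift[OF K(1) p(1,2) that(2,1)]
      by (auto simp: v_def c_def)
    then show "((\<lambda>n. v n (\<lambda>x. f (k + x))) \<longlongrightarrow> J f) G" using G(3)[of f] by simp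
  qed
  have Jn: "0 \<le> J f" if "f \<in> Cc euclidean" for f
  proof (rule tendsto_lowerbound[OF G(3) _ G(2)])
    show "\<forall>\<^sub>F n in G. 0 \<le> v n f"
      using that covering_number_nonneg[OF K(1) p(1,2) that] c0
      by (auto simp: v_def c_def less_imp_le intro!: always_eventually divide_nonneg_nonneg)
  qed
  have Jsub: "J (\<lambda>x. f x + g x) \<le> J f + J g" if fg: "f \<in> Cc euclidean" "g \<in> Cc euclidean" for f g
  proof (rule tendsto_le[OF G(2) tendsto_add[OF G(3) G(3)] G(3)])
    show "\<forall>\<^sub>F n in G. v n (\<lambda>x. f x + g x) \<le> v n f + v n g"
      using fg Cc_add[OF fg] covering_number_add[OF K(1) p(1,2) fg] c0
      by (auto simp: v_def c_def less_imp_le add_divide_distrib[symmetric] intro!: always_eventually divide_right_mono)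
  qed
  have Jadd: "J (\<lambda>x. f x + g x) = J f + J g" if fg: "f \<in> Cc euclidean" "g \<in> Cc euclidean" for f g
  proof (rule antisym[OF Jsub[OF fg]])
    have sC: "(\<lambda>x. f x + g x) \<in> Cc euclidean" using Cc_add[OF fg] .
    obtain h where h: "h \<in> Cc euclidean" and hV:
      "\<And>e. 0 < e \<Longrightarrow> \<exists>V. open V \<and> (0::'a) \<in> V \<and> (\<forall>K \<phi>. is_subgroup K \<longrightarrow> \<phi> \<in> Cc euclidean \<longrightarrow> 0 < \<phi> 0 \<longrightarrow>
       (\<forall>x. \<phi> x \<noteq> 0 \<longrightarrow> x \<in> V) \<longrightarrow>
       covering_number K \<phi> f + covering_number K \<phi> g
         \<le> (1 + 2 * e) * (covering_number K \<phi> (\<lambda>x. f x + g x) + e * covering_number K \<phi> h))"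
      by (rule covering_number_almost_additive[OF fg]) (rule that)
    have lim: "J f + J g \<le> (1 + 2 * e) * (J (\<lambda>x. f x + g x) + e * J h)" if e: "0 < e" for e
    proof (rule tendsto_le[OF G(2)])
      show "((\<lambda>n. v n f + v n g) \<longlongrightarrow> J f + J g) G" by (intro tendsto_add G(3))
      show "((\<lambda>n. (1 + 2 * e) * (v n (\<lambda>x. f x + g x) + e * v n h)) \<longlongrightarrow>
          (1 + 2 * e) * (J (\<lambda>x. f x + g x) + e * J h)) G"
        by (intro tendsto_mult_left tendsto_add G(3))
      obtain V where V: "open V" "(0::'a) \<in> V" and Vb: "\<forall>K \<phi>. is_subgroup K \<longrightarrow> \<phi> \<in> Cc euclidean \<longrightarrow> 0 < \<phi> 0 \<longrightarrow>
       (\<forall>x. \<phi> x \<noteq> 0 \<longrightarrow> x \<in> V) \<longrightarrow>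
       covering_number K \<phi> f + covering_number K \<phi> g
         \<le> (1 + 2 * e) * (covering_number K \<phi> (\<lambda>x. f x + g x) + e * covering_number K \<phi> h)"
        using hV[OF e] by blast
      have "\<forall>\<^sub>F n in G. A n \<subseteq> V" using filter_leD[OF G(1) A(3)[OF V]] .
      then show "\<forall>\<^sub>F n in G. v n f + v n g \<le> (1 + 2 * e) * (v n (\<lambda>x. f x + g x) + e * v n h)"
      proof eventually_elim
        case (elim n)
        have "c n f + c n g \<le> (1 + 2 * e) * (c n (\<lambda>x. f x + g x) + e * c n h)"
          unfolding c_def by (rule Vb[rule_format, OF K(1) p(1,2)]) (use elim p(3) in blast)
        then have "(c n f + c n g) / c n \<phi>0 \<le> (1 + 2 * e) * (c n (\<lambda>x. f x + g x) + e * c n h) / c n \<phi>0"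
          using c0[of n] by (intro divide_right_mono) auto
        then show ?case using fg sC h by (simp add: v_def add_divide_distrib algebra_simps)
      qed
    qed
    let ?s = "J (\<lambda>x. f x + g x)"
    have sn: "0 \<le> ?s" "0 \<le> J h" using Jn sC h by auto
    show "J f + J g \<le> ?s"
    proof (rule field_le_epsilon)
      fix d :: real assume d: "0 < d"
      \<comment> \<open>For \<open>e \<le> 1\<close>, \<open>(1 + 2e)(s + eJ) \<le> s + e(2s + 3J)\<close>; the summand \<open>1\<close> avoids division by zero.\<close>
      define e where "e = min 1 (d / (2 * ?s + 3 * J h + 1))"
      have den: "0 < 2 * ?s + 3 * J h + 1" using sn by linarith
      have e: "0 < e" "e \<le> 1" "e * (2 * ?s + 3 * J h + 1) \<le> d"
        unfolding e_def using d den by (auto simp: min_def pos_le_divide_eq[symmetric])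
      have "J f + J g \<le> (1 + 2 * e) * (?s + e * J h)" by (rule lim[OF e(1)])
      also have "\<dots> = ?s + e * (2 * ?s + J h + 2 * (e * J h))" by (simp add: algebra_simps)
      also have "\<dots> \<le> ?s + e * (2 * ?s + 3 * J h + 1)"
        using e sn mult_right_mono[OF e(2) sn(2)] by (intro add_left_mono mult_left_mono) auto
      also have "\<dots> \<le> ?s + d" using e(3) by simp
      finally show "J f + J g \<le> ?s + d" .
    qed
  qed
  have J: "positive_functional euclidean J"
    unfolding positive_functional_def using Jn Jadd Jscale by blast
  have van: "J f = 0" if f: "f \<in> Cc euclidean" "\<And>x. x \<in> K \<Longrightarrow> f x = 0" for f
  proof (rule tendsto_unique[OF G(2) G(3)])
    have "c n f = 0" for n
    proof (rule antisym)
      show "c n f \<le> 0" unfolding c_def using f(2) by (intro covering_number_le[OF translate_sum.zero]) auto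
      show "0 \<le> c n f" unfolding c_def by (rule covering_number_nonneg[OF K(1) p(1,2) f(1)])
    qed
    then have "(\<lambda>n. v n f) = (\<lambda>_. 0)" by (simp add: v_def fun_eq_iff)
    then show "((\<lambda>n. v n f) \<longlongrightarrow> 0) G" by simp
  qed
  have van': "J f = 0" if "subordinate euclidean (- K) f" for f
    by (rule van[OF subordinate_Cc[OF that]]) (use that in \<open>auto simp: subordinate_def\<close>)
  obtain M where "left_haar K M" "\<And>f. f \<in> Cc euclidean \<Longrightarrow> (\<integral>\<^sup>+x. ennreal (f x) \<partial>M) = ennreal (J f)"
    using left_haar_of_functional[OF K J van' Jshift] by blast
  then show ?thesis using J1 \<phi>0(1) by auto
qed

lemma countable_compact_cover:
  obtains \<P> where "countable \<P>" "\<And>P. P \<in> \<P> \<Longrightarrow> compact P" "\<Union>\<P> = (UNIV :: 'a set)"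
proof -
  have "\<exists>W P. open W \<and> compact P \<and> x \<in> W \<and> W \<subseteq> P" for x :: 'a
    using lc unfolding locally_compact_space_def by auto
  then obtain W P where W: "\<And>x::'a. open (W x)" "\<And>x. compact (P x)" "\<And>x. x \<in> W x" "\<And>x. W x \<subseteq> P x"
    by metis
  obtain \<F> where F: "\<F> \<subseteq> range W" "countable \<F>" "\<Union>\<F> = \<Union>(range W)"
    using Lindelof[of "range W"] W(1) by auto
  then obtain S where S: "countable S" "\<F> = W ` S" by (metis countable_subset_image)
  show thesis
  proof (rule that[of "P ` S"])
    have "(UNIV :: 'a set) = \<Union>\<F>" using F(3) W(3) by auto
    also have "\<dots> \<subseteq> \<Union>(P ` S)" using S(2) W(4) by blast
    finally show "\<Union>(P ` S) = UNIV" by blast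
  qed (use S W in auto)
qed

lemma left_haar_sigma_finite:
  assumes "left_haar K (M :: 'a measure)"
  shows "sigma_finite_measure M"
proof
  have sM: "sets M = sets borel" using assms by (simp add: left_haar_def)
  then have sp: "space M = UNIV" using sets_eq_imp_space_eq by fastforce
  obtain \<P> where P: "countable \<P>" "\<And>P. P \<in> \<P> \<Longrightarrow> compact P" "\<Union>\<P> = (UNIV :: 'a set)"
    using countable_compact_cover by metis
  have "emeasure M Q \<noteq> \<infinity>" if Q: "compact Q" for Q
  proof -
    obtain f where f: "f \<in> Cc euclidean" "\<And>x. x \<in> Q \<Longrightarrow> f x = 1"
      using group_bump[OF Q open_UNIV subset_UNIV] by metis
    have "emeasure M Q = (\<integral>\<^sup>+x. indicator Q x \<partial>M)"
      using Q sM by (intro nn_integral_indicator[symmetric]) (simp add: compact_imp_closed)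
    also have "\<dots> \<le> (\<integral>\<^sup>+x. ennreal (f x) \<partial>M)"
      using f by (intro nn_integral_mono) (auto simp: indicator_def)
    also have "\<dots> < top" using assms f(1) unfolding left_haar_def by blast
    finally show ?thesis by simp
  qed
  then show "\<exists>A. countable A \<and> A \<subseteq> sets M \<and> \<Union> A = space M \<and> (\<forall>a\<in>A. emeasure M a \<noteq> \<infinity>)"
    using P sM sp by (intro exI[of _ \<P>]) (auto simp: compact_imp_closed)
qed

text \<open>
  If \<open>f(k) > 0\<close> then \<open>g\<close> is dominated on \<open>K\<close> by finitely many translates of \<open>f\<close>, and these would all have integral
  zero together with \<open>f\<close>.
\<close>

lemma left_haar_pos:
  assumes M: "left_haar K (M :: 'a measure)" "is_subgroup K" "closed K"
    and g: "g \<in> Cc euclidean" "(\<integral>\<^sup>+x. ennreal (g x) \<partial>M) \<noteq> 0"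
    and f: "f \<in> Cc euclidean" "k \<in> K" "0 < f k"
  shows "0 < (\<integral>\<^sup>+x. ennreal (f x) \<partial>M)"
proof (rule ccontr)
  assume "\<not> ?thesis"
  then have z: "(\<integral>\<^sup>+x. ennreal (f x) \<partial>M) = 0" by simp
  have sM: "sets M = sets borel" using M by (simp add: left_haar_def)
  have mf: "(\<lambda>x. ennreal (f (l + x))) \<in> borel_measurable M" for l
    using Cc_borel[OF Cc_shift_left[OF f(1)] sM] .
  have mf': "(\<lambda>x. ennreal (f x)) \<in> borel_measurable borel"
    using Cc_borel[OF f(1) refl] .
  have zs: "(\<integral>\<^sup>+x. ennreal (f (l + x)) \<partial>M) = 0" if "l \<in> K" for l
    using left_haar_nn_integral_shift[OF M(1) that mf' M(2)] z by simp
  obtain B where B: "0 \<le> B" "\<And>K. is_subgroup K \<Longrightarrow>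
      \<exists>c u. translate_sum K (\<lambda>x. f (k + x)) c u \<and> c \<le> B \<and> (\<forall>x. x \<in> K \<longrightarrow> g x \<le> u x)"
    by (rule uniform_cover[OF Cc_shift_left[OF f(1)], of k g]) (use f g in auto)
  obtain c u where u: "translate_sum K (\<lambda>x. f (k + x)) c u" "\<And>x. x \<in> K \<Longrightarrow> g x \<le> u x"
    using B(2)[OF M(2)] by blast
  from u(1) have "(\<lambda>x. ennreal (u x)) \<in> borel_measurable M \<and> (\<integral>\<^sup>+x. ennreal (u x) \<partial>M) = 0"
  proof (induction rule: translate_sum.induct)
    case (step c u a j)
    have "k + - j \<in> K" using M(2) f(2) step(3) unfolding is_subgroup_def by blast
    then have l: "k - j \<in> K" by simp
    have "k + (- j + x) = (k - j) + x" for x by (simp add: add.assoc[symmetric])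
    then have "ennreal (u x + a * f (k + (- j + x))) = ennreal (u x) + ennreal a * ennreal (f ((k - j) + x))" for x
      using translate_sum_nonneg[OF step(1), of x] Cc_nonneg[OF f(1)] step(2)
      by (simp add: ennreal_plus ennreal_mult)
    moreover have "(\<lambda>x. ennreal (u x)) \<in> borel_measurable M" "(\<integral>\<^sup>+x. ennreal (u x) \<partial>M) = 0"
      using step by auto
    ultimately show ?case
      using mf[of "k - j"] zs[OF l]
      by (simp add: nn_integral_add nn_integral_cmult borel_measurable_add borel_measurable_times)
  qed simp
  moreover have "(\<integral>\<^sup>+x. ennreal (g x) \<partial>M) \<le> (\<integral>\<^sup>+x. ennreal (u x) \<partial>M)"
    using left_haar_AE[OF M(1,3)] u(2) by (intro nn_integral_mono_AE) (auto intro: ennreal_leI)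
  ultimately show False using g(2) by simp
qed

end

section \<open>Uniqueness of Haar measures\<close>

definition Cc_integral :: "'a measure \<Rightarrow> ('a \<Rightarrow> real) \<Rightarrow> real" where
  "Cc_integral M f = enn2real (\<integral>\<^sup>+x. ennreal (f x) \<partial>M)"

lemma Cc_integral_nonneg: "0 \<le> Cc_integral M f"
  by (simp add: Cc_integral_def)

lemma pair_borel_measurable:
  fixes F :: "'a::second_countable_topology \<times> 'a \<Rightarrow> real"
  assumes "continuous_on UNIV F" "sets M = sets borel" "sets N = sets borel"
  shows "(\<lambda>z. ennreal (F z)) \<in> borel_measurable (M \<Otimes>\<^sub>M N)"
proof -
  have "sets (M \<Otimes>\<^sub>M N) = sets (borel \<Otimes>\<^sub>M borel :: ('a \<times> 'a) measure)"
    by (rule sets_pair_measure_cong) (use assms in auto)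
  also have "(borel \<Otimes>\<^sub>M borel :: ('a \<times> 'a) measure) = borel" by (rule borel_prod)
  finally have "sets (M \<Otimes>\<^sub>M N) = sets (borel :: ('a \<times> 'a) measure)" .
  moreover have "(\<lambda>z. ennreal (F z)) \<in> borel_measurable borel"
    using borel_measurable_continuous_onI[OF assms(1)] by simp
  ultimately show ?thesis using measurable_cong_sets by blast
qed

context
  fixes K :: "'a::topological_group_add set" and M :: "'a measure"
  assumes K: "is_subgroup K" "closed K" and M: "left_haar K M"
begin

lemma sets_left_haar: "sets M = sets borel"
  using M by (simp add: left_haar_def)

lemma Cc_integral_eq: "f \<in> Cc euclidean \<Longrightarrow> (\<integral>\<^sup>+x. ennreal (f x) \<partial>M) = ennreal (Cc_integral M f)"
  using M unfolding left_haar_def Cc_integral_def by simp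

lemma Cc_integral_eqI: "f \<in> Cc euclidean \<Longrightarrow> (\<integral>\<^sup>+x. ennreal (f x) \<partial>M) = ennreal r \<Longrightarrow> 0 \<le> r \<Longrightarrow> Cc_integral M f = r"
  by (simp add: Cc_integral_def)

lemma Cc_integral_add:
  assumes "f \<in> Cc euclidean" "g \<in> Cc euclidean"
  shows "Cc_integral M (\<lambda>x. f x + g x) = Cc_integral M f + Cc_integral M g"
proof (rule Cc_integral_eqI[OF Cc_add[OF assms]])
  have "(\<integral>\<^sup>+x. ennreal (f x + g x) \<partial>M) = (\<integral>\<^sup>+x. ennreal (f x) + ennreal (g x) \<partial>M)"
    using Cc_nonneg[OF assms(1)] Cc_nonneg[OF assms(2)] by (simp add: ennreal_plus)
  also have "\<dots> = ennreal (Cc_integral M f) + ennreal (Cc_integral M g)"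
    using Cc_integral_eq assms Cc_borel[OF assms(1) sets_left_haar] Cc_borel[OF assms(2) sets_left_haar]
    by (simp add: nn_integral_add)
  finally show "(\<integral>\<^sup>+x. ennreal (f x + g x) \<partial>M) = ennreal (Cc_integral M f + Cc_integral M g)"
    by (simp add: ennreal_plus Cc_integral_nonneg)
qed (simp add: Cc_integral_nonneg)

lemma Cc_integral_scale:
  assumes "f \<in> Cc euclidean" "0 \<le> r"
  shows "Cc_integral M (\<lambda>x. r * f x) = r * Cc_integral M f"
proof (rule Cc_integral_eqI[OF Cc_scale[OF assms]])
  have "(\<integral>\<^sup>+x. ennreal (r * f x) \<partial>M) = (\<integral>\<^sup>+x. ennreal r * ennreal (f x) \<partial>M)"
    using assms by (simp add: ennreal_mult Cc_nonneg[OF assms(1)])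
  also have "\<dots> = ennreal r * ennreal (Cc_integral M f)"
    using Cc_integral_eq assms Cc_borel[OF assms(1) sets_left_haar] by (simp add: nn_integral_cmult)
  finally show "(\<integral>\<^sup>+x. ennreal (r * f x) \<partial>M) = ennreal (r * Cc_integral M f)"
    using assms by (simp add: ennreal_mult Cc_integral_nonneg)
qed (use assms in \<open>simp add: Cc_integral_nonneg\<close>)

lemma Cc_integral_mono:
  assumes "f \<in> Cc euclidean" "g \<in> Cc euclidean" "\<And>x. x \<in> K \<Longrightarrow> f x \<le> g x"
  shows "Cc_integral M f \<le> Cc_integral M g"
proof -
  have "(\<integral>\<^sup>+x. ennreal (f x) \<partial>M) \<le> (\<integral>\<^sup>+x. ennreal (g x) \<partial>M)"
    using left_haar_AE[OF M K(2)] assms(3) by (intro nn_integral_mono_AE) (auto intro: ennreal_leI)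
  then show ?thesis using Cc_integral_eq assms by (simp add: Cc_integral_nonneg)
qed

lemma Cc_integral_diff_le:
  assumes "f \<in> Cc euclidean" "g \<in> Cc euclidean" "h \<in> Cc euclidean"
    "\<And>x. x \<in> K \<Longrightarrow> \<bar>f x - g x\<bar> \<le> h x"
  shows "\<bar>Cc_integral M f - Cc_integral M g\<bar> \<le> Cc_integral M h"
proof -
  have "Cc_integral M f \<le> Cc_integral M (\<lambda>x. g x + h x)"
    "Cc_integral M g \<le> Cc_integral M (\<lambda>x. f x + h x)"
    using assms(4) by (intro Cc_integral_mono assms Cc_add; force simp: abs_le_iff algebra_simps)+
  then show ?thesis using assms by (simp add: Cc_integral_add)
qed

lemma Cc_integral_zero: "f \<in> Cc euclidean \<Longrightarrow> (\<And>x. x \<in> K \<Longrightarrow> f x = 0) \<Longrightarrow> Cc_integral M f = 0"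
  using Cc_integral_mono[OF _ Cc_zero, of f] Cc_integral_nonneg[of M f]
  by (simp add: Cc_integral_def[of M "\<lambda>_. 0"])

lemma Cc_integral_shift:
  assumes "k \<in> K" "f \<in> Cc euclidean"
  shows "Cc_integral M (\<lambda>x. f (k + x)) = Cc_integral M f"
  using left_haar_nn_integral_shift[OF M assms(1) Cc_borel[OF assms(2) refl] K(1)]
  by (simp add: Cc_integral_def)

end

context
  assumes lc: "locally_compact_space
    (euclidean :: 'a::{topological_group_add, t2_space, second_countable_topology} topology)"
begin

lemma Cc_integral_pos:
  assumes K: "is_subgroup K" "closed K" and M: "left_haar K (M :: 'a measure)"
    and g: "g \<in> Cc euclidean" "Cc_integral M g \<noteq> 0" and f: "f \<in> Cc euclidean" "k \<in> K" "0 < f k"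
  shows "0 < Cc_integral M f"
proof -
  have "(\<integral>\<^sup>+x. ennreal (g x) \<partial>M) \<noteq> 0" using g(2) by (auto simp: Cc_integral_def)
  then have "0 < (\<integral>\<^sup>+x. ennreal (f x) \<partial>M)" using left_haar_pos[OF lc M K g(1) _ f] by blast
  then show ?thesis using Cc_integral_eq[OF K M f(1)] by (simp add: Cc_integral_nonneg)
qed

context
  fixes K :: "'a set" and \<mu> \<nu> :: "'a measure"
  assumes K: "is_subgroup K" "closed K" and \<mu>: "left_haar K \<mu>" and \<nu>: "left_haar K \<nu>"
begin

text \<open>
  On \<open>K\<close> the function \<open>x \<mapsto> \<integral> g(t\<^sup>-\<^sup>1x) d\<nu>(t)\<close> is constant, by invariance of \<open>\<nu>\<close>. Insert it into \<open>\<mu>(f)\<close>, exchange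
  the integrals and replace \<open>x\<close> by \<open>tx\<close> in the integral over \<open>\<mu>\<close>.
\<close>

lemma haar_convolution:
  assumes f: "f \<in> Cc euclidean" and g: "g \<in> Cc euclidean"
  shows "(\<integral>\<^sup>+x. ennreal (f x) \<partial>\<mu>) * (\<integral>\<^sup>+t. ennreal (g (- t)) \<partial>\<nu>) =
    (\<integral>\<^sup>+x. ennreal (g x) * (\<integral>\<^sup>+t. ennreal (f (t + x)) \<partial>\<nu>) \<partial>\<mu>)"
proof -
  have s: "sets \<mu> = sets borel" "sets \<nu> = sets borel" using \<mu> \<nu> by (simp_all add: left_haar_def)
  interpret m: sigma_finite_measure \<mu> by (rule left_haar_sigma_finite[OF lc \<mu>])
  interpret n: sigma_finite_measure \<nu> by (rule left_haar_sigma_finite[OF lc \<nu>])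
  interpret p: pair_sigma_finite \<nu> \<mu> ..
  have cf: "continuous_on UNIV f" and cg: "continuous_on UNIV g"
    using Cc_cont[OF f] Cc_cont[OF g] by simp_all
  have g_meas: "(\<lambda>x. ennreal (g (- x))) \<in> borel_measurable borel" "(\<lambda>t. ennreal (g (- t + x))) \<in> borel_measurable \<nu>"
    "(\<lambda>x. ennreal (g (- t + x))) \<in> borel_measurable \<mu>" "(\<lambda>t. ennreal (f (t + x))) \<in> borel_measurable \<nu>" for x t
    using Cc_borel[OF Cc_reflect[OF g, of 0] refl] Cc_borel[OF Cc_reflect[OF g, of x] s(2)]
      Cc_borel[OF Cc_shift_left[OF g, of "- t"] s(1)] Cc_borel[OF Cc_shift_right[OF f, of x] s(2)] by simp_all
  have "(\<integral>\<^sup>+x. ennreal (f x) \<partial>\<mu>) * (\<integral>\<^sup>+t. ennreal (g (- t)) \<partial>\<nu>) =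
      (\<integral>\<^sup>+x. ennreal (f x) * (\<integral>\<^sup>+t. ennreal (g (- t)) \<partial>\<nu>) \<partial>\<mu>)"
    using Cc_borel[OF f s(1)] by (rule nn_integral_multc[symmetric])
  also have "\<dots> = (\<integral>\<^sup>+x. ennreal (f x) * (\<integral>\<^sup>+t. ennreal (g (- t + x)) \<partial>\<nu>) \<partial>\<mu>)"
  proof (rule nn_integral_cong_AE, use left_haar_AE[OF \<mu> K(2)] in eventually_elim)
    case (elim x)
    have "(\<integral>\<^sup>+t. ennreal (g (- (x + t) + x)) \<partial>\<nu>) = (\<integral>\<^sup>+t. ennreal (g (- t + x)) \<partial>\<nu>)"
      using left_haar_nn_integral_shift[OF \<nu> elim Cc_borel[OF Cc_reflect[OF g, of x] refl] K(1)] .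
    then show ?case by (simp add: minus_add add.assoc)
  qed
  also have "\<dots> = (\<integral>\<^sup>+x. (\<integral>\<^sup>+t. ennreal (f x * g (- t + x)) \<partial>\<nu>) \<partial>\<mu>)"
    using g_meas by (simp add: nn_integral_cmult ennreal_mult Cc_nonneg[OF f] Cc_nonneg[OF g])
  also have "\<dots> = (\<integral>\<^sup>+t. (\<integral>\<^sup>+x. ennreal (f x * g (- t + x)) \<partial>\<mu>) \<partial>\<nu>)"
    using p.Fubini[OF pair_borel_measurable[OF _ s(2,1), of "\<lambda>z. f (snd z) * g (- fst z + snd z)"]]
    by (simp add: continuous_intros continuous_on_compose2[OF cf] continuous_on_compose2[OF cg])
  also have "\<dots> = (\<integral>\<^sup>+t. (\<integral>\<^sup>+x. ennreal (f (t + x) * g x) \<partial>\<mu>) \<partial>\<nu>)"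
  proof (rule nn_integral_cong_AE, use left_haar_AE[OF \<nu> K(2)] in eventually_elim)
    case (elim t)
    have C: "(\<lambda>x. f x * g (- t + x)) \<in> Cc euclidean"
      using Cc_mult[OF f] Cc_cont[OF Cc_shift_left[OF g]] Cc_nonneg[OF g] by blast
    show ?case
      using left_haar_nn_integral_shift[OF \<mu> elim Cc_borel[OF C refl] K(1)]
      by (simp add: add.assoc[symmetric])
  qed
  also have "\<dots> = (\<integral>\<^sup>+x. (\<integral>\<^sup>+t. ennreal (f (t + x) * g x) \<partial>\<nu>) \<partial>\<mu>)"
    using p.Fubini[OF pair_borel_measurable[OF _ s(2,1), of "\<lambda>z. f (fst z + snd z) * g (snd z)"]]
    by (simp add: continuous_intros continuous_on_compose2[OF cf] continuous_on_compose2[OF cg])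
  also have "\<dots> = (\<integral>\<^sup>+x. ennreal (g x) * (\<integral>\<^sup>+t. ennreal (f (t + x)) \<partial>\<nu>) \<partial>\<mu>)"
  proof (rule nn_integral_cong)
    fix x
    have "(\<integral>\<^sup>+t. ennreal (f (t + x) * g x) \<partial>\<nu>) = (\<integral>\<^sup>+t. ennreal (g x) * ennreal (f (t + x)) \<partial>\<nu>)"
      by (simp add: ennreal_mult Cc_nonneg[OF f] Cc_nonneg[OF g] mult.commute)
    then show "(\<integral>\<^sup>+t. ennreal (f (t + x) * g x) \<partial>\<nu>) = ennreal (g x) * (\<integral>\<^sup>+t. ennreal (f (t + x)) \<partial>\<nu>)"
      using g_meas(4)[of x] by (simp add: nn_integral_cmult)
  qed
  finally show ?thesis .
qed

text \<open>
  When \<open>g\<close> is supported near the identity, \<open>\<nu>(f(\<cdot> x))\<close> is close to \<open>\<nu>(f)\<close> for all \<open>x\<close> in the support of \<open>g\<close>,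
  and the right-hand side of \<open>haar_convolution\<close> is close to \<open>\<nu>(f) \<mu>(g)\<close>.
\<close>

lemma haar_ratio_approx:
  assumes f: "f \<in> Cc euclidean"
  shows "\<exists>H\<ge>0. \<forall>e>0. \<exists>V. open V \<and> 0 \<in> V \<and> (\<forall>g. g \<in> Cc euclidean \<longrightarrow> (\<forall>x. g x \<noteq> 0 \<longrightarrow> x \<in> V) \<longrightarrow>
    \<bar>Cc_integral \<mu> f * Cc_integral \<nu> (\<lambda>t. g (- t)) - Cc_integral \<nu> f * Cc_integral \<mu> g\<bar> \<le> e * H * Cc_integral \<mu> g)"
proof -
  note iu = Cc_integral_eq[OF K \<mu>] and iv = Cc_integral_eq[OF K \<nu>]
  have s: "sets \<mu> = sets borel" using \<mu> by (simp add: left_haar_def)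
  obtain h where h: "h \<in> Cc euclidean" and hV: "\<And>e. 0 < e \<Longrightarrow>
    \<exists>V. open V \<and> 0 \<in> V \<and> (\<forall>v\<in>V. \<forall>x::'a. \<bar>f (x + v) - f x\<bar> \<le> e * h x)"
    using uniform_right[OF lc f] by blast
  show ?thesis
  proof (intro exI[of _ "Cc_integral \<nu> h"] conjI allI impI)
    fix e :: real assume e: "0 < e"
    obtain V where V: "open V" "0 \<in> V" "\<And>v x. v \<in> V \<Longrightarrow> \<bar>f (x + v) - f x\<bar> \<le> e * h x"
      using hV[OF e] by blast
    have close: "\<bar>Cc_integral \<nu> (\<lambda>t. f (t + v)) - Cc_integral \<nu> f\<bar> \<le> e * Cc_integral \<nu> h" if "v \<in> V" for v
      using Cc_integral_diff_le[OF K \<nu> Cc_shift_right[OF f] f Cc_scale[OF h, of e], of v] V(3)[OF that] e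
        Cc_integral_scale[OF K \<nu> h, of e] by simp
    show "\<exists>V. open V \<and> 0 \<in> V \<and> (\<forall>g. g \<in> Cc euclidean \<longrightarrow> (\<forall>x. g x \<noteq> 0 \<longrightarrow> x \<in> V) \<longrightarrow>
      \<bar>Cc_integral \<mu> f * Cc_integral \<nu> (\<lambda>t. g (- t)) - Cc_integral \<nu> f * Cc_integral \<mu> g\<bar>
        \<le> e * Cc_integral \<nu> h * Cc_integral \<mu> g)"
    proof (intro exI[of _ V] conjI allI impI)
      fix g assume g: "g \<in> Cc euclidean" and supp: "\<forall>x. g x \<noteq> 0 \<longrightarrow> x \<in> V"
      let ?I = "Cc_integral \<mu> f * Cc_integral \<nu> (\<lambda>t. g (- t))"
      let ?q = "Cc_integral \<mu> g" and ?b = "Cc_integral \<nu> f" and ?d = "e * Cc_integral \<nu> h"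
      have g': "(\<lambda>t. g (- t)) \<in> Cc euclidean" using Cc_reflect[OF g, of 0] by simp
      have d: "0 \<le> ?d" "0 \<le> ?b" "0 \<le> ?q" using e by (simp_all add: Cc_integral_nonneg)
      have I: "ennreal ?I = (\<integral>\<^sup>+x. ennreal (g x) * ennreal (Cc_integral \<nu> (\<lambda>t. f (t + x))) \<partial>\<mu>)"
        using haar_convolution[OF f g] iu[OF f] iv[OF g'] iv[OF Cc_shift_right[OF f]]
        by (simp add: ennreal_mult Cc_integral_nonneg)
      have "ennreal ?I \<le> (\<integral>\<^sup>+x. ennreal (?b + ?d) * ennreal (g x) \<partial>\<mu>)"
        unfolding I
      proof (rule nn_integral_mono)
        fix x show "ennreal (g x) * ennreal (Cc_integral \<nu> (\<lambda>t. f (t + x))) \<le> ennreal (?b + ?d) * ennreal (g x)"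
          using close[of x] supp by (cases "g x = 0") (auto simp: mult.commute intro!: mult_left_mono ennreal_leI)
      qed
      also have "\<dots> = ennreal ((?b + ?d) * ?q)"
        using Cc_borel[OF g s] d by (simp add: nn_integral_cmult iu[OF g] ennreal_mult)
      finally have up: "?I \<le> (?b + ?d) * ?q" using d by simp
      have "ennreal (?b * ?q) = (\<integral>\<^sup>+x. ennreal ?b * ennreal (g x) \<partial>\<mu>)"
        using Cc_borel[OF g s] d by (simp add: nn_integral_cmult iu[OF g] ennreal_mult)
      also have "\<dots> \<le> (\<integral>\<^sup>+x. ennreal (g x) * ennreal (Cc_integral \<nu> (\<lambda>t. f (t + x))) + ennreal ?d * ennreal (g x) \<partial>\<mu>)"
      proof (rule nn_integral_mono)
        fix x show "ennreal ?b * ennreal (g x) \<le> ennreal (g x) * ennreal (Cc_integral \<nu> (\<lambda>t. f (t + x))) + ennreal ?d * ennreal (g x)"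
        proof (cases "g x = 0")
          case False
          then have "?b \<le> Cc_integral \<nu> (\<lambda>t. f (t + x)) + ?d" using close[of x] supp by force
          then have "ennreal ?b * ennreal (g x) \<le> ennreal (Cc_integral \<nu> (\<lambda>t. f (t + x)) + ?d) * ennreal (g x)"
            by (intro mult_right_mono ennreal_leI) auto
          then show ?thesis using d by (simp add: ennreal_plus Cc_integral_nonneg algebra_simps)
        qed simp
      qed
      also have "\<dots> = ennreal ?I + ennreal (?d * ?q)"
      proof -
        have m: "(\<lambda>x. ennreal (g x) * ennreal (Cc_integral \<nu> (\<lambda>t. f (t + x)))) \<in> borel_measurable \<mu>"
        proof -
          have "(\<lambda>x. \<integral>\<^sup>+t. ennreal (f (t + x)) \<partial>\<nu>) \<in> borel_measurable \<mu>"
          proof -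
            interpret n: sigma_finite_measure \<nu> by (rule left_haar_sigma_finite[OF lc \<nu>])
            have cf: "continuous_on UNIV f" using Cc_cont[OF f] by simp
            have "continuous_on UNIV (\<lambda>z::'a \<times> 'a. f (snd z + fst z))"
              by (intro continuous_on_compose2[OF cf] continuous_intros) auto
            from pair_borel_measurable[OF this s, of \<nu>] \<nu>
            have "(\<lambda>z. ennreal (f (snd z + fst z))) \<in> borel_measurable (\<mu> \<Otimes>\<^sub>M \<nu>)"
              by (simp add: left_haar_def)
            from n.borel_measurable_nn_integral_fst[OF this] show ?thesis by simp
          qed
          then show ?thesis using iv[OF Cc_shift_right[OF f]] Cc_borel[OF g s] by simp
        qed
        show ?thesis
          using m Cc_borel[OF g s] d
          by (subst nn_integral_add) (simp_all add: I nn_integral_cmult iu[OF g] ennreal_mult)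
      qed
      finally have lo: "?b * ?q \<le> ?I + ?d * ?q" using d by (simp add: ennreal_plus[symmetric] Cc_integral_nonneg del: ennreal_plus)
      show "\<bar>?I - ?b * ?q\<bar> \<le> ?d * ?q" using up lo by (simp add: algebra_simps abs_le_iff)
    qed (use V in auto)
  qed (simp add: Cc_integral_nonneg)
qed

text \<open>
  Proportionality of \<open>\<mu>\<close> and \<open>\<nu>\<close> in the form of cross products, which also covers the case that one of them is zero.
  By \<open>haar_ratio_approx\<close> the ratio of \<open>\<nu>(f)\<close> to \<open>\<mu>(f)\<close> is approximately
  \<open>\<nu>(g(-\<cdot>)) / \<mu>(g)\<close>, which does not involve \<open>f\<close>; apply this with the same \<open>g\<close> to \<open>f1\<close> and \<open>f2\<close>.
\<close>

theorem left_haar_unique: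
  assumes f1: "f1 \<in> Cc euclidean" and f2: "f2 \<in> Cc euclidean"
  shows "Cc_integral \<mu> f1 * Cc_integral \<nu> f2 = Cc_integral \<mu> f2 * Cc_integral \<nu> f1"
proof (cases "Cc_integral \<mu> f1 = 0 \<and> Cc_integral \<mu> f2 = 0")
  case False
  then obtain f0 where f0: "f0 \<in> Cc euclidean" "Cc_integral \<mu> f0 \<noteq> 0" using f1 f2 by blast
  let ?a1 = "Cc_integral \<mu> f1" and ?a2 = "Cc_integral \<mu> f2"
  let ?b1 = "Cc_integral \<nu> f1" and ?b2 = "Cc_integral \<nu> f2"
  obtain H1 where H1: "0 \<le> H1" "\<And>e. 0 < e \<Longrightarrow> \<exists>V. open V \<and> 0 \<in> V \<and> (\<forall>g. g \<in> Cc euclidean \<longrightarrow> (\<forall>x. g x \<noteq> 0 \<longrightarrow> x \<in> V) \<longrightarrow>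
    \<bar>?a1 * Cc_integral \<nu> (\<lambda>t. g (- t)) - ?b1 * Cc_integral \<mu> g\<bar> \<le> e * H1 * Cc_integral \<mu> g)"
    using haar_ratio_approx[OF f1] by blast
  obtain H2 where H2: "0 \<le> H2" "\<And>e. 0 < e \<Longrightarrow> \<exists>V. open V \<and> 0 \<in> V \<and> (\<forall>g. g \<in> Cc euclidean \<longrightarrow> (\<forall>x. g x \<noteq> 0 \<longrightarrow> x \<in> V) \<longrightarrow>
    \<bar>?a2 * Cc_integral \<nu> (\<lambda>t. g (- t)) - ?b2 * Cc_integral \<mu> g\<bar> \<le> e * H2 * Cc_integral \<mu> g)"
    using haar_ratio_approx[OF f2] by blast
  have zero: "0 \<in> K" using K by (simp add: is_subgroup_def)
  have bound: "\<bar>?a1 * ?b2 - ?a2 * ?b1\<bar> \<le> e * (?a1 * H2 + ?a2 * H1)" if e: "0 < e" for e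
  proof -
    obtain V1 where V1: "open V1" "0 \<in> V1" "\<And>g. g \<in> Cc euclidean \<Longrightarrow> (\<forall>x. g x \<noteq> 0 \<longrightarrow> x \<in> V1) \<Longrightarrow>
      \<bar>?a1 * Cc_integral \<nu> (\<lambda>t. g (- t)) - ?b1 * Cc_integral \<mu> g\<bar> \<le> e * H1 * Cc_integral \<mu> g"
      using H1(2)[OF e] by blast
    obtain V2 where V2: "open V2" "0 \<in> V2" "\<And>g. g \<in> Cc euclidean \<Longrightarrow> (\<forall>x. g x \<noteq> 0 \<longrightarrow> x \<in> V2) \<Longrightarrow>
      \<bar>?a2 * Cc_integral \<nu> (\<lambda>t. g (- t)) - ?b2 * Cc_integral \<mu> g\<bar> \<le> e * H2 * Cc_integral \<mu> g"
      using H2(2)[OF e] by blast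
    obtain g where g: "g \<in> Cc euclidean" "\<And>x. x \<in> {0} \<Longrightarrow> g x = 1" "\<And>x. g x \<noteq> 0 \<Longrightarrow> x \<in> V1 \<inter> V2" "\<And>x. g x \<le> 1"
      by (rule group_bump[OF lc, of "{0}" "V1 \<inter> V2"]) (use V1 V2 in auto)
    let ?q = "Cc_integral \<mu> g" and ?n = "Cc_integral \<nu> (\<lambda>t. g (- t))"
    have q: "0 < ?q" using Cc_integral_pos[OF K \<mu> f0 g(1) zero] g(2) by simp
    have 1: "\<bar>?a1 * ?n - ?b1 * ?q\<bar> \<le> e * H1 * ?q" using V1(3)[OF g(1)] g(3) by blast
    have 2: "\<bar>?a2 * ?n - ?b2 * ?q\<bar> \<le> e * H2 * ?q" using V2(3)[OF g(1)] g(3) by blast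
    have a: "0 \<le> ?a1" "0 \<le> ?a2" by (simp_all add: Cc_integral_nonneg)
    have "(?a1 * ?b2 - ?a2 * ?b1) * ?q = ?a2 * (?a1 * ?n - ?b1 * ?q) - ?a1 * (?a2 * ?n - ?b2 * ?q)"
      by (simp add: algebra_simps)
    also have "\<bar>\<dots>\<bar> \<le> ?a2 * (e * H1 * ?q) + ?a1 * (e * H2 * ?q)"
    proof -
      have "\<bar>?a2 * (?a1 * ?n - ?b1 * ?q)\<bar> \<le> ?a2 * (e * H1 * ?q)"
        using 1 a by (simp add: abs_mult mult_left_mono)
      moreover have "\<bar>?a1 * (?a2 * ?n - ?b2 * ?q)\<bar> \<le> ?a1 * (e * H2 * ?q)"
        using 2 a by (simp add: abs_mult mult_left_mono)
      ultimately show ?thesis by linarith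
    qed
    also have "\<dots> = (e * (?a1 * H2 + ?a2 * H1)) * ?q" by (simp add: algebra_simps)
    finally show ?thesis using q by (simp add: abs_mult)
  qed
  let ?L = "?a1 * H2 + ?a2 * H1"
  have L: "0 \<le> ?L" using H1 H2 by (simp add: Cc_integral_nonneg)
  have "\<bar>?a1 * ?b2 - ?a2 * ?b1\<bar> \<le> 0 + d" if d: "0 < d" for d
  proof -
    have p: "0 < d / (?L + 1)" using d L by simp
    have "d / (?L + 1) * ?L \<le> d" using d L by (simp add: pos_divide_le_eq)
    then show ?thesis using bound[OF p] by simp
  qed
  then have "\<bar>?a1 * ?b2 - ?a2 * ?b1\<bar> \<le> 0" by (rule field_le_epsilon)
  then show ?thesis by simp
qed simp

end

end

section \<open>Continuous dependence on the subgroup\<close>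

lemma Sub_iff: "K \<in> Sub \<longleftrightarrow> is_subgroup K \<and> closed K"
  by (simp add: Sub_def)

lemma chabauty_miss: "compact C \<Longrightarrow> openin chabauty {K \<in> Sub. K \<inter> C = {}}"
  unfolding chabauty_def by (rule topology_generated_by_Basis) blast

lemma chabauty_hit: "open U \<Longrightarrow> openin chabauty {K \<in> Sub. K \<inter> U \<noteq> {}}"
  unfolding chabauty_def by (rule topology_generated_by_Basis) blast

lemma eventually_chabautyI:
  assumes "openin chabauty N" "H \<in> N" "\<And>K. K \<in> N \<Longrightarrow> P K"
  shows "eventually P (nhdsin chabauty H)"
  unfolding eventually_nhdsin using assms by blast

definition unit_haar :: "('a::topological_group_add \<Rightarrow> real) \<Rightarrow> 'a set \<Rightarrow> 'a measure" where
  "unit_haar \<phi> K = (SOME M. left_haar K M \<and> (\<integral>\<^sup>+x. ennreal (\<phi> x) \<partial>M) = 1)"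

text \<open>
  The averaging map \<open>P\<^sub>K\<close> onto functions on \<open>G/K\<close>, which are written as functions on \<open>G\<close> constant on left cosets.
\<close>

definition coset_average :: "('a::topological_group_add \<Rightarrow> real) \<Rightarrow> 'a set \<Rightarrow> ('a \<Rightarrow> real) \<Rightarrow> 'a \<Rightarrow> real" where
  "coset_average \<phi> K f g = Cc_integral (unit_haar \<phi> K) (\<lambda>x. f (g + x))"

lemma coset_average_nonneg: "0 \<le> coset_average \<phi> K f g"
  by (simp add: coset_average_def Cc_integral_nonneg)

text \<open>
  An open set in the product is a union of rectangles \<open>U b \<times> b\<close> with \<open>b\<close> running through a countable basis of the
  second factor and \<open>U b\<close> the largest open set that fits. The countable basis of one
  factor already makes the union countable.
\<close>

lemma open_prod_measurable:
  fixes X :: "'k topology"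
  assumes W: "openin (prod_topology X (euclidean :: 'a::second_countable_topology topology)) W"
  shows "W \<in> sets (borel_on X \<Otimes>\<^sub>M borel)"
proof -
  obtain B :: "'a set set" where B: "countable B" "topological_basis B"
    using ex_countable_basis by blast
  define U where "U b = \<Union>{N. openin X N \<and> N \<times> b \<subseteq> W}" for b
  have "W = (\<Union>b\<in>B. U b \<times> b)"
  proof (intro equalityI subsetI)
    fix z assume z: "z \<in> W"
    obtain k g where kg: "z = (k, g)" by (cases z)
    obtain N V where NV: "openin X N" "open V" "k \<in> N" "g \<in> V" "N \<times> V \<subseteq> W"
      using W z unfolding openin_prod_topology_alt kg open_openin[symmetric] by meson
    then obtain b where "b \<in> B" "g \<in> b" "b \<subseteq> V" using B(2) topological_basisE by metis
    then show "z \<in> (\<Union>b\<in>B. U b \<times> b)" using NV kg unfolding U_def by blast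
  qed (auto simp: U_def)
  also have "\<dots> \<in> sets (borel_on X \<Otimes>\<^sub>M borel)"
  proof (rule sets.countable_UN''[OF B(1)])
    fix b assume b: "b \<in> B"
    have "U b \<in> sets (borel_on X)" unfolding U_def by (intro open_in_borel_on openin_Union) auto
    moreover have "b \<in> sets borel" using topological_basis_open[OF B(2) b] by simp
    ultimately show "U b \<times> b \<in> sets (borel_on X \<Otimes>\<^sub>M borel)" by auto
  qed
  finally show ?thesis .
qed

lemma continuous_prod_measurable:
  fixes X :: "'k topology"
  assumes f: "continuous_map (prod_topology X (euclidean :: 'a::second_countable_topology topology)) Y f"
  shows "f \<in> borel_on X \<Otimes>\<^sub>M borel \<rightarrow>\<^sub>M borel_on Y"
  unfolding borel_on_def[of Y]
proof (rule measurable_measure_of)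
  have sp: "space (borel_on X \<Otimes>\<^sub>M (borel :: 'a measure)) = topspace (prod_topology X (euclidean :: 'a topology))"
    by (simp add: space_pair_measure)
  show "f \<in> space (borel_on X \<Otimes>\<^sub>M borel) \<rightarrow> topspace Y"
    unfolding sp using continuous_map_image_subset_topspace[OF f] by blast
  show "f -` U \<inter> space (borel_on X \<Otimes>\<^sub>M borel) \<in> sets (borel_on X \<Otimes>\<^sub>M borel)" if "U \<in> {U. openin Y U}" for U
  proof -
    have "openin (prod_topology X (euclidean :: 'a topology)) {z \<in> topspace (prod_topology X euclidean). f z \<in> U}"
      using that openin_continuous_map_preimage[OF f] by auto
    from open_prod_measurable[OF this] show ?thesis
      unfolding sp by (simp add: vimage_def Int_def conj_commute)
  qed
qed (auto dest: openin_subset)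

context
  fixes \<phi> :: "'a::{topological_group_add, t2_space, second_countable_topology} \<Rightarrow> real"
  assumes lc: "locally_compact_space (euclidean :: 'a topology)"
    and \<phi>: "\<phi> \<in> Cc euclidean" "0 < \<phi> 0"
begin

lemma unit_haar:
  assumes "K \<in> Sub"
  shows "left_haar K (unit_haar \<phi> K)" "Cc_integral (unit_haar \<phi> K) \<phi> = 1"
proof -
  have "\<exists>M. left_haar K M \<and> (\<integral>\<^sup>+x. ennreal (\<phi> x) \<partial>M) = 1"
    using left_haar_exists[OF lc _ _ \<phi>] assms by (simp add: Sub_iff)
  then have "left_haar K (unit_haar \<phi> K) \<and> (\<integral>\<^sup>+x. ennreal (\<phi> x) \<partial>unit_haar \<phi> K) = 1"
    unfolding unit_haar_def by (rule someI_ex)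
  then show "left_haar K (unit_haar \<phi> K)" "Cc_integral (unit_haar \<phi> K) \<phi> = 1"
    by (simp_all add: Cc_integral_def)
qed

lemma Sub_facts:
  assumes "K \<in> Sub"
  shows "is_subgroup K" "closed K" "left_haar K (unit_haar \<phi> K)"
  using assms unit_haar by (simp_all add: Sub_iff)

lemma unit_haar_bounded:
  assumes f: "f \<in> Cc euclidean"
  shows "\<exists>B. \<forall>K\<in>Sub. Cc_integral (unit_haar \<phi> K) f \<le> B"
proof -
  obtain B where B: "0 \<le> B"
    "\<And>K. is_subgroup K \<Longrightarrow> \<exists>c u. translate_sum K \<phi> c u \<and> c \<le> B \<and> (\<forall>x. x \<in> K \<longrightarrow> f x \<le> u x)"
    by (rule uniform_cover[OF lc \<phi> f]) (rule that)
  have "Cc_integral (unit_haar \<phi> K) f \<le> B" if K: "K \<in> Sub" for K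
  proof -
    note S = Sub_facts[OF K]
    obtain c u where u: "translate_sum K \<phi> c u" "c \<le> B" "\<And>x. x \<in> K \<Longrightarrow> f x \<le> u x"
      using B(2)[OF S(1)] by blast
    from u(1) have "u \<in> Cc euclidean \<and> Cc_integral (unit_haar \<phi> K) u = c"
    proof (induction rule: translate_sum.induct)
      case zero
      then show ?case by (simp add: Cc_zero Cc_integral_def)
    next
      case (step c u a k)
      have k: "- k \<in> K" using S(1) step(3) by (simp add: is_subgroup_def)
      have C: "(\<lambda>x. \<phi> (- k + x)) \<in> Cc euclidean" by (rule Cc_shift_left[OF \<phi>(1)])
      have "Cc_integral (unit_haar \<phi> K) (\<lambda>x. a * \<phi> (- k + x)) = a"
        using Cc_integral_scale[OF S C step(2)] Cc_integral_shift[OF S k \<phi>(1)] unit_haar(2)[OF K] by simp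
      then show ?case
        using step Cc_add[OF _ Cc_scale[OF C step(2)], of u] Cc_integral_add[OF S _ Cc_scale[OF C step(2)], of u]
        by simp
    qed
    then have "Cc_integral (unit_haar \<phi> K) f \<le> c"
      using Cc_integral_mono[OF S f _ u(3)] by auto
    then show ?thesis using u(2) by simp
  qed
  then show ?thesis by blast
qed

text \<open>
  If continuity failed at \<open>H\<close>, some filter finer than the neighbourhood filter would avoid a neighbourhood of the
  value at \<open>H\<close>. The uniform bounds provide a limit functional \<open>J\<close> along a still finer filter. This \<open>J\<close> comes from a
  Haar measure of \<open>H\<close>: it vanishes on functions with compact support off \<open>H\<close>, since nearby
  subgroups miss that support, and it is invariant under \<open>k \<in> H\<close>, since nearby subgroups contain elements close to
  \<open>k\<close>. As \<open>J \<phi> = 1\<close>, uniqueness identifies \<open>J\<close> with \<open>\<nu>\<^sub>H\<close>, a contradiction.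
\<close>

theorem unit_haar_tendsto:
  assumes H: "H \<in> Sub" and f: "f \<in> Cc euclidean"
  shows "((\<lambda>K. Cc_integral (unit_haar \<phi> K) f) \<longlongrightarrow> Cc_integral (unit_haar \<phi> H) f) (nhdsin chabauty H)"
proof (rule topological_tendstoI, rule ccontr)
  fix O' :: "real set"
  assume O': "open O'" "Cc_integral (unit_haar \<phi> H) f \<in> O'"
    and not: "\<not> eventually (\<lambda>K. Cc_integral (unit_haar \<phi> K) f \<in> O') (nhdsin chabauty H)"
  let ?N = "nhdsin chabauty H"
  define v where "v K f = (if f \<in> Cc euclidean \<and> K \<in> Sub then Cc_integral (unit_haar \<phi> K) f else 0)" for K f
  have "\<exists>B. \<forall>K. \<bar>v K f\<bar> \<le> B" for f
  proof (cases "f \<in> Cc euclidean")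
    case True
    then obtain B where "\<forall>K\<in>Sub. Cc_integral (unit_haar \<phi> K) f \<le> B" using unit_haar_bounded by blast
    then have "\<bar>v K f\<bar> \<le> \<bar>B\<bar>" for K
      by (cases "K \<in> Sub") (auto simp: v_def Cc_integral_nonneg abs_of_nonneg intro: order_trans[OF _ abs_ge_self])
    then show ?thesis by blast
  qed (auto simp: v_def)
  then obtain B where B: "\<And>K f. \<bar>v K f\<bar> \<le> B f" by metis
  define F where "F = inf ?N (principal {K. Cc_integral (unit_haar \<phi> K) f \<notin> O'})"
  have "F \<noteq> bot"
  proof
    assume "F = bot"
    then have "eventually (\<lambda>_. False) F" by simp
    then show False using not unfolding F_def eventually_inf_principal by simp
  qed
  obtain G J where G: "G \<le> F" "G \<noteq> bot" "\<And>f. ((\<lambda>K. v K f) \<longlongrightarrow> J f) G"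
    by (rule bounded_family_cluster[where v = v, OF \<open>F \<noteq> bot\<close> B]) (rule that)
  have GN: "eventually P G" if "eventually P ?N" for P
    using filter_leD[OF G(1), of P] that unfolding F_def by (auto intro: filter_leD[OF inf_le1])
  have GO: "eventually (\<lambda>K. Cc_integral (unit_haar \<phi> K) f \<notin> O') G"
    by (rule filter_leD[OF G(1)]) (simp add: F_def eventually_inf_principal)
  have GS: "eventually (\<lambda>K. K \<in> Sub) G"
    by (rule GN, rule eventually_chabautyI[OF openin_topspace]) (use H in \<open>auto simp: topspace_chabauty\<close>)
  have Jadd: "J (\<lambda>x. p x + q x) = J p + J q" if pq: "p \<in> Cc euclidean" "q \<in> Cc euclidean" for p q
  proof (rule tendsto_unique[OF G(2) G(3)])
    have "eventually (\<lambda>K. v K p + v K q = v K (\<lambda>x. p x + q x)) G"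
      using GS
    proof eventually_elim
      case (elim K)
      then show ?case using Cc_integral_add[OF Sub_facts[OF elim] pq] pq Cc_add[OF pq] by (simp add: v_def)
    qed
    then show "((\<lambda>K. v K (\<lambda>x. p x + q x)) \<longlongrightarrow> J p + J q) G"
      by (rule Lim_transform_eventually[OF tendsto_add[OF G(3) G(3)]])
  qed
  have Jscale: "J (\<lambda>x. r * p x) = r * J p" if p: "p \<in> Cc euclidean" and r: "0 \<le> r" for p r
  proof (rule tendsto_unique[OF G(2) G(3)])
    have "eventually (\<lambda>K. r * v K p = v K (\<lambda>x. r * p x)) G"
      using GS
    proof eventually_elim
      case (elim K)
      then show ?case using Cc_integral_scale[OF Sub_facts[OF elim] p r] p Cc_scale[OF p r] by (simp add: v_def)
    qed
    then show "((\<lambda>K. v K (\<lambda>x. r * p x)) \<longlongrightarrow> r * J p) G"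
      by (rule Lim_transform_eventually[OF tendsto_mult_left[OF G(3)]])
  qed
  have Jn: "0 \<le> J p" for p
    by (rule tendsto_lowerbound[OF G(3) _ G(2)]) (auto simp: v_def Cc_integral_nonneg intro!: always_eventually)
  have pf: "positive_functional euclidean J"
    unfolding positive_functional_def using Jadd Jscale Jn by blast
  have van: "J p = 0" if p: "subordinate euclidean (- H) p" for p
  proof (rule tendsto_unique[OF G(2) G(3)])
    obtain C where C: "compact C" "C \<subseteq> - H" "\<And>x. x \<notin> C \<Longrightarrow> p x = 0"
      using p unfolding subordinate_def by auto
    have "eventually (\<lambda>K. K \<in> Sub \<and> K \<inter> C = {}) G"
      by (rule GN, rule eventually_chabautyI[OF chabauty_miss[OF C(1)]]) (use H C(2) in auto)
    then have "eventually (\<lambda>K. 0 = v K p) G"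
    proof eventually_elim
      case (elim K)
      then have K: "K \<in> Sub" by blast
      have "Cc_integral (unit_haar \<phi> K) p = 0"
        using elim C(3) by (intro Cc_integral_zero[OF Sub_facts[OF K] subordinate_Cc[OF p]]) blast
      then show ?case by (simp add: v_def)
    qed
    then show "((\<lambda>K. v K p) \<longlongrightarrow> 0) G" by (rule Lim_transform_eventually[OF tendsto_const])
  qed
  have inv: "J (\<lambda>x. p (k + x)) = J p" if k: "k \<in> H" and p: "p \<in> Cc euclidean" for k p
  proof -
    obtain h where h: "h \<in> Cc euclidean" and hV: "\<And>e. 0 < e \<Longrightarrow>
      \<exists>V. open V \<and> 0 \<in> V \<and> (\<forall>v\<in>V. \<forall>x::'a. \<bar>p (v + x) - p x\<bar> \<le> e * h x)"
      using uniform_left[OF lc p] by blast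
    have hk: "(\<lambda>x. h (k + x)) \<in> Cc euclidean" and pk: "(\<lambda>x. p (k + x)) \<in> Cc euclidean"
      using Cc_shift_left h p by blast+
    have "\<bar>J (\<lambda>x. p (k + x)) - J p\<bar> \<le> e * B (\<lambda>x. h (k + x))" if e: "0 < e" for e
    proof (rule tendsto_upperbound[OF _ _ G(2)])
      show "((\<lambda>K. \<bar>v K (\<lambda>x. p (k + x)) - v K p\<bar>) \<longlongrightarrow> \<bar>J (\<lambda>x. p (k + x)) - J p\<bar>) G"
        by (intro tendsto_rabs tendsto_diff G(3))
      obtain V where V: "open V" "0 \<in> V" "\<And>v x. v \<in> V \<Longrightarrow> \<bar>p (v + x) - p x\<bar> \<le> e * h x"
        using hV[OF e] by blast
      have "open ((\<lambda>x. x - k) -` V)" by (rule open_vimage) (auto intro!: continuous_intros V)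
      from chabauty_hit[OF this]
      have "eventually (\<lambda>K. K \<in> Sub \<and> K \<inter> (\<lambda>x. x - k) -` V \<noteq> {}) G"
        by (intro GN, elim eventually_chabautyI) (use H k V(2) in auto)
      then show "eventually (\<lambda>K. \<bar>v K (\<lambda>x. p (k + x)) - v K p\<bar> \<le> e * B (\<lambda>x. h (k + x))) G"
      proof eventually_elim
        case (elim K)
        then obtain j where j: "j \<in> K" "j - k \<in> V" by auto
        have K: "K \<in> Sub" using elim by blast
        note S = Sub_facts[OF K]
        have "\<bar>p (k + x) - p (j + x)\<bar> \<le> e * h (k + x)" for x
          using V(3)[OF j(2), of "k + x"] by (simp add: add.assoc[symmetric] abs_minus_commute)
        then have "\<bar>Cc_integral (unit_haar \<phi> K) (\<lambda>x. p (k + x)) - Cc_integral (unit_haar \<phi> K) (\<lambda>x. p (j + x))\<bar>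
            \<le> Cc_integral (unit_haar \<phi> K) (\<lambda>x. e * h (k + x))"
          using e by (intro Cc_integral_diff_le[OF S pk Cc_shift_left[OF p] Cc_scale[OF hk]]) auto
        also have "\<dots> = e * v K (\<lambda>x. h (k + x))"
          using Cc_integral_scale[OF S hk] e K hk by (simp add: v_def)
        also have "\<dots> \<le> e * B (\<lambda>x. h (k + x))"
          using e B[of K "\<lambda>x. h (k + x)"] by (intro mult_left_mono) (auto simp: abs_le_iff)
        finally show ?case
          using Cc_integral_shift[OF S j(1) p] K p pk by (simp add: v_def)
      qed
    qed
    moreover have "0 \<le> B (\<lambda>x. h (k + x))" using B[of H "\<lambda>x. h (k + x)"] abs_ge_zero order_trans by blast
    ultimately have "\<bar>J (\<lambda>x. p (k + x)) - J p\<bar> \<le> 0 + d" if "0 < d" for d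
    proof -
      let ?b = "B (\<lambda>x. h (k + x))"
      have b: "0 \<le> ?b" by fact
      have "0 < d / (?b + 1)" using that b by simp
      then have "\<bar>J (\<lambda>x. p (k + x)) - J p\<bar> \<le> d / (?b + 1) * ?b" by fact
      also have "\<dots> \<le> d" using that b by (simp add: pos_divide_le_eq)
      finally show ?thesis by simp
    qed
    then have "\<bar>J (\<lambda>x. p (k + x)) - J p\<bar> \<le> 0" by (rule field_le_epsilon)
    then show ?thesis by simp
  qed
  have J1: "J \<phi> = 1"
  proof (rule tendsto_unique[OF G(2) G(3)])
    have "eventually (\<lambda>K. 1 = v K \<phi>) G"
      using GS by eventually_elim (simp add: v_def \<phi> unit_haar)
    then show "((\<lambda>K. v K \<phi>) \<longlongrightarrow> 1) G" by (rule Lim_transform_eventually[OF tendsto_const])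
  qed
  note S = Sub_facts[OF H]
  obtain M where M: "left_haar H M" "\<And>p. p \<in> Cc euclidean \<Longrightarrow> (\<integral>\<^sup>+x. ennreal (p x) \<partial>M) = ennreal (J p)"
    by (rule left_haar_of_functional[OF lc S(1,2) pf]; (rule van inv that; assumption))
  have MJ: "Cc_integral M p = J p" if "p \<in> Cc euclidean" for p
    using M(2)[OF that] Jn[of p] by (simp add: Cc_integral_def)
  have "J f = Cc_integral (unit_haar \<phi> H) f"
    using left_haar_unique[OF lc S(1,2) M(1) S(3) f \<phi>(1)] MJ f \<phi>(1) J1 unit_haar(2)[OF H] by simp
  then have "eventually (\<lambda>K. v K f \<in> O') G" using topological_tendstoD[OF G(3)[of f] O'(1)] O'(2) by simp
  with GO GS have "eventually (\<lambda>_. False) G"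
    by eventually_elim (use f in \<open>simp add: v_def\<close>)
  then show False using G(2) by (simp add: trivial_limit_def)
qed

lemma coset_average_tendsto:
  assumes H: "H \<in> Sub" and f: "f \<in> Cc euclidean"
  shows "((\<lambda>K. coset_average \<phi> K f g) \<longlongrightarrow> coset_average \<phi> H f g) (nhdsin chabauty H)"
  unfolding coset_average_def by (rule unit_haar_tendsto[OF H Cc_shift_left[OF f]])

text \<open>
  The neighbourhood \<open>V\<close> serves all closed subgroups at once, thanks to the uniform bound of \<open>unit_haar_bounded\<close>. Together
  with convergence at each point this gives joint continuity and uniform convergence on compact sets.
\<close>

lemma coset_average_equicontinuous:
  assumes f: "f \<in> Cc euclidean" and e: "0 < e"
  shows "\<exists>V. open V \<and> g0 \<in> V \<and> (\<forall>K\<in>Sub. \<forall>g\<in>V. \<bar>coset_average \<phi> K f g - coset_average \<phi> K f g0\<bar> < e)"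
proof -
  obtain h where h: "h \<in> Cc euclidean" and hV: "\<And>e. 0 < e \<Longrightarrow>
    \<exists>V. open V \<and> 0 \<in> V \<and> (\<forall>v\<in>V. \<forall>x::'a. \<bar>f (v + x) - f x\<bar> \<le> e * h x)"
    using uniform_left[OF lc f] by blast
  have hC: "(\<lambda>x. h (g0 + x)) \<in> Cc euclidean" by (rule Cc_shift_left[OF h])
  obtain B0 where B0: "\<forall>K\<in>Sub. Cc_integral (unit_haar \<phi> K) (\<lambda>x. h (g0 + x)) \<le> B0"
    using unit_haar_bounded[OF hC] by blast
  define B where "B = max B0 0 + 1"
  have B: "0 < B" "\<And>K. K \<in> Sub \<Longrightarrow> Cc_integral (unit_haar \<phi> K) (\<lambda>x. h (g0 + x)) < B"
    using B0 by (fastforce simp: B_def)+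
  define d where "d = e / B"
  have d: "0 < d" using e B by (simp add: d_def)
  obtain V where V: "open V" "0 \<in> V" "\<And>v x. v \<in> V \<Longrightarrow> \<bar>f (v + x) - f x\<bar> \<le> d * h x" using hV[OF d] by blast
  show ?thesis
  proof (intro exI[of _ "(\<lambda>x. x - g0) -` V"] conjI ballI)
    show "open ((\<lambda>x. x - g0) -` V)" by (rule open_vimage) (auto intro!: continuous_intros V)
    fix K :: "'a set" and g assume K: "K \<in> Sub" and g: "g \<in> (\<lambda>x. x - g0) -` V"
    note S = Sub_facts[OF K]
    have "\<bar>f (g + x) - f (g0 + x)\<bar> \<le> d * h (g0 + x)" for x
      using V(3)[of "g - g0" "g0 + x"] g by (simp add: add.assoc[symmetric])
    then have "\<bar>coset_average \<phi> K f g - coset_average \<phi> K f g0\<bar> \<le> Cc_integral (unit_haar \<phi> K) (\<lambda>x. d * h (g0 + x))"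
      unfolding coset_average_def using d
      by (intro Cc_integral_diff_le[OF S Cc_shift_left[OF f] Cc_shift_left[OF f] Cc_scale[OF hC]]) auto
    also have "\<dots> = d * Cc_integral (unit_haar \<phi> K) (\<lambda>x. h (g0 + x))"
      using Cc_integral_scale[OF S hC] d by simp
    also have "\<dots> < d * B" using B(2)[OF K] d by simp
    finally show "\<bar>coset_average \<phi> K f g - coset_average \<phi> K f g0\<bar> < e" using B(1) by (simp add: d_def)
  qed (use V in auto)
qed

lemma coset_average_continuous:
  assumes f: "f \<in> Cc euclidean" and K: "K \<in> Sub"
  shows "continuous_on UNIV (coset_average \<phi> K f)"
  unfolding continuous_on_def
proof (intro ballI tendstoI)
  fix x :: 'a and e :: real assume "0 < e"
  from coset_average_equicontinuous[OF f this, of x] K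
  obtain V where "open V" "x \<in> V" "\<And>g. g \<in> V \<Longrightarrow> \<bar>coset_average \<phi> K f g - coset_average \<phi> K f x\<bar> < e" by blast
  then show "\<forall>\<^sub>F y in at x within UNIV. dist (coset_average \<phi> K f y) (coset_average \<phi> K f x) < e"
    unfolding eventually_at_topological dist_real_def by blast
qed

lemma coset_average_mult_Cc:
  assumes "f \<in> Cc euclidean" "p \<in> Cc euclidean" "K \<in> Sub"
  shows "(\<lambda>g. f g * coset_average \<phi> K p g) \<in> Cc euclidean"
  by (rule Cc_mult[OF assms(1)]) (use coset_average_continuous[OF assms(2,3)] coset_average_nonneg in auto)

lemma coset_average_uniform:
  assumes f: "f \<in> Cc euclidean" and H: "H \<in> Sub" and C: "compact C" and e: "0 < e"
  shows "eventually (\<lambda>K. \<forall>g\<in>C. \<bar>coset_average \<phi> K f g - coset_average \<phi> H f g\<bar> < e) (nhdsin chabauty H)"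
proof -
  have "0 < e / 3" using e by simp
  from coset_average_equicontinuous[OF f this]
  obtain V where V: "\<And>g. open (V g)" "\<And>g. g \<in> V g"
    "\<And>g K y. K \<in> Sub \<Longrightarrow> y \<in> V g \<Longrightarrow> \<bar>coset_average \<phi> K f y - coset_average \<phi> K f g\<bar> < e / 3" by metis
  obtain F where F: "F \<subseteq> C" "finite F" "C \<subseteq> (\<Union>g\<in>F. V g)"
    by (rule compactE_image[OF C, of C V]) (use V in auto)
  have "eventually (\<lambda>K. \<forall>g\<in>F. \<bar>coset_average \<phi> K f g - coset_average \<phi> H f g\<bar> < e / 3) (nhdsin chabauty H)"
    using F(2)
  proof (rule eventually_ball_finite, intro ballI)
    fix g show "\<forall>\<^sub>F K in nhdsin chabauty H. \<bar>coset_average \<phi> K f g - coset_average \<phi> H f g\<bar> < e / 3"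
      using tendstoD[OF coset_average_tendsto[OF H f, of g], of "e / 3"] e by (simp add: dist_real_def)
  qed
  moreover have "eventually (\<lambda>K. K \<in> Sub) (nhdsin chabauty H)"
    by (rule eventually_chabautyI[OF openin_topspace]) (use H in \<open>auto simp: topspace_chabauty\<close>)
  ultimately show ?thesis
  proof eventually_elim
    case (elim K)
    show ?case
    proof
      fix y assume "y \<in> C"
      then obtain g where g: "g \<in> F" "y \<in> V g" using F(3) by blast
      have "\<bar>coset_average \<phi> K f y - coset_average \<phi> K f g\<bar> < e / 3"
        "\<bar>coset_average \<phi> H f y - coset_average \<phi> H f g\<bar> < e / 3"
        "\<bar>coset_average \<phi> K f g - coset_average \<phi> H f g\<bar> < e / 3"
        using V(3) g elim H by auto
      then show "\<bar>coset_average \<phi> K f y - coset_average \<phi> H f y\<bar> < e" by linarith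
    qed
  qed
qed

lemma coset_average_measurable:
  assumes f: "f \<in> Cc euclidean"
  shows "(\<lambda>(K, g). coset_average \<phi> K f g) \<in> borel_measurable (borel_on chabauty \<Otimes>\<^sub>M borel)"
proof -
  have "continuous_map (prod_topology chabauty (euclidean :: 'a topology)) euclideanreal (\<lambda>(K, g). coset_average \<phi> K f g)"
    unfolding continuous_map_eq_topcontinuous_at topcontinuous_at_def
  proof (intro ballI conjI allI impI)
    fix z :: "'a set \<times> 'a"
    assume z: "z \<in> topspace (prod_topology chabauty (euclidean :: 'a topology))"
    show "z \<in> topspace (prod_topology chabauty euclidean)" by (rule z)
    obtain K0 g0 where zz: "z = (K0, g0)" by (cases z)
    have K0: "K0 \<in> Sub" using z zz by (simp add: topspace_chabauty)
    fix O' :: "real set" assume O': "openin euclideanreal O' \<and> (case z of (K, g) \<Rightarrow> coset_average \<phi> K f g) \<in> O'"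
    then obtain e where e: "0 < e" "ball (coset_average \<phi> K0 f g0) e \<subseteq> O'"
      using zz open_contains_ball[of O'] by (auto simp: open_openin[symmetric])
    then have "0 < e / 2" by simp
    from coset_average_equicontinuous[OF f this, of g0] obtain V where V: "open V" "g0 \<in> V"
      "\<And>K g. K \<in> Sub \<Longrightarrow> g \<in> V \<Longrightarrow> \<bar>coset_average \<phi> K f g - coset_average \<phi> K f g0\<bar> < e / 2" by blast
    have "eventually (\<lambda>K. \<bar>coset_average \<phi> K f g0 - coset_average \<phi> K0 f g0\<bar> < e / 2) (nhdsin chabauty K0)"
      using tendstoD[OF coset_average_tendsto[OF K0 f, of g0], of "e / 2"] e by (simp add: dist_real_def)
    then obtain N where N: "openin chabauty N" "K0 \<in> N"
      "\<And>K. K \<in> N \<Longrightarrow> \<bar>coset_average \<phi> K f g0 - coset_average \<phi> K0 f g0\<bar> < e / 2"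
      using K0 unfolding eventually_nhdsin topspace_chabauty by blast
    show "\<exists>U. openin (prod_topology chabauty euclidean) U \<and> z \<in> U \<and>
        (\<forall>y\<in>U. (case y of (K, g) \<Rightarrow> coset_average \<phi> K f g) \<in> O')"
    proof (intro exI[of _ "N \<times> V"] conjI ballI)
      show "openin (prod_topology chabauty euclidean) (N \<times> V)"
        using N V by (simp add: openin_prod_Times_iff)
      fix y assume "y \<in> N \<times> V"
      then obtain K g where y: "y = (K, g)" "K \<in> N" "g \<in> V" by blast
      have "K \<in> Sub" using openin_subset[OF N(1)] y by (auto simp: topspace_chabauty)
      then have "\<bar>coset_average \<phi> K f g - coset_average \<phi> K0 f g0\<bar> < e"
        using V(3)[OF \<open>K \<in> Sub\<close> y(3)] N(3)[OF y(2)] by linarith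
      then show "(case y of (K, g) \<Rightarrow> coset_average \<phi> K f g) \<in> O'"
        using e(2) y by (auto simp: dist_real_def abs_minus_commute)
    qed (use zz N V in auto)
  qed auto
  from continuous_prod_measurable[OF this] show ?thesis
    using measurable_cong_sets[OF refl sets_borel_on_euclidean] by blast
qed

end

section \<open>Conjugation of subgroups\<close>

lemmas group_normalize = diff_conv_add_uminus minus_add add.assoc

lemma mem_conjugate: "x \<in> conjugate (- g) L \<longleftrightarrow> g + x - g \<in> (L :: 'a::group_add set)"
proof
  assume "x \<in> conjugate (- g) L"
  then show "g + x - g \<in> L" by (auto simp: conjugate_def add.assoc[symmetric])
next
  assume a: "g + x - g \<in> L"
  have "x = - g + (g + x - g) - - g" by (simp add: group_normalize del: add_uminus_conv_diff)
  then show "x \<in> conjugate (- g) L" unfolding conjugate_def using a by blast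
qed

lemma conjugate_Sub:
  assumes "L \<in> Sub"
  shows "conjugate (- g) L \<in> (Sub :: 'a::topological_group_add set set)"
proof -
  have L: "is_subgroup L" "closed L" using assms by (simp_all add: Sub_iff)
  have "is_subgroup (conjugate (- g) L)"
    unfolding is_subgroup_def
  proof (intro conjI ballI)
    show "0 \<in> conjugate (- g) L" using L by (simp add: mem_conjugate is_subgroup_def)
    fix x assume "x \<in> conjugate (- g) L"
    then have x: "g + x - g \<in> L" by (simp add: mem_conjugate)
    then have "- (g + x - g) \<in> L" using L unfolding is_subgroup_def by blast
    moreover have "- (g + x - g) = g + - x - g"
      by (simp only: diff_conv_add_uminus minus_add minus_minus add.assoc)
    ultimately show "- x \<in> conjugate (- g) L" by (simp add: mem_conjugate)
    fix y assume "y \<in> conjugate (- g) L"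
    then have "(g + x - g) + (g + y - g) \<in> L" using L x unfolding is_subgroup_def mem_conjugate by blast
    moreover have "(g + x - g) + (g + y - g) = g + (x + y) - g"
      by (simp add: diff_conv_add_uminus add.assoc del: add_uminus_conv_diff)
    ultimately show "x + y \<in> conjugate (- g) L" by (simp add: mem_conjugate)
  qed
  moreover have "conjugate (- g) L = (\<lambda>x. g + x - g) -` L" by (auto simp: mem_conjugate)
  then have "closed (conjugate (- g) L)"
    using L(2) by (auto intro!: closed_vimage continuous_intros)
  ultimately show ?thesis by (simp add: Sub_iff)
qed

lemma conjugate_translate:
  assumes "is_subgroup L" "l \<in> L"
  shows "conjugate (- (l + g)) L = conjugate (- g) (L :: 'a::group_add set)"
proof -
  have in_iff: "l + y + - l \<in> L \<longleftrightarrow> y \<in> L" for y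
  proof
    assume a: "l + y + - l \<in> L"
    have "- l \<in> L" using assms unfolding is_subgroup_def by blast
    then have "- l + (l + y + - l) + l \<in> L" using a assms unfolding is_subgroup_def by blast
    then show "y \<in> L" by (simp add: group_normalize del: add_uminus_conv_diff)
  next
    assume "y \<in> L"
    then show "l + y + - l \<in> L" using assms unfolding is_subgroup_def by blast
  qed
  have "(l + g) + x - (l + g) = l + (g + x - g) + - l" for x
    by (simp only: diff_conv_add_uminus minus_add add.assoc)
  then show ?thesis using in_iff by (auto simp: mem_conjugate simp del: add_uminus_conv_diff)
qed

context
  assumes lc: "locally_compact_space
    (euclidean :: 'a::{topological_group_add, t2_space, second_countable_topology} topology)"
begin

text \<open>
  It is enough to look at the two kinds of subbasic sets. If \<open>g\<^sub>0\<^sup>-\<^sup>1L\<^sub>0g\<^sub>0\<close> misses a compact set \<open>C\<close>, then for a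
  small compact neighbourhood \<open>D\<close> of \<open>g\<^sub>0\<close> the subgroup \<open>L\<^sub>0\<close> misses the compact set \<open>E\<close> of all \<open>gcg\<^sup>-\<^sup>1\<close> with \<open>g \<in> D\<close> and
  \<open>c \<in> C\<close>, by the tube lemma. If it meets an open set, so do its neighbours by continuity of the
  group operations.
\<close>

lemma conjugate_continuous:
  "continuous_map (prod_topology chabauty (euclidean :: 'a topology)) chabauty (\<lambda>(L, g). conjugate (- g) L)"
  unfolding chabauty_def[where 'a = 'a]
proof (rule continuous_on_generated_topo, fold chabauty_def)
  let ?X = "prod_topology chabauty (euclidean :: 'a topology)" and ?T = "\<lambda>(L, g :: 'a). conjugate (- g) L"
  have top: "topspace ?X = Sub \<times> UNIV" by (simp add: topspace_chabauty)
  fix S assume "S \<in> {{H \<in> Sub. H \<inter> K = {}} |K. compact K} \<union> {{H \<in> Sub. H \<inter> U \<noteq> {}} |U. open (U :: 'a set)}"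
  then consider C where "compact C" "S = {H \<in> Sub. H \<inter> C = {}}" | U where "open U" "S = {H \<in> Sub. H \<inter> U \<noteq> {}}" by blast
  then show "openin ?X (?T -` S \<inter> topspace ?X)"
  proof cases
    case (1 C)
    show ?thesis
      unfolding openin_prod_topology_alt
    proof (intro allI impI)
      fix L0 g0 assume a: "(L0, g0) \<in> ?T -` S \<inter> topspace ?X"
      then have L0: "L0 \<in> Sub" and dis: "conjugate (- g0) L0 \<inter> C = {}" using 1 top by auto
      define W where "W = (\<lambda>z. fst z + snd z - fst z) -` (- L0)"
      have "open W" unfolding W_def using L0
        by (intro open_vimage continuous_intros) (auto simp: Sub_iff)
      moreover have "{g0} \<times> C \<subseteq> W" using dis by (auto simp: W_def mem_conjugate)
      ultimately obtain X0 where X0: "g0 \<in> X0" "open X0" "X0 \<times> C \<subseteq> W"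
        using Elementary_Topology.tube_lemma[OF 1(1)] by metis
      obtain V D where V: "openin euclidean V" "compactin euclidean D" "closedin euclidean D" "{g0} \<subseteq> V" "V \<subseteq> D" "D \<subseteq> X0"
        by (rule compact_between[OF lc haus_euclidean, of "{g0}" X0]) (use X0 in auto)
      define E where "E = (\<lambda>z. fst z + snd z - fst z) ` (D \<times> C)"
      have "compact E" unfolding E_def
        using V(2) 1(1) by (intro compact_continuous_image continuous_intros compact_Times) auto
      from chabauty_miss[OF this]
      show "\<exists>U V. openin chabauty U \<and> openin euclidean V \<and> L0 \<in> U \<and> g0 \<in> V \<and> U \<times> V \<subseteq> ?T -` S \<inter> topspace ?X"
      proof (intro exI[of _ "{K \<in> Sub. K \<inter> E = {}}"] exI[of _ V] conjI)
        have "E \<subseteq> - L0" using X0(3) V(6) by (auto simp: E_def W_def)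
        then show "L0 \<in> {K \<in> Sub. K \<inter> E = {}}" using L0 by auto
        show "{K \<in> Sub. K \<inter> E = {}} \<times> V \<subseteq> ?T -` S \<inter> topspace ?X"
        proof
          fix z assume "z \<in> {K \<in> Sub. K \<inter> E = {}} \<times> V"
          then obtain L g where z: "z = (L, g)" "L \<in> Sub" "L \<inter> E = {}" "g \<in> V" by blast
          have "conjugate (- g) L \<inter> C = {}"
            using z V(5) by (force simp: mem_conjugate E_def)
          then show "z \<in> ?T -` S \<inter> topspace ?X" using z 1 top conjugate_Sub by auto
        qed
      qed (use V in auto)
    qed
  next
    case (2 U)
    show ?thesis
      unfolding openin_prod_topology_alt
    proof (intro allI impI)
      fix L0 g0 assume a: "(L0, g0) \<in> ?T -` S \<inter> topspace ?X"
      then obtain x where L0: "L0 \<in> Sub" and x: "x \<in> U" "g0 + x - g0 \<in> L0"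
      proof -
        have "L0 \<in> Sub" "conjugate (- g0) L0 \<inter> U \<noteq> {}" using a 2 by (auto simp: topspace_chabauty)
        then show ?thesis using that by (auto simp: mem_conjugate)
      qed
      define W where "W = (\<lambda>z. - snd z + fst z + snd z) -` U"
      have "open W" unfolding W_def using 2 by (intro open_vimage continuous_intros) auto
      moreover have "(g0 + x - g0, g0) \<in> W" using x by (simp add: W_def group_normalize del: add_uminus_conv_diff)
      ultimately obtain A B where AB: "open A" "open B" "(g0 + x - g0, g0) \<in> A \<times> B" "A \<times> B \<subseteq> W"
        by (rule open_prod_elim)
      show "\<exists>U V. openin chabauty U \<and> openin euclidean V \<and> L0 \<in> U \<and> g0 \<in> V \<and> U \<times> V \<subseteq> ?T -` S \<inter> topspace ?X"
      proof (intro exI[of _ "{K \<in> Sub. K \<inter> A \<noteq> {}}"] exI[of _ B] conjI)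
        show "{K \<in> Sub. K \<inter> A \<noteq> {}} \<times> B \<subseteq> ?T -` S \<inter> topspace ?X"
        proof
          fix z assume "z \<in> {K \<in> Sub. K \<inter> A \<noteq> {}} \<times> B"
          then obtain L g h where z: "z = (L, g)" "L \<in> Sub" "h \<in> L" "h \<in> A" "g \<in> B" by blast
          have "- g + h + g \<in> U" using AB(4) z by (auto simp: W_def)
          moreover have "- g + h + g \<in> conjugate (- g) L" using z(3) by (simp add: mem_conjugate add.assoc[symmetric])
          ultimately show "z \<in> ?T -` S \<inter> topspace ?X" using z 2 top conjugate_Sub by auto
        qed
      qed (use AB L0 x chabauty_hit[OF AB(1)] in auto)
    qed
  qed
next
  show "(\<lambda>(L, g :: 'a). conjugate (- g) L) ` topspace (prod_topology chabauty euclidean)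
    \<subseteq> \<Union> ({{H \<in> Sub. H \<inter> K = {}} |K. compact K} \<union> {{H \<in> Sub. H \<inter> U \<noteq> {}} |U. open (U :: 'a set)})"
  proof
    fix K assume "K \<in> (\<lambda>(L, g :: 'a). conjugate (- g) L) ` topspace (prod_topology chabauty euclidean)"
    then have "K \<in> Sub" using conjugate_Sub by (auto simp: topspace_chabauty)
    then show "K \<in> \<Union> ({{H \<in> Sub. H \<inter> K = {}} |K. compact K} \<union> {{H \<in> Sub. H \<inter> U \<noteq> {}} |U. open (U :: 'a set)})"
      by (intro UnionI[of "{H \<in> Sub. H \<inter> {} = {}}"]) auto
  qed
qed

lemma conjugate_measurable:
  "(\<lambda>(L, g). conjugate (- g) L) \<in> borel_on chabauty \<Otimes>\<^sub>M (borel :: 'a measure) \<rightarrow>\<^sub>M borel_on chabauty"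
  by (rule continuous_prod_measurable[OF conjugate_continuous])

lemma invariant_nn_integral:
  fixes \<Lambda> :: "'a set measure"
  assumes \<Lambda>: "invariant_subgroup_measure \<Lambda>" and F: "F \<in> borel_measurable (borel_on chabauty)"
  shows "(\<integral>\<^sup>+L. F (conjugate (- g) L) \<partial>\<Lambda>) = (\<integral>\<^sup>+K. F K \<partial>\<Lambda>)"
proof -
  have s: "sets \<Lambda> = sets (borel_on chabauty)" using \<Lambda> by (simp add: invariant_subgroup_measure_def)
  have sp: "space \<Lambda> = Sub" using sets_eq_imp_space_eq[OF s] by (simp add: topspace_chabauty)
  let ?T = "\<lambda>L. conjugate (- g) L"
  have T: "?T \<in> \<Lambda> \<rightarrow>\<^sub>M \<Lambda>"
    using measurable_Pair1[OF conjugate_measurable, of g] measurable_cong_sets[OF s s] by simp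
  have "distr \<Lambda> \<Lambda> ?T = \<Lambda>"
  proof (rule measure_eqI)
    fix A assume "A \<in> sets (distr \<Lambda> \<Lambda> ?T)"
    then have A: "A \<in> sets \<Lambda>" by simp
    then have ASub: "A \<subseteq> Sub" using sets.sets_into_space sp by blast
    have inv1: "conjugate g (conjugate (- g) L) = L" for L :: "'a set"
      by (auto simp: conjugate_def image_image group_normalize simp del: add_uminus_conv_diff)
    have inv2: "conjugate (- g) (conjugate g L) = L" for L :: "'a set"
      by (auto simp: conjugate_def image_image group_normalize simp del: add_uminus_conv_diff)
    have "?T -` A \<inter> space \<Lambda> = conjugate g ` A"
    proof (intro equalityI subsetI)
      fix L assume "L \<in> ?T -` A \<inter> space \<Lambda>"
      then show "L \<in> conjugate g ` A" using inv1[of L] by (metis IntD1 image_eqI vimageD)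
    next
      fix L assume "L \<in> conjugate g ` A"
      then obtain K where K: "K \<in> A" "L = conjugate g K" by blast
      have "conjugate (- (- g)) K \<in> Sub" using conjugate_Sub K ASub by blast
      then show "L \<in> ?T -` A \<inter> space \<Lambda>" using K inv2 sp by simp
    qed
    then show "emeasure (distr \<Lambda> \<Lambda> ?T) A = emeasure \<Lambda> A"
      using \<Lambda> A by (simp add: emeasure_distr[OF T A] invariant_subgroup_measure_def invariant_under_def)
  qed simp
  then have "(\<integral>\<^sup>+K. F K \<partial>\<Lambda>) = (\<integral>\<^sup>+K. F K \<partial>distr \<Lambda> \<Lambda> ?T)" by simp
  also have "\<dots> = (\<integral>\<^sup>+L. F (?T L) \<partial>\<Lambda>)"
    using F measurable_cong_sets[OF s refl] by (intro nn_integral_distr[OF T]) auto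
  finally show ?thesis by simp
qed

context
  fixes L :: "'a set" and m \<nu> :: "'a measure"
  assumes L: "L \<in> Sub" and m: "left_haar UNIV m" and \<nu>: "left_haar L \<nu>"
begin

text \<open>
  Exchange the integrals and replace \<open>x\<close> by \<open>lx\<close> under \<open>m\<close>. The weight \<open>U\<close> is unchanged by this, so any factor that depends
  only on the right coset \<open>Lx\<close> may be absorbed into it.
\<close>

lemma transfer_average:
  assumes U: "U \<in> borel_measurable borel" "\<And>l x. l \<in> L \<Longrightarrow> U (l + x) = (U x :: ennreal)"
    and p: "p \<in> Cc euclidean" and q: "q \<in> Cc euclidean"
  shows "(\<integral>\<^sup>+x. U x * (ennreal (p x) * (\<integral>\<^sup>+l. ennreal (q (- l + x)) \<partial>\<nu>)) \<partial>m) =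
    (\<integral>\<^sup>+x. U x * (ennreal (q x) * (\<integral>\<^sup>+l. ennreal (p (l + x)) \<partial>\<nu>)) \<partial>m)"
proof -
  have s: "sets m = sets borel" "sets \<nu> = sets borel" using m \<nu> by (simp_all add: left_haar_def)
  have sub: "is_subgroup (UNIV :: 'a set)" by (simp add: is_subgroup_def)
  interpret m: sigma_finite_measure m by (rule left_haar_sigma_finite[OF lc m])
  interpret n: sigma_finite_measure \<nu> by (rule left_haar_sigma_finite[OF lc \<nu>])
  interpret pr: pair_sigma_finite m \<nu> ..
  have cp: "continuous_on UNIV p" and cq: "continuous_on UNIV q"
    using Cc_cont[OF p] Cc_cont[OF q] by simp_all
  have Um: "U \<in> borel_measurable m" using U(1) measurable_cong_sets[OF s(1) refl] by blast
  have Uf: "(\<lambda>z. U (fst z)) \<in> borel_measurable (m \<Otimes>\<^sub>M \<nu>)"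
    using measurable_compose[OF measurable_fst Um] .
  have qm: "(\<lambda>l. ennreal (q (- l + x))) \<in> borel_measurable \<nu>" for x
    using Cc_borel[OF Cc_reflect[OF q, of x] s(2)] by simp
  have pm: "(\<lambda>l. ennreal (p (l + x))) \<in> borel_measurable \<nu>" for x
    using Cc_borel[OF Cc_shift_right[OF p, of x] s(2)] by simp
  have c1: "continuous_on UNIV (\<lambda>z. p (fst z) * q (- snd z + fst z))"
    by (intro continuous_intros continuous_on_compose2[OF cp] continuous_on_compose2[OF cq]) auto
  have c2: "continuous_on UNIV (\<lambda>z. p (snd z + fst z) * q (fst z))"
    by (intro continuous_intros continuous_on_compose2[OF cp] continuous_on_compose2[OF cq]) auto
  have "(\<integral>\<^sup>+x. U x * (ennreal (p x) * (\<integral>\<^sup>+l. ennreal (q (- l + x)) \<partial>\<nu>)) \<partial>m) =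
      (\<integral>\<^sup>+x. (\<integral>\<^sup>+l. U x * ennreal (p x * q (- l + x)) \<partial>\<nu>) \<partial>m)"
    using qm by (simp add: nn_integral_cmult ennreal_mult Cc_nonneg[OF p] Cc_nonneg[OF q])
  also have "\<dots> = (\<integral>\<^sup>+l. (\<integral>\<^sup>+x. U x * ennreal (p x * q (- l + x)) \<partial>m) \<partial>\<nu>)"
    using pr.Fubini[OF borel_measurable_times_ennreal[OF Uf pair_borel_measurable[OF c1 s]]] by simp
  also have "\<dots> = (\<integral>\<^sup>+l. (\<integral>\<^sup>+x. U x * ennreal (p (l + x) * q x) \<partial>m) \<partial>\<nu>)"
  proof (rule nn_integral_cong_AE, use left_haar_AE[OF \<nu>] L in \<open>simp add: Sub_iff\<close>, elim eventually_mono)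
    fix l assume l: "l \<in> L"
    have "(\<lambda>x. p x * q (- l + x)) \<in> Cc euclidean"
      using Cc_mult[OF p] Cc_cont[OF Cc_shift_left[OF q]] Cc_nonneg[OF q] by blast
    then have "(\<lambda>x. U x * ennreal (p x * q (- l + x))) \<in> borel_measurable borel"
      using U(1) by (intro borel_measurable_times_ennreal Cc_borel) auto
    from left_haar_nn_integral_shift[OF m UNIV_I this sub, of l]
    show "(\<integral>\<^sup>+x. U x * ennreal (p x * q (- l + x)) \<partial>m) = (\<integral>\<^sup>+x. U x * ennreal (p (l + x) * q x) \<partial>m)"
      using U(2)[OF l] by (simp add: add.assoc[symmetric])
  qed
  also have "\<dots> = (\<integral>\<^sup>+x. (\<integral>\<^sup>+l. U x * ennreal (p (l + x) * q x) \<partial>\<nu>) \<partial>m)"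
    using pr.Fubini[OF borel_measurable_times_ennreal[OF Uf pair_borel_measurable[OF c2 s]]] by simp
  also have "\<dots> = (\<integral>\<^sup>+x. U x * (ennreal (q x) * (\<integral>\<^sup>+l. ennreal (p (l + x)) \<partial>\<nu>)) \<partial>m)"
    using pm by (simp add: nn_integral_cmult ennreal_mult Cc_nonneg[OF p] Cc_nonneg[OF q] mult.commute[of "p _" "q _"])
  finally show ?thesis .
qed

end

end

section \<open>Averages over right cosets\<close>

text \<open>
  With \<open>K = g\<^sup>-\<^sup>1Lg\<close> the left coset \<open>gK\<close> is the right coset \<open>Lg\<close>. As a function of \<open>g\<close>, for fixed \<open>L\<close>, this average depends
  only on \<open>Lg\<close>.
\<close>

definition right_coset_average :: "('a::topological_group_add \<Rightarrow> real) \<Rightarrow> 'a set \<Rightarrow> ('a \<Rightarrow> real) \<Rightarrow> 'a \<Rightarrow> real" where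
  "right_coset_average \<phi> L f g = coset_average \<phi> (conjugate (- g) L) f g"

context
  fixes \<phi> :: "'a::{topological_group_add, t2_space, second_countable_topology} \<Rightarrow> real"
  assumes lc: "locally_compact_space (euclidean :: 'a topology)"
    and \<phi>: "\<phi> \<in> Cc euclidean" "0 < \<phi> 0"
begin

lemma right_coset_average_measurable:
  assumes f: "f \<in> Cc euclidean"
  shows "(\<lambda>(L, g). ennreal (right_coset_average \<phi> L f g)) \<in> borel_measurable (borel_on chabauty \<Otimes>\<^sub>M borel)"
proof -
  have "(\<lambda>z. ((\<lambda>(L, g). conjugate (- g) L) z, snd z)) \<in>
      borel_on chabauty \<Otimes>\<^sub>M (borel :: 'a measure) \<rightarrow>\<^sub>M borel_on chabauty \<Otimes>\<^sub>M borel"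
    using conjugate_measurable[OF lc] by (intro measurable_Pair measurable_snd)
  from measurable_compose[OF this coset_average_measurable[OF lc \<phi> f]]
  show ?thesis by (simp add: right_coset_average_def split_beta)
qed

lemma right_coset_average_invariant:
  assumes f: "f \<in> Cc euclidean" and L: "L \<in> Sub" and l: "l \<in> L"
  shows "right_coset_average \<phi> L f (l + g) = right_coset_average \<phi> L f g"
proof -
  let ?K = "conjugate (- g) L"
  have K: "?K \<in> Sub" by (rule conjugate_Sub[OF L])
  have eq: "conjugate (- (l + g)) L = ?K" using conjugate_translate L l by (auto simp: Sub_iff)
  have k: "- g + l + g \<in> ?K" using l by (simp add: mem_conjugate add.assoc[symmetric])
  have "Cc_integral (unit_haar \<phi> ?K) (\<lambda>x. f (g + ((- g + l + g) + x))) = Cc_integral (unit_haar \<phi> ?K) (\<lambda>x. f (g + x))"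
    by (rule Cc_integral_shift[OF Sub_facts[OF lc \<phi> K] k Cc_shift_left[OF f]])
  then show ?thesis
    unfolding right_coset_average_def coset_average_def eq by (simp add: add.assoc[symmetric])
qed

text \<open>
  For fixed \<open>x\<close> the image \<open>\<mu>\<close> of \<open>\<nu>\<^sub>K\<close>, \<open>K = x\<^sup>-\<^sup>1Lx\<close>, under \<open>k \<mapsto> xkx\<^sup>-\<^sup>1\<close> is a Haar measure of \<open>L\<close>, and the average of
  \<open>f\<close> is \<open>\<mu>(f(\<cdot> x))\<close>. So \<open>left_haar_unique\<close> applies; the factor of proportionality depends on \<open>x\<close> and cancels.
\<close>

lemma right_coset_average_ratio:
  assumes f1: "f1 \<in> Cc euclidean" and f2: "f2 \<in> Cc euclidean" and L: "L \<in> Sub"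
  defines "Q f x \<equiv> Cc_integral (unit_haar \<phi> L) (\<lambda>l. f (l + x))"
  shows "right_coset_average \<phi> L f1 x * Q f2 x = right_coset_average \<phi> L f2 x * Q f1 x"
proof -
  let ?K = "conjugate (- x) L"
  let ?\<nu> = "unit_haar \<phi> ?K"
  have K: "?K \<in> Sub" by (rule conjugate_Sub[OF L])
  note SK = Sub_facts[OF lc \<phi> K] and SL = Sub_facts[OF lc \<phi> L]
  have s: "sets ?\<nu> = sets borel" using SK by (simp add: left_haar_def)
  have sp: "space ?\<nu> = UNIV" using sets_eq_imp_space_eq[OF s] by simp
  define \<mu> where "\<mu> = distr ?\<nu> borel (\<lambda>k. x + k - x)"
  have meas: "(\<lambda>k. x + k - x) \<in> ?\<nu> \<rightarrow>\<^sub>M borel"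
    unfolding measurable_cong_sets[OF s refl] by (intro borel_measurable_continuous_onI continuous_intros)
  have C: "(\<lambda>k. f (x + k - x)) \<in> Cc euclidean" if "f \<in> Cc euclidean" for f
    by (rule Cc_homeo[OF that, where S = "\<lambda>y. - x + y + x"])
       (auto intro!: continuous_intros simp: group_normalize simp del: add_uminus_conv_diff)
  have int: "(\<integral>\<^sup>+y. ennreal (f y) \<partial>\<mu>) = (\<integral>\<^sup>+k. ennreal (f (x + k - x)) \<partial>?\<nu>)" if "f \<in> Cc euclidean" for f
    unfolding \<mu>_def by (rule nn_integral_distr[OF meas]) (simp add: Cc_borel[OF that])
  have "left_haar L \<mu>"
    unfolding left_haar_def
  proof (intro conjI ballI)
    show "sets \<mu> = sets borel" by (simp add: \<mu>_def)
    have "emeasure \<mu> (- L) = emeasure ?\<nu> ((\<lambda>k. x + k - x) -` (- L) \<inter> space ?\<nu>)"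
      unfolding \<mu>_def using SL by (intro emeasure_distr[OF meas]) auto
    also have "(\<lambda>k. x + k - x) -` (- L) \<inter> space ?\<nu> = - ?K" using sp by (auto simp: mem_conjugate)
    also have "emeasure ?\<nu> (- ?K) = 0" using SK(3) by (simp add: left_haar_def)
    finally show "emeasure \<mu> (- L) = 0" .
    show "(\<integral>\<^sup>+y. ennreal (f y) \<partial>\<mu>) < top" if "f \<in> Cc euclidean" for f
      unfolding int[OF that] using SK(3) C[OF that] by (simp add: left_haar_def)
    fix l A assume l: "l \<in> L" and A: "A \<in> sets (borel :: 'a measure)"
    let ?B = "(\<lambda>k. x + k - x) -` A"
    have lk: "- x + l + x \<in> ?K" using l by (simp add: mem_conjugate add.assoc[symmetric])
    have im: "(+) l ` A = (\<lambda>y. - l + y) -` A"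
    proof (intro equalityI subsetI)
      fix y assume "y \<in> (\<lambda>y. - l + y) -` A"
      moreover have "y = l + (- l + y)" by (simp add: add.assoc[symmetric])
      ultimately show "y \<in> (+) l ` A" by blast
    qed (auto simp: add.assoc[symmetric])
    have lA: "(+) l ` A \<in> sets borel"
      unfolding im
      by (rule measurable_sets_borel[OF _ A]) (intro borel_measurable_continuous_onI continuous_intros)
    have B: "?B \<in> sets borel"
      by (rule measurable_sets_borel[OF _ A]) (intro borel_measurable_continuous_onI continuous_intros)
    have "(\<lambda>k. x + k - x) -` ((+) l ` A) = (+) (- x + l + x) ` ?B"
    proof (intro equalityI subsetI)
      fix k assume "k \<in> (\<lambda>k. x + k - x) -` ((+) l ` A)"
      then obtain a where a: "a \<in> A" "x + k - x = l + a" by auto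
      define j where "j = - x + a + x"
      have "k = - x + (x + k - x) + x" by (simp add: group_normalize del: add_uminus_conv_diff)
      also have "\<dots> = (- x + l + x) + j" unfolding a(2) j_def by (simp add: group_normalize del: add_uminus_conv_diff)
      finally have "k = (- x + l + x) + j" .
      moreover have "x + j - x = a" by (simp add: j_def group_normalize del: add_uminus_conv_diff)
      ultimately show "k \<in> (+) (- x + l + x) ` ?B" using a(1) by auto
    next
      fix k assume "k \<in> (+) (- x + l + x) ` ?B"
      then obtain j where j: "x + j - x \<in> A" "k = (- x + l + x) + j" by auto
      have "x + k - x = l + (x + j - x)"
        unfolding j(2) by (simp add: group_normalize del: add_uminus_conv_diff)
      then show "k \<in> (\<lambda>k. x + k - x) -` ((+) l ` A)" using j(1) by auto
    qed
    then show "emeasure \<mu> ((+) l ` A) = emeasure \<mu> A"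
      using SK(3) lk B sp unfolding \<mu>_def
      by (simp add: emeasure_distr[OF meas lA] emeasure_distr[OF meas A] left_haar_def)
  qed
  note U = left_haar_unique[OF lc SL(1,2) this SL(3) Cc_shift_right[OF f1, of x] Cc_shift_right[OF f2, of x]]
  have "Cc_integral \<mu> (\<lambda>l. f (l + x)) = right_coset_average \<phi> L f x" if "f \<in> Cc euclidean" for f
    unfolding right_coset_average_def coset_average_def Cc_integral_def int[OF Cc_shift_right[OF that]]
    by (simp add: add.assoc)
  then show ?thesis using U f1 f2 by (simp add: Q_def)
qed

text \<open>
  Let \<open>E f\<close> be the average over right cosets, \<open>Q f (x) = \<integral> f(lx) d\<nu>\<^sub>L(l)\<close> and \<open>A(x) = \<integral> g(l\<^sup>-\<^sup>1x) d\<nu>\<^sub>L(l)\<close>. By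
  \<open>transfer_average\<close>, applied with the weight \<open>W \<cdot> E q\<close>,
  \<open>m(W \<cdot> E q \<cdot> p \<cdot> A) = m(W \<cdot> E q \<cdot> g \<cdot> Q p)\<close>, and \<open>E q \<cdot> Q p = E p \<cdot> Q q\<close> makes the right-hand side symmetric in \<open>p\<close>
  and \<open>q\<close>. With \<open>W = U / A\<close> the left-hand side becomes \<open>m(U \<cdot> p \<cdot> E q)\<close>. The choice \<open>g = f1 + f2\<close> ensures \<open>A > 0\<close> wherever
  \<open>f1\<close> or \<open>f2\<close> is positive.
\<close>

lemma right_coset_average_symmetric:
  assumes L: "L \<in> Sub" and m: "left_haar UNIV m"
    and U: "U \<in> borel_measurable borel" "\<And>l x. l \<in> L \<Longrightarrow> U (l + x) = (U x :: ennreal)"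
    and f1: "f1 \<in> Cc euclidean" and f2: "f2 \<in> Cc euclidean"
  shows "(\<integral>\<^sup>+x. U x * (ennreal (f1 x) * ennreal (right_coset_average \<phi> L f2 x)) \<partial>m) =
    (\<integral>\<^sup>+x. U x * (ennreal (f2 x) * ennreal (right_coset_average \<phi> L f1 x)) \<partial>m)"
proof -
  let ?\<nu> = "unit_haar \<phi> L"
  note S = Sub_facts[OF lc \<phi> L]
  define g where "g x = f1 x + f2 x" for x
  have g: "g \<in> Cc euclidean" unfolding g_def by (rule Cc_add[OF f1 f2])
  define A where "A x = (\<integral>\<^sup>+l. ennreal (g (- l + x)) \<partial>?\<nu>)" for x
  have Afin: "A x < top" for x
    unfolding A_def using Cc_reflect[OF g, of x] S(3) by (simp add: left_haar_def)
  have Apos: "A x \<noteq> 0" if "0 < g x" for x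
  proof -
    have "0 < Cc_integral ?\<nu> (\<lambda>l. g (- l + x))"
      by (rule Cc_integral_pos[OF lc S \<phi>(1) _ Cc_reflect[OF g], of 0])
         (use that S(1) unit_haar[OF lc \<phi> L] in \<open>auto simp: is_subgroup_def\<close>)
    then show ?thesis by (auto simp: A_def Cc_integral_def)
  qed
  have Ainv: "A (l + x) = A x" if l: "l \<in> L" for l x
  proof -
    have "(\<integral>\<^sup>+t. ennreal (g (- (l + t) + (l + x))) \<partial>?\<nu>) = (\<integral>\<^sup>+t. ennreal (g (- t + (l + x))) \<partial>?\<nu>)"
      by (rule left_haar_nn_integral_shift[OF S(3) l Cc_borel[OF Cc_reflect[OF g] refl] S(1)])
    then show ?thesis unfolding A_def by (simp add: minus_add add.assoc) (simp add: add.assoc[symmetric])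
  qed
  have Am: "A \<in> borel_measurable borel"
  proof -
    interpret n: sigma_finite_measure ?\<nu> by (rule left_haar_sigma_finite[OF lc S(3)])
    have cg: "continuous_on UNIV g" using Cc_cont[OF g] by simp
    have "continuous_on UNIV (\<lambda>z::'a \<times> 'a. g (- snd z + fst z))"
      by (intro continuous_on_compose2[OF cg] continuous_intros) auto
    from pair_borel_measurable[OF this refl, of ?\<nu>] S(3)
    have "(\<lambda>z. ennreal (g (- snd z + fst z))) \<in> borel_measurable (borel \<Otimes>\<^sub>M ?\<nu>)" by (simp add: left_haar_def)
    from n.borel_measurable_nn_integral_fst[OF this] show ?thesis by (simp add: A_def[abs_def])
  qed
  define W where "W x = U x / A x" for x
  have Lsp: "L \<in> space (borel_on chabauty)" using L by (simp add: topspace_chabauty)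
  have Em: "(\<lambda>x. ennreal (right_coset_average \<phi> L f x)) \<in> borel_measurable borel" if "f \<in> Cc euclidean" for f
    using measurable_Pair2[OF right_coset_average_measurable[OF that] Lsp] by simp
  have one: "(\<integral>\<^sup>+x. U x * (ennreal (p x) * ennreal (right_coset_average \<phi> L q x)) \<partial>m) =
      (\<integral>\<^sup>+x. W x * (ennreal (g x) * (ennreal (right_coset_average \<phi> L q x) * ennreal (Cc_integral ?\<nu> (\<lambda>l. p (l + x))))) \<partial>m)"
    if p: "p \<in> Cc euclidean" and q: "q \<in> Cc euclidean" and pg: "\<And>x. p x \<le> g x" for p q
  proof -
    have "(\<integral>\<^sup>+x. U x * (ennreal (p x) * ennreal (right_coset_average \<phi> L q x)) \<partial>m) =
        (\<integral>\<^sup>+x. (W x * ennreal (right_coset_average \<phi> L q x)) * (ennreal (p x) * A x) \<partial>m)"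
    proof (rule nn_integral_cong)
      fix x show "U x * (ennreal (p x) * ennreal (right_coset_average \<phi> L q x)) =
          (W x * ennreal (right_coset_average \<phi> L q x)) * (ennreal (p x) * A x)"
      proof (cases "p x = 0")
        case False
        then have "0 < g x" using pg[of x] Cc_nonneg[OF p, of x] by linarith
        then have "U x = W x * A x"
          using Apos Afin[of x] unfolding W_def by (simp add: ennreal_divide_times ennreal_times_divide mult_divide_eq_ennreal)
        then show ?thesis by (simp add: ac_simps)
      qed simp
    qed
    also have "\<dots> = (\<integral>\<^sup>+x. (W x * ennreal (right_coset_average \<phi> L q x)) * (ennreal (g x) * (\<integral>\<^sup>+l. ennreal (p (l + x)) \<partial>?\<nu>)) \<partial>m)"
      unfolding A_def
    proof (rule transfer_average[OF lc L m S(3) _ _ p g])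
      show "(\<lambda>x. W x * ennreal (right_coset_average \<phi> L q x)) \<in> borel_measurable borel"
        unfolding W_def using U(1) Am Em[OF q] by (intro borel_measurable_times_ennreal borel_measurable_divide_ennreal) auto
      show "W (l + x) * ennreal (right_coset_average \<phi> L q (l + x)) = W x * ennreal (right_coset_average \<phi> L q x)" if "l \<in> L" for l x
        using U(2)[OF that] Ainv[OF that] right_coset_average_invariant[OF q L that] by (simp add: W_def)
    qed
    also have "\<dots> = (\<integral>\<^sup>+x. W x * (ennreal (g x) * (ennreal (right_coset_average \<phi> L q x) * ennreal (Cc_integral ?\<nu> (\<lambda>l. p (l + x))))) \<partial>m)"
      using Cc_integral_eq[OF S Cc_shift_right[OF p]] by (simp add: ac_simps)
    finally show ?thesis .
  qed
  have nn: "0 \<le> right_coset_average \<phi> L q x" for q x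
    by (simp add: right_coset_average_def coset_average_def Cc_integral_nonneg)
  have "ennreal (right_coset_average \<phi> L f2 x) * ennreal (Cc_integral ?\<nu> (\<lambda>l. f1 (l + x))) =
      ennreal (right_coset_average \<phi> L f1 x) * ennreal (Cc_integral ?\<nu> (\<lambda>l. f2 (l + x)))" for x
    using right_coset_average_ratio[OF f1 f2 L, of x]
    by (simp add: ennreal_mult[symmetric] nn Cc_integral_nonneg)
  then show ?thesis
    using one[OF f1 f2] one[OF f2 f1] Cc_nonneg[OF f1] Cc_nonneg[OF f2] by (simp add: g_def)
qed

end

section \<open>The mass transport principle\<close>

context
  fixes \<phi> :: "'a::{topological_group_add, t2_space, second_countable_topology} \<Rightarrow> real"
    and m :: "'a measure"
  assumes lc: "locally_compact_space (euclidean :: 'a topology)"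
    and \<phi>: "\<phi> \<in> Cc euclidean" "0 < \<phi> 0" and m: "left_haar UNIV m"
begin

lemma UNIV_facts: "is_subgroup (UNIV :: 'a set)" "closed (UNIV :: 'a set)" "left_haar UNIV m"
  using m by (simp_all add: is_subgroup_def)

text \<open>
  Fubini's theorem brings the integral over \<open>\<lambda>\<close> inside, where for each \<open>g\<close> the substitution \<open>K = g\<^sup>-\<^sup>1Lg\<close> preserves
  \<open>\<lambda>\<close>. After a second exchange \<open>L\<close> is fixed and \<open>right_coset_average_symmetric\<close> applies with the weight
  \<open>g \<mapsto> u(g\<^sup>-\<^sup>1Lg)\<close>, which is constant on right cosets of \<open>L\<close>.
\<close>

lemma mass_transport:
  fixes \<Lambda> :: "'a set measure"
  assumes \<Lambda>: "invariant_subgroup_measure \<Lambda>" and u: "u \<in> borel_measurable (borel_on chabauty)"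
    and f1: "f1 \<in> Cc euclidean" and f2: "f2 \<in> Cc euclidean"
  shows "(\<integral>\<^sup>+K. u K * ennreal (Cc_integral m (\<lambda>g. f1 g * coset_average \<phi> K f2 g)) \<partial>\<Lambda>) =
    (\<integral>\<^sup>+K. u K * ennreal (Cc_integral m (\<lambda>g. f2 g * coset_average \<phi> K f1 g)) \<partial>\<Lambda>)"
proof -
  have s: "sets \<Lambda> = sets (borel_on chabauty)" using \<Lambda> by (simp add: invariant_subgroup_measure_def)
  have sp: "space \<Lambda> = Sub" using sets_eq_imp_space_eq[OF s] by (simp add: topspace_chabauty)
  have sm: "sets m = sets borel" using m by (simp add: left_haar_def)
  interpret l: sigma_finite_measure \<Lambda> using \<Lambda> by (simp add: invariant_subgroup_measure_def)
  interpret m: sigma_finite_measure m by (rule left_haar_sigma_finite[OF lc m])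
  interpret p: pair_sigma_finite \<Lambda> m ..
  have pair: "sets (\<Lambda> \<Otimes>\<^sub>M m) = sets (borel_on chabauty \<Otimes>\<^sub>M borel)"
    by (rule sets_pair_measure_cong[OF s sm])
  have meas: "F \<in> borel_measurable (\<Lambda> \<Otimes>\<^sub>M m)" if "F \<in> borel_measurable (borel_on chabauty \<Otimes>\<^sub>M borel)"
    for F :: "'a set \<times> 'a \<Rightarrow> ennreal"
    using that measurable_cong_sets[OF pair refl] by blast
  have fm: "(\<lambda>z. ennreal (f (snd z))) \<in> borel_measurable (borel_on chabauty \<Otimes>\<^sub>M borel)" if "f \<in> Cc euclidean"
    for f :: "'a \<Rightarrow> real"
    using measurable_compose[OF measurable_snd Cc_borel[OF that refl]] .
  have uc: "(\<lambda>z. u (conjugate (- snd z) (fst z))) \<in> borel_measurable (borel_on chabauty \<Otimes>\<^sub>M (borel :: 'a measure))"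
    using measurable_compose[OF conjugate_measurable[OF lc] u] by (simp add: split_beta)
  have uf: "(\<lambda>z. u (fst z)) \<in> borel_measurable (borel_on chabauty \<Otimes>\<^sub>M (borel :: 'a measure))"
    using measurable_compose[OF measurable_fst u] .
  have transform: "(\<integral>\<^sup>+K. u K * ennreal (Cc_integral m (\<lambda>g. p g * coset_average \<phi> K q g)) \<partial>\<Lambda>) =
      (\<integral>\<^sup>+L. (\<integral>\<^sup>+g. u (conjugate (- g) L) * (ennreal (p g) * ennreal (right_coset_average \<phi> L q g)) \<partial>m) \<partial>\<Lambda>)"
    if p: "p \<in> Cc euclidean" and q: "q \<in> Cc euclidean" for p q
  proof -
    have cm: "(\<lambda>z. ennreal (coset_average \<phi> (fst z) q (snd z))) \<in> borel_measurable (borel_on chabauty \<Otimes>\<^sub>M borel)"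
      using coset_average_measurable[OF lc \<phi> q] by (simp add: split_beta)
    have cr: "(\<lambda>z. ennreal (right_coset_average \<phi> (fst z) q (snd z))) \<in> borel_measurable (borel_on chabauty \<Otimes>\<^sub>M borel)"
      using right_coset_average_measurable[OF lc \<phi> q] by (simp add: split_beta)
    have "(\<integral>\<^sup>+K. u K * ennreal (Cc_integral m (\<lambda>g. p g * coset_average \<phi> K q g)) \<partial>\<Lambda>) =
        (\<integral>\<^sup>+K. (\<integral>\<^sup>+g. u K * (ennreal (p g) * ennreal (coset_average \<phi> K q g)) \<partial>m) \<partial>\<Lambda>)"
    proof (rule nn_integral_cong)
      fix K assume "K \<in> space \<Lambda>"
      then have K: "K \<in> Sub" using sp by simp
      note C = coset_average_mult_Cc[OF lc \<phi> p q K]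
      have "ennreal (Cc_integral m (\<lambda>g. p g * coset_average \<phi> K q g)) =
          (\<integral>\<^sup>+g. ennreal (p g) * ennreal (coset_average \<phi> K q g) \<partial>m)"
        using Cc_integral_eq[OF UNIV_facts C] by (simp add: ennreal_mult coset_average_nonneg Cc_nonneg[OF p])
      then show "u K * ennreal (Cc_integral m (\<lambda>g. p g * coset_average \<phi> K q g)) =
          (\<integral>\<^sup>+g. u K * (ennreal (p g) * ennreal (coset_average \<phi> K q g)) \<partial>m)"
        using Cc_borel[OF C sm]
        by (simp add: nn_integral_cmult ennreal_mult[symmetric] coset_average_nonneg Cc_nonneg[OF p])
    qed
    also have "\<dots> = (\<integral>\<^sup>+g. (\<integral>\<^sup>+K. u K * (ennreal (p g) * ennreal (coset_average \<phi> K q g)) \<partial>\<Lambda>) \<partial>m)"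
      using p.Fubini[OF meas[OF borel_measurable_times_ennreal[OF uf borel_measurable_times_ennreal[OF fm[OF p] cm]]]]
      by simp
    also have "\<dots> = (\<integral>\<^sup>+g. (\<integral>\<^sup>+L. u (conjugate (- g) L) * (ennreal (p g) * ennreal (right_coset_average \<phi> L q g)) \<partial>\<Lambda>) \<partial>m)"
    proof (rule nn_integral_cong)
      fix g
      have "(\<lambda>K. ennreal (coset_average \<phi> K q g)) \<in> borel_measurable (borel_on chabauty)"
        using measurable_Pair1[OF cm, of g] by simp
      then have "(\<lambda>K. u K * (ennreal (p g) * ennreal (coset_average \<phi> K q g))) \<in> borel_measurable (borel_on chabauty)"
        using u by (intro borel_measurable_times_ennreal) auto
      from invariant_nn_integral[OF lc \<Lambda> this, of g]
      show "(\<integral>\<^sup>+K. u K * (ennreal (p g) * ennreal (coset_average \<phi> K q g)) \<partial>\<Lambda>) =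
          (\<integral>\<^sup>+L. u (conjugate (- g) L) * (ennreal (p g) * ennreal (right_coset_average \<phi> L q g)) \<partial>\<Lambda>)"
        by (simp add: right_coset_average_def)
    qed
    also have "\<dots> = (\<integral>\<^sup>+L. (\<integral>\<^sup>+g. u (conjugate (- g) L) * (ennreal (p g) * ennreal (right_coset_average \<phi> L q g)) \<partial>m) \<partial>\<Lambda>)"
      using p.Fubini[OF meas[OF borel_measurable_times_ennreal[OF uc borel_measurable_times_ennreal[OF fm[OF p] cr]]]]
      by simp
    finally show ?thesis .
  qed
  have "(\<integral>\<^sup>+L. (\<integral>\<^sup>+g. u (conjugate (- g) L) * (ennreal (f1 g) * ennreal (right_coset_average \<phi> L f2 g)) \<partial>m) \<partial>\<Lambda>) =
      (\<integral>\<^sup>+L. (\<integral>\<^sup>+g. u (conjugate (- g) L) * (ennreal (f2 g) * ennreal (right_coset_average \<phi> L f1 g)) \<partial>m) \<partial>\<Lambda>)"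
  proof (rule nn_integral_cong)
    fix L assume "L \<in> space \<Lambda>"
    then have L: "L \<in> Sub" using sp by simp
    then have Lsp: "L \<in> space (borel_on chabauty)" by (simp add: topspace_chabauty)
    show "(\<integral>\<^sup>+g. u (conjugate (- g) L) * (ennreal (f1 g) * ennreal (right_coset_average \<phi> L f2 g)) \<partial>m) =
        (\<integral>\<^sup>+g. u (conjugate (- g) L) * (ennreal (f2 g) * ennreal (right_coset_average \<phi> L f1 g)) \<partial>m)"
    proof (rule right_coset_average_symmetric[OF lc \<phi> L m _ _ f1 f2])
      show "(\<lambda>g. u (conjugate (- g) L)) \<in> borel_measurable borel"
        using measurable_Pair2[OF uc Lsp] by simp
      show "u (conjugate (- (l + x)) L) = u (conjugate (- x) L)" if "l \<in> L" for l x
        using conjugate_translate[of L l x] L that by (simp add: Sub_iff)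
    qed
  qed
  then show ?thesis using transform[OF f1 f2] transform[OF f2 f1] by simp
qed

lemma average_pairing_tendsto:
  assumes H: "H \<in> Sub" and f: "f \<in> Cc euclidean" and p: "p \<in> Cc euclidean"
  shows "((\<lambda>K. Cc_integral m (\<lambda>g. f g * coset_average \<phi> K p g)) \<longlongrightarrow>
    Cc_integral m (\<lambda>g. f g * coset_average \<phi> H p g)) (nhdsin chabauty H)"
proof (rule tendstoI)
  fix e :: real assume e: "0 < e"
  obtain C where C: "compact C" "\<And>x. x \<notin> C \<Longrightarrow> f x = 0" using f by (metis CcE compactin_euclidean_iff)
  define d where "d = e / (Cc_integral m f + 1)"
  have mf: "0 \<le> Cc_integral m f" by (rule Cc_integral_nonneg)
  have d: "0 < d" using e mf by (simp add: d_def)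
  have "eventually (\<lambda>K. K \<in> Sub) (nhdsin chabauty H)"
    by (rule eventually_chabautyI[OF openin_topspace]) (use H in \<open>auto simp: topspace_chabauty\<close>)
  with coset_average_uniform[OF lc \<phi> p H C(1) d]
  show "\<forall>\<^sub>F K in nhdsin chabauty H. dist (Cc_integral m (\<lambda>g. f g * coset_average \<phi> K p g))
      (Cc_integral m (\<lambda>g. f g * coset_average \<phi> H p g)) < e"
  proof eventually_elim
    case (elim K)
    have "\<bar>Cc_integral m (\<lambda>g. f g * coset_average \<phi> K p g) - Cc_integral m (\<lambda>g. f g * coset_average \<phi> H p g)\<bar>
        \<le> Cc_integral m (\<lambda>g. d * f g)"
    proof (rule Cc_integral_diff_le[OF UNIV_facts])
      fix g
      show "\<bar>f g * coset_average \<phi> K p g - f g * coset_average \<phi> H p g\<bar> \<le> d * f g"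
      proof (cases "g \<in> C")
        case True
        then have "\<bar>coset_average \<phi> K p g - coset_average \<phi> H p g\<bar> \<le> d" using elim by force
        then have "f g * \<bar>coset_average \<phi> K p g - coset_average \<phi> H p g\<bar> \<le> f g * d"
          by (intro mult_left_mono Cc_nonneg[OF f])
        then show ?thesis
          using Cc_nonneg[OF f, of g] by (simp add: right_diff_distrib[symmetric] abs_mult mult.commute)
      qed (simp add: C)
    qed (use elim H d f p in \<open>auto intro: coset_average_mult_Cc[OF lc \<phi>] Cc_scale\<close>)
    also have "\<dots> = d * Cc_integral m f" using Cc_integral_scale[OF UNIV_facts f] d by simp
    also have "\<dots> < e"
      using e mf by (simp add: d_def pos_divide_less_eq)
    finally show ?case by (simp add: dist_real_def)
  qed
qed

text \<open>
  A strict inequality at \<open>H\<close> would persist, with a gap between constants \<open>a < b\<close>, on a neighbourhood \<open>N\<close> of \<open>H\<close>. As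
  \<open>H\<close> is in the support, \<open>N\<close> has positive measure, and by \<open>\<sigma>\<close>-finiteness it has a measurable subset \<open>D\<close> of positive finite measure.
  The indicator of \<open>D\<close> as weight then contradicts \<open>mass_transport\<close>.
\<close>

theorem average_pairing_symmetric:
  fixes \<Lambda> :: "'a set measure"
  assumes \<Lambda>: "invariant_subgroup_measure \<Lambda>" and H: "H \<in> topological_support chabauty \<Lambda>"
    and f1: "f1 \<in> Cc euclidean" and f2: "f2 \<in> Cc euclidean"
  shows "Cc_integral m (\<lambda>g. f1 g * coset_average \<phi> H f2 g) = Cc_integral m (\<lambda>g. f2 g * coset_average \<phi> H f1 g)"
proof -
  have s: "sets \<Lambda> = sets (borel_on chabauty)" using \<Lambda> by (simp add: invariant_subgroup_measure_def)
  have sp: "space \<Lambda> = Sub" using sets_eq_imp_space_eq[OF s] by (simp add: topspace_chabauty)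
  have HS: "H \<in> Sub" using H by (simp add: topological_support_def topspace_chabauty)
  define j where "j p q K = Cc_integral m (\<lambda>g. p g * coset_average \<phi> K q g)" for p q K
  have le: "\<not> j q p H < j p q H" if p: "p \<in> Cc euclidean" and q: "q \<in> Cc euclidean" for p q
  proof
    assume "j q p H < j p q H"
    then obtain a where a: "j q p H < a" "a < j p q H" using dense by blast
    then obtain b where b: "a < b" "b < j p q H" using dense by blast
    have a0: "0 < a" using a(1) Cc_integral_nonneg[of m] unfolding j_def by (meson le_less_trans)
    have "eventually (\<lambda>K. j q p K < a) (nhdsin chabauty H)" "eventually (\<lambda>K. b < j p q K) (nhdsin chabauty H)"
      unfolding j_def
      using order_tendstoD(2)[OF average_pairing_tendsto[OF HS q p], of a]
        order_tendstoD(1)[OF average_pairing_tendsto[OF HS p q], of b] a b by (simp_all add: j_def)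
    then have "eventually (\<lambda>K. j q p K < a \<and> b < j p q K) (nhdsin chabauty H)" by eventually_elim simp
    then obtain N where N: "openin chabauty N" "H \<in> N" "\<And>K. K \<in> N \<Longrightarrow> j q p K < a \<and> b < j p q K"
      using HS unfolding eventually_nhdsin topspace_chabauty by blast
    have NS: "N \<in> sets \<Lambda>" using open_in_borel_on[OF N(1)] s by simp
    have "0 < emeasure \<Lambda> N" using H N by (simp add: topological_support_def)
    interpret l: sigma_finite_measure \<Lambda> using \<Lambda> by (simp add: invariant_subgroup_measure_def)
    obtain A :: "nat \<Rightarrow> 'a set set" where A: "range A \<subseteq> sets \<Lambda>" "(\<Union>i. A i) = space \<Lambda>"
      "\<And>i. emeasure \<Lambda> (A i) \<noteq> \<infinity>" using l.sigma_finite by metis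
    have "\<exists>i. emeasure \<Lambda> (N \<inter> A i) \<noteq> 0"
    proof (rule ccontr)
      assume "\<not> ?thesis"
      then have "emeasure \<Lambda> (\<Union>i. N \<inter> A i) = 0"
        using A(1) NS by (intro emeasure_UN_eq_0) auto
      moreover have "(\<Union>i. N \<inter> A i) = N" using A(2) sets.sets_into_space[OF NS] by blast
      ultimately show False using \<open>0 < emeasure \<Lambda> N\<close> by simp
    qed
    then obtain i where i: "emeasure \<Lambda> (N \<inter> A i) \<noteq> 0" by blast
    define D where "D = N \<inter> A i"
    have D: "D \<in> sets \<Lambda>" using A(1) NS by (auto simp: D_def)
    have "emeasure \<Lambda> D \<le> emeasure \<Lambda> (A i)" using A(1) by (intro emeasure_mono) (auto simp: D_def)
    then have Dfin: "emeasure \<Lambda> D < top" using A(3)[of i] by (simp add: less_top le_less_trans)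
    have "ennreal b * emeasure \<Lambda> D = (\<integral>\<^sup>+K. indicator D K * ennreal b \<partial>\<Lambda>)"
      using D by (simp add: nn_integral_cmult_indicator mult.commute[of "indicator D _"])
    also have "\<dots> \<le> (\<integral>\<^sup>+K. indicator D K * ennreal (j p q K) \<partial>\<Lambda>)"
      using N(3) by (intro nn_integral_mono) (auto simp: indicator_def D_def less_imp_le intro!: ennreal_leI)
    also have "\<dots> = (\<integral>\<^sup>+K. indicator D K * ennreal (j q p K) \<partial>\<Lambda>)"
      unfolding j_def by (rule mass_transport[OF \<Lambda> _ p q]) (use D s in simp)
    also have "\<dots> \<le> (\<integral>\<^sup>+K. indicator D K * ennreal a \<partial>\<Lambda>)"
      using N(3) by (intro nn_integral_mono) (auto simp: indicator_def D_def less_imp_le intro!: ennreal_leI)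
    also have "\<dots> = ennreal a * emeasure \<Lambda> D"
      using D by (simp add: nn_integral_cmult_indicator mult.commute[of "indicator D _"])
    finally have "ennreal b * emeasure \<Lambda> D \<le> ennreal a * emeasure \<Lambda> D" .
    moreover obtain r where r: "emeasure \<Lambda> D = ennreal r" "0 \<le> r" using Dfin by (metis ennreal_cases less_top)
    moreover have "r \<noteq> 0" using i r by (auto simp: D_def)
    ultimately have "b * r \<le> a * r" "0 < r"
      using a0 b by (auto simp: ennreal_mult[symmetric])
    then show False using b(1) by simp
  qed
  show ?thesis using le[OF f1 f2] le[OF f2 f1] unfolding j_def by simp
qed

end

section \<open>The space of cosets\<close>

lemma coset_eq_iff:
  assumes H: "is_subgroup (H :: 'a::group_add set)"
  shows "left_translate x H = left_translate y H \<longleftrightarrow> - x + y \<in> H"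
proof
  assume "left_translate x H = left_translate y H"
  moreover have "y \<in> left_translate y H" using H by (force simp: left_translate_def is_subgroup_def)
  ultimately obtain h where "h \<in> H" "y = x + h" by (auto simp: left_translate_def)
  then show "- x + y \<in> H" by (simp add: add.assoc[symmetric])
next
  have sub: "left_translate y H \<subseteq> left_translate x H" if xy: "- x + y \<in> H" for x y
  proof
    fix z assume "z \<in> left_translate y H"
    then obtain h where h: "h \<in> H" "z = y + h" by (auto simp: left_translate_def)
    have "z = x + ((- x + y) + h)" using h by (simp add: add.assoc[symmetric])
    moreover have "(- x + y) + h \<in> H" using xy h H unfolding is_subgroup_def by blast
    ultimately show "z \<in> left_translate x H" unfolding left_translate_def by blast
  qed
  assume a: "- x + y \<in> H"
  then have "- (- x + y) \<in> H" using H unfolding is_subgroup_def by blast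
  then have "- y + x \<in> H" by (simp add: minus_add)
  then show "left_translate x H = left_translate y H" using sub a by blast
qed

lemma left_translate_comp: "left_translate x (left_translate y A) = left_translate (x + y) (A :: 'a::group_add set)"
  by (auto simp: left_translate_def image_image add.assoc)

lemma left_translate_zero: "left_translate 0 A = (A :: 'a::group_add set)"
  by (auto simp: left_translate_def)

lemma coset_map_open:
  assumes H: "is_subgroup H" and U: "open (U :: 'a::topological_group_add set)"
  shows "openin (coset_topology H) ((\<lambda>g. left_translate g H) ` U)"
  unfolding openin_coset_topology
proof (intro conjI)
  have "(\<lambda>g. left_translate g H) -` (\<lambda>g. left_translate g H) ` U = (\<Union>h\<in>H. (\<lambda>x. x + h) -` U)"
  proof (intro equalityI subsetI)
    fix x assume "x \<in> (\<lambda>g. left_translate g H) -` (\<lambda>g. left_translate g H) ` U"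
    then obtain u where u: "u \<in> U" "left_translate x H = left_translate u H" by auto
    then have h: "- x + u \<in> H" using coset_eq_iff[OF H] by blast
    have "x + (- x + u) = u" by (simp add: add.assoc[symmetric])
    then show "x \<in> (\<Union>h\<in>H. (\<lambda>x. x + h) -` U)" using h u(1) by (intro UN_I[OF h]) simp
  next
    fix x assume "x \<in> (\<Union>h\<in>H. (\<lambda>x. x + h) -` U)"
    then obtain h where h: "h \<in> H" "x + h \<in> U" by blast
    have "left_translate x H = left_translate (x + h) H"
      unfolding coset_eq_iff[OF H] using h(1) by (simp add: add.assoc[symmetric])
    then show "x \<in> (\<lambda>g. left_translate g H) -` (\<lambda>g. left_translate g H) ` U" using h(2) by auto
  qed
  also have "open \<dots>" using U by (intro open_UN ballI open_vimage continuous_intros) auto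
  finally show "open ((\<lambda>g. left_translate g H) -` (\<lambda>g. left_translate g H) ` U)" .
qed (auto simp: left_cosets_def)

lemma coset_space_Hausdorff:
  assumes H: "is_subgroup H" "closed (H :: 'a::topological_group_add set)"
  shows "Hausdorff_space (coset_topology H)"
  unfolding Hausdorff_space_def topspace_coset_topology
proof (intro allI impI, elim conjE)
  fix a b assume "a \<in> left_cosets H" "b \<in> left_cosets H" and ne: "a \<noteq> b"
  then obtain x y where xy: "a = left_translate x H" "b = left_translate y H" by (auto simp: left_cosets_def)
  have "open ((\<lambda>z. - fst z + snd z) -` (- H))"
    using H by (intro open_vimage continuous_intros) auto
  moreover have "(x, y) \<in> (\<lambda>z. - fst z + snd z) -` (- H)" using ne xy coset_eq_iff[OF H(1)] by simp
  ultimately obtain A B where AB: "open A" "open B" "(x, y) \<in> A \<times> B" "A \<times> B \<subseteq> (\<lambda>z. - fst z + snd z) -` (- H)"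
    by (rule open_prod_elim)
  let ?p = "\<lambda>g. left_translate g H"
  show "\<exists>U V. openin (coset_topology H) U \<and> openin (coset_topology H) V \<and> a \<in> U \<and> b \<in> V \<and> disjnt U V"
  proof (rule exI[of _ "?p ` A"], rule exI[of _ "?p ` B"], intro conjI)
    show "disjnt (?p ` A) (?p ` B)"
    proof -
      have "?p u \<noteq> ?p v" if uv: "u \<in> A" "v \<in> B" for u v
      proof -
        have "(u, v) \<in> A \<times> B" using uv by blast
        then have "- u + v \<notin> H" using AB(4) by auto
        then show ?thesis using coset_eq_iff[OF H(1)] by blast
      qed
      then show ?thesis by (auto simp: disjnt_iff)
    qed
  qed (use AB xy coset_map_open[OF H(1)] in auto)
qed

lemma coset_map_continuous: "continuous_map euclidean (coset_topology H) (\<lambda>g. left_translate g H)"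
  by (rule quotient_imp_continuous_map[OF quotient_map_coset_topology])

lemma left_translate_continuous:
  "continuous_map (coset_topology H) (coset_topology H) (left_translate (x :: 'a::topological_group_add))"
proof -
  have "continuous_map euclidean (coset_topology H) ((\<lambda>g. left_translate g H) \<circ> (\<lambda>g. x + g))"
    by (rule continuous_map_compose[OF _ coset_map_continuous]) (auto intro!: continuous_intros)
  then have "continuous_map euclidean (coset_topology H) (left_translate x \<circ> (\<lambda>g. left_translate g H))"
    by (simp add: o_def left_translate_comp)
  then show ?thesis by (rule continuous_compose_quotient_map[OF quotient_map_coset_topology])
qed

section \<open>The invariant measure on the space of cosets\<close>

context
  fixes \<phi> :: "'a::{topological_group_add, t2_space, second_countable_topology} \<Rightarrow> real"
    and m :: "'a measure" and H :: "'a set"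
  assumes lc: "locally_compact_space (euclidean :: 'a topology)"
    and \<phi>: "\<phi> \<in> Cc euclidean" "0 < \<phi> 0" and m: "left_haar UNIV m" "Cc_integral m \<phi> = 1" and H: "H \<in> Sub"
    and symmetric: "\<And>f1 f2. f1 \<in> Cc euclidean \<Longrightarrow> f2 \<in> Cc euclidean \<Longrightarrow>
      Cc_integral m (\<lambda>g. f1 g * coset_average \<phi> H f2 g) = Cc_integral m (\<lambda>g. f2 g * coset_average \<phi> H f1 g)"
begin

lemma coset_space_locally_compact: "locally_compact_space (coset_topology H)"
proof (rule locally_compact_space_continuous_open_map_image[OF coset_map_continuous _ _ lc])
  show "open_map euclidean (coset_topology H) (\<lambda>g. left_translate g H)"
    unfolding open_map_def using coset_map_open H by (auto simp: Sub_iff)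
qed (simp add: topspace_coset_topology left_cosets_def)

lemma coset_average_cong:
  assumes f: "f \<in> Cc euclidean" and g: "g \<in> Cc euclidean" and eq: "\<And>k. k \<in> H \<Longrightarrow> f (x + k) = g (x + k)"
  shows "coset_average \<phi> H f x = coset_average \<phi> H g x"
  unfolding coset_average_def
  using Cc_integral_mono[OF Sub_facts[OF lc \<phi> H] Cc_shift_left[OF f] Cc_shift_left[OF g], of x x]
    Cc_integral_mono[OF Sub_facts[OF lc \<phi> H] Cc_shift_left[OF g] Cc_shift_left[OF f], of x x] eq
  by (simp add: antisym)

lemma coset_average_scale:
  assumes "f \<in> Cc euclidean" "0 \<le> c"
  shows "coset_average \<phi> H (\<lambda>x. c * f x) g = c * coset_average \<phi> H f g"
  unfolding coset_average_def
  by (rule Cc_integral_scale[OF Sub_facts[OF lc \<phi> H] Cc_shift_left[OF assms(1)] assms(2)])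

lemma coset_average_add:
  assumes "f \<in> Cc euclidean" "g \<in> Cc euclidean"
  shows "coset_average \<phi> H (\<lambda>x. f x + g x) y = coset_average \<phi> H f y + coset_average \<phi> H g y"
  unfolding coset_average_def
  by (rule Cc_integral_add[OF Sub_facts[OF lc \<phi> H] Cc_shift_left[OF assms(1)] Cc_shift_left[OF assms(2)]])

lemma coset_average_invariant:
  assumes f: "f \<in> Cc euclidean" and k: "k \<in> H"
  shows "coset_average \<phi> H f (g + k) = coset_average \<phi> H f g"
  using Cc_integral_shift[OF Sub_facts[OF lc \<phi> H] k Cc_shift_left[OF f], of g]
  by (simp add: coset_average_def add.assoc)

lemma coset_average_pos:
  assumes f: "f \<in> Cc euclidean" and k: "k \<in> H" "0 < f (g + k)"
  shows "0 < coset_average \<phi> H f g"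
  unfolding coset_average_def
  by (rule Cc_integral_pos[OF lc Sub_facts[OF lc \<phi> H] \<phi>(1) _ Cc_shift_left[OF f] k(1)])
     (use k(2) unit_haar[OF lc \<phi> H] in auto)

text \<open>
  Choose a compact \<open>Q \<subseteq> G\<close> whose image contains the support of \<open>F\<close> and \<open>h\<close> equal to \<open>1\<close> on \<open>Q\<close>. Then
  \<open>f = h \<cdot> F / P\<^sub>H h\<close> has average \<open>F\<close>, because \<open>F\<close> and \<open>P\<^sub>H h\<close> are constant on cosets. Where \<open>P\<^sub>H h\<close> vanishes, so does \<open>F\<close>,
  and the convention \<open>0 / 0 = 0\<close> gives the right value; continuity holds because \<open>{P\<^sub>H h > 0}\<close> and the complement of the
  preimage of the support are open and cover \<open>G\<close>.
\<close>

lemma coset_average_surjective: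
  assumes F: "F \<in> Cc (coset_topology H)"
  shows "\<exists>f\<in>Cc euclidean. \<forall>g. coset_average \<phi> H f g = F (left_translate g H)"
proof -
  let ?X = "coset_topology H" and ?p = "\<lambda>g. left_translate g H"
  note S = Sub_facts[OF lc \<phi> H]
  obtain C where C: "compactin ?X C" "\<And>x. x \<notin> C \<Longrightarrow> F x = 0" using F by (metis CcE)
  have "\<exists>W P. open W \<and> compact P \<and> x \<in> W \<and> W \<subseteq> P" for x :: 'a
    using lc unfolding locally_compact_space_def by auto
  then obtain W P where W: "\<And>x::'a. open (W x)" "\<And>x. compact (P x)" "\<And>x. x \<in> W x" "\<And>x. W x \<subseteq> P x"
    by metis
  have "C \<subseteq> \<Union> (range (\<lambda>x. ?p ` W x))"
  proof
    fix c assume "c \<in> C"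
    then obtain x where "c = ?p x"
      using compactin_subset_topspace[OF C(1)] by (auto simp: topspace_coset_topology left_cosets_def)
    then show "c \<in> \<Union> (range (\<lambda>x. ?p ` W x))" using W(3) by blast
  qed
  then obtain \<F> where \<F>: "finite \<F>" "\<F> \<subseteq> range (\<lambda>x. ?p ` W x)" "C \<subseteq> \<Union>\<F>"
  proof -
    have "\<And>U. U \<in> range (\<lambda>x. ?p ` W x) \<Longrightarrow> openin ?X U"
      using coset_map_open[OF S(1) W(1)] by blast
    from compactinD[OF C(1) this \<open>C \<subseteq> \<Union> (range (\<lambda>x. ?p ` W x))\<close>] show ?thesis using that by meson
  qed
  then obtain T where T: "finite T" "\<F> = (\<lambda>x. ?p ` W x) ` T"
    by (metis finite_subset_image)
  define Q where "Q = (\<Union>x\<in>T. P x)"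
  have Q: "compact Q" unfolding Q_def using T(1) W(2) by (intro compact_UN) auto
  have CQ: "C \<subseteq> ?p ` Q" using \<F>(3) T(2) W(4) unfolding Q_def by blast
  obtain h where h: "h \<in> Cc euclidean" "\<And>x. x \<in> Q \<Longrightarrow> h x = 1" "\<And>x. h x \<noteq> 0 \<Longrightarrow> x \<in> UNIV" "\<And>x. h x \<le> 1"
    by (rule group_bump[OF lc Q open_UNIV subset_UNIV]) (rule that)
  let ?D = "coset_average \<phi> H h"
  have D: "continuous_on UNIV ?D" by (rule coset_average_continuous[OF lc \<phi> h(1) H])
  have Dpos: "0 < ?D g" if g: "?p g \<in> C" for g
  proof -
    obtain q where q: "q \<in> Q" "?p g = ?p q" using CQ g by blast
    then have "- g + q \<in> H" using coset_eq_iff[OF S(1)] by blast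
    moreover have "g + (- g + q) = q" by (simp add: add.assoc[symmetric])
    ultimately show ?thesis using coset_average_pos[OF h(1), of "- g + q" g] h(2)[OF q(1)] by simp
  qed
  have Fc: "continuous_on UNIV (\<lambda>g. F (?p g))"
    using continuous_map_compose[OF coset_map_continuous Cc_cont[OF F]] by (simp add: o_def)
  define f where "f g = h g * (F (?p g) / ?D g)" for g
  have quot: "continuous_on UNIV (\<lambda>g. F (?p g) / ?D g)"
  proof -
    have "continuous_on (?D -` {0<..}) (\<lambda>g. F (?p g) / ?D g)"
      by (intro continuous_on_divide continuous_on_subset[OF Fc] continuous_on_subset[OF D]) auto
    moreover have "continuous_on (?p -` (topspace ?X - C)) (\<lambda>g. F (?p g) / ?D g)"
      using C(2) by (subst continuous_on_cong[of _ "?p -` (topspace ?X - C)" _ "\<lambda>_. 0"]) auto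
    moreover have "open (?D -` {0<..})" by (rule open_vimage[OF _ D]) auto
    moreover have "open (?p -` (topspace ?X - C))"
    proof -
      have "closedin ?X C"
        by (rule compactin_imp_closedin[OF coset_space_Hausdorff[OF S(1,2)] C(1)])
      then have "openin ?X (topspace ?X - C)" by blast
      then show ?thesis by (simp add: openin_coset_topology)
    qed
    ultimately have "continuous_on (?D -` {0<..} \<union> ?p -` (topspace ?X - C)) (\<lambda>g. F (?p g) / ?D g)"
      by (intro continuous_on_open_Un) auto
    moreover have "?D -` {0<..} \<union> ?p -` (topspace ?X - C) = UNIV"
      using Dpos by (auto simp: topspace_coset_topology left_cosets_def)
    ultimately show ?thesis by simp
  qed
  have nn: "0 \<le> F (?p g) / ?D g" for g
    using Cc_nonneg[OF F] by (simp add: coset_average_def Cc_integral_nonneg)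
  have fC: "f \<in> Cc euclidean"
    unfolding f_def using quot nn by (intro Cc_mult[OF h(1)]) auto
  show ?thesis
  proof (intro bexI[OF _ fC] allI)
    fix g
    let ?c = "F (?p g) / ?D g"
    have "coset_average \<phi> H f g = coset_average \<phi> H (\<lambda>x. ?c * h x) g"
    proof (rule coset_average_cong[OF fC Cc_scale[OF h(1) nn]])
      fix k assume k: "k \<in> H"
      have "?p (g + k) = ?p g"
        using coset_eq_iff[OF S(1), of g "g + k"] k by (simp add: add.assoc[symmetric])
      then show "f (g + k) = ?c * h (g + k)"
        by (simp add: f_def coset_average_invariant[OF h(1) k])
    qed
    also have "\<dots> = ?c * ?D g" by (rule coset_average_scale[OF h(1) nn])
    also have "\<dots> = F (?p g)" using Dpos[of g] C(2)[of "?p g"] by (cases "?p g \<in> C") auto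
    finally show "coset_average \<phi> H f g = F (?p g)" .
  qed
qed

text \<open>
  Take \<open>\<psi>\<close> with \<open>P\<^sub>H \<psi> = 1\<close> on the supports of \<open>f1\<close> and \<open>f2\<close>. By symmetry of the pairing
  \<open>m(f1) = m(f1 \<cdot> P\<^sub>H \<psi>) = m(\<psi> \<cdot> P\<^sub>H f1)\<close>, and likewise for \<open>f2\<close>.
\<close>

lemma integral_mono_of_average:
  assumes f1: "f1 \<in> Cc euclidean" and f2: "f2 \<in> Cc euclidean"
    and le: "\<And>g. coset_average \<phi> H f1 g \<le> coset_average \<phi> H f2 g"
  shows "Cc_integral m f1 \<le> Cc_integral m f2"
proof -
  let ?X = "coset_topology H" and ?p = "\<lambda>g. left_translate g H"
  note S = Sub_facts[OF lc \<phi> H]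
  have U: "is_subgroup (UNIV :: 'a set)" "closed (UNIV :: 'a set)" "left_haar UNIV m"
    using m by (simp_all add: is_subgroup_def)
  obtain C1 where C1: "compact C1" "\<And>x. x \<notin> C1 \<Longrightarrow> f1 x = 0" using f1 by (metis CcE compactin_euclidean_iff)
  obtain C2 where C2: "compact C2" "\<And>x. x \<notin> C2 \<Longrightarrow> f2 x = 0" using f2 by (metis CcE compactin_euclidean_iff)
  have K: "compactin ?X (?p ` (C1 \<union> C2))"
    by (rule image_compactin[OF _ coset_map_continuous]) (use C1 C2 in \<open>simp add: compact_Un\<close>)
  obtain \<theta> where \<theta>: "subordinate ?X (topspace ?X) \<theta>" "\<And>c. c \<in> ?p ` (C1 \<union> C2) \<Longrightarrow> \<theta> c = 1"
    by (rule bump_function[OF coset_space_locally_compact coset_space_Hausdorff[OF S(1,2)] K openin_topspace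
        compactin_subset_topspace[OF K]]) (rule that)
  obtain \<psi> where \<psi>: "\<psi> \<in> Cc euclidean" "\<And>g. coset_average \<phi> H \<psi> g = \<theta> (?p g)"
    using coset_average_surjective[OF subordinate_Cc[OF \<theta>(1)]] by blast
  have one: "f g * coset_average \<phi> H \<psi> g = f g" if "\<And>x. x \<notin> C1 \<union> C2 \<Longrightarrow> f x = 0" for f g
    using that[of g] \<theta>(2)[of "?p g"] by (cases "g \<in> C1 \<union> C2") (auto simp: \<psi>(2))
  have eq: "Cc_integral m f = Cc_integral m (\<lambda>g. \<psi> g * coset_average \<phi> H f g)"
    if "f \<in> Cc euclidean" "\<And>x. x \<notin> C1 \<union> C2 \<Longrightarrow> f x = 0" for f
  proof -
    have "(\<lambda>g. f g * coset_average \<phi> H \<psi> g) = f" by (rule ext, rule one) (rule that(2))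
    then show ?thesis using symmetric[OF that(1) \<psi>(1)] by simp
  qed
  have "Cc_integral m f1 = Cc_integral m (\<lambda>g. \<psi> g * coset_average \<phi> H f1 g)"
    by (rule eq[OF f1]) (use C1 in auto)
  also have "\<dots> \<le> Cc_integral m (\<lambda>g. \<psi> g * coset_average \<phi> H f2 g)"
    using le Cc_nonneg[OF \<psi>(1)]
    by (intro Cc_integral_mono[OF U] coset_average_mult_Cc[OF lc \<phi>] f1 f2 \<psi>(1) H mult_left_mono)
  also have "\<dots> = Cc_integral m f2" by (rule eq[OF f2, symmetric]) (use C2 in auto)
  finally show ?thesis .
qed

text \<open>
  The functional sends \<open>F\<close> to \<open>m(f)\<close> for any \<open>f\<close> with average \<open>F\<close>; by \<open>integral_mono_of_average\<close> the choice of \<open>f\<close>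
  does not matter. Translating \<open>f\<close> translates its average, so the functional is invariant, and it is positive at a bump
  function around the coset \<open>H\<close>.
\<close>

theorem invariant_radon_of_symmetric:
  "\<exists>\<mu>. radon_measure (coset_topology H) \<mu> \<and> invariant_under left_translate \<mu> \<and> (\<exists>A\<in>sets \<mu>. emeasure \<mu> A \<noteq> 0)"
proof -
  let ?X = "coset_topology H" and ?p = "\<lambda>g. left_translate g H"
  note S = Sub_facts[OF lc \<phi> H]
  note lcX = coset_space_locally_compact and hX = coset_space_Hausdorff[OF S(1,2)]
  have U: "is_subgroup (UNIV :: 'a set)" "closed (UNIV :: 'a set)" "left_haar UNIV m"
    using m by (simp_all add: is_subgroup_def)
  define lift where "lift F f \<longleftrightarrow> f \<in> Cc euclidean \<and> (\<forall>g. coset_average \<phi> H f g = F (?p g))" for F f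
  define I where "I F = Cc_integral m (SOME f. lift F f)" for F
  have I: "I F = Cc_integral m f" if f: "lift F f" for F f
  proof -
    have "lift F (SOME f. lift F f)" using someI[of "lift F", OF f] .
    moreover have "Cc_integral m p \<le> Cc_integral m q" if "lift F p" "lift F q" for p q
      using that by (intro integral_mono_of_average) (simp_all add: lift_def)
    ultimately show ?thesis unfolding I_def using f by (blast intro: antisym)
  qed
  have ex: "\<exists>f. lift F f" if "F \<in> Cc ?X" for F
    using coset_average_surjective[OF that] by (auto simp: lift_def)
  have pos: "positive_functional ?X I"
    unfolding positive_functional_def
  proof (intro conjI ballI allI impI)
    show "0 \<le> I F" for F unfolding I_def by (rule Cc_integral_nonneg)
    fix F assume F: "F \<in> Cc ?X"
    obtain f where f: "lift F f" using ex[OF F] by blast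
    have fC: "f \<in> Cc euclidean" using f by (simp add: lift_def)
    show "I (\<lambda>x. F x + G x) = I F + I G" if G: "G \<in> Cc ?X" for G
    proof -
      obtain g where g: "lift G g" using ex[OF G] by blast
      then have gC: "g \<in> Cc euclidean" by (simp add: lift_def)
      have "lift (\<lambda>x. F x + G x) (\<lambda>x. f x + g x)"
        using f g Cc_add[OF fC gC] coset_average_add[OF fC gC] by (simp add: lift_def)
      then show ?thesis using I[OF f] I[OF g] I Cc_integral_add[OF U fC gC] by simp
    qed
    show "I (\<lambda>x. c * F x) = c * I F" if "0 \<le> c" for c
    proof -
      have "lift (\<lambda>x. c * F x) (\<lambda>x. c * f x)"
        using f Cc_scale[OF fC that] coset_average_scale[OF fC that] by (simp add: lift_def)
      then show ?thesis using I[OF f] I Cc_integral_scale[OF U fC that] by simp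
    qed
  qed
  have inv: "I (\<lambda>c. F (left_translate x c)) = I F" if F: "F \<in> Cc ?X" for F x
  proof -
    obtain f where f: "lift F f" using ex[OF F] by blast
    then have fC: "f \<in> Cc euclidean" by (simp add: lift_def)
    have "coset_average \<phi> H (\<lambda>y. f (x + y)) g = coset_average \<phi> H f (x + g)" for g
      by (simp add: coset_average_def add.assoc)
    then have "lift (\<lambda>c. F (left_translate x c)) (\<lambda>y. f (x + y))"
      using f Cc_shift_left[OF fC] by (simp add: lift_def left_translate_comp)
    then show ?thesis using I[OF f] I Cc_integral_shift[OF U UNIV_I fC] by simp
  qed
  obtain M where M: "riesz_measure ?X I M"
    by (rule riesz_representation[OF lcX hX pos]) (rule that)
  have "radon_measure ?X M" by (rule riesz_radon[OF lcX hX pos M])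
  moreover have "invariant_under left_translate M"
    unfolding invariant_under_def
  proof (intro allI ballI)
    fix x A assume A: "A \<in> sets M"
    show "emeasure M (left_translate x ` A) = emeasure M A"
      by (rule riesz_invariant[OF lcX hX pos M left_translate_continuous left_translate_continuous[of _ "- x"] _ _ inv A])
         (simp_all add: left_translate_comp left_translate_zero)
  qed
  moreover have "\<exists>A\<in>sets M. emeasure M A \<noteq> 0"
  proof (rule ccontr)
    assume "\<not> ?thesis"
    then have null: "emeasure M (space M) = 0" by blast
    have p0: "?p 0 \<in> topspace ?X" by (auto simp: topspace_coset_topology left_cosets_def)
    obtain F where F: "subordinate ?X (topspace ?X) F" "\<And>c. c \<in> {?p 0} \<Longrightarrow> F c = 1"
      by (rule bump_function[OF lcX hX, of "{?p 0}" "topspace ?X"]) (use p0 in auto)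
    have FC: "F \<in> Cc ?X" by (rule subordinate_Cc[OF F(1)])
    obtain f where f: "lift F f" using ex[OF FC] by blast
    then have fC: "f \<in> Cc euclidean" and f1: "coset_average \<phi> H f 0 = 1" using F(2) by (simp_all add: lift_def)
    have "\<exists>k. f k \<noteq> 0"
    proof (rule ccontr)
      assume "\<not> ?thesis"
      then have "coset_average \<phi> H f 0 = 0" by (simp add: coset_average_def Cc_integral_def)
      then show False using f1 by simp
    qed
    then obtain k where "0 < f k" using Cc_nonneg[OF fC] by (metis order_le_less)
    then have "0 < Cc_integral m f"
      using Cc_integral_pos[OF lc U \<phi>(1) _ fC UNIV_I] m(2) by simp
    moreover have "(\<integral>\<^sup>+c. ennreal (F c) \<partial>M) = ennreal (I F)"
      by (rule riesz_integral[OF lcX hX pos M FC])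
    moreover have "(\<integral>\<^sup>+c. ennreal (F c) \<partial>M) \<le> (\<integral>\<^sup>+c. indicator (space M) c \<partial>M)"
      using F(1) by (intro nn_integral_mono) (auto simp: subordinate_def)
    ultimately show False using null I[OF f] by simp
  qed
  ultimately show ?thesis by blast
qed

end

theorem theorem1p1:
  fixes \<Lambda> :: "'a::{topological_group_add, t2_space, second_countable_topology} set measure"
    and H :: "'a set"
  assumes "locally_compact_space (euclidean :: 'a topology)"
    and "invariant_subgroup_measure \<Lambda>"
    and "H \<in> topological_support chabauty \<Lambda>"
  shows "\<exists>\<mu> :: 'a set measure.
    radon_measure (coset_topology H) \<mu> \<and>
    invariant_under left_translate \<mu> \<and>
    (\<exists>A\<in>sets \<mu>. emeasure \<mu> A \<noteq> 0)"
proof -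
  note lc = assms(1)
  obtain \<phi> :: "'a \<Rightarrow> real" where \<phi>: "\<phi> \<in> Cc euclidean" "\<And>x. x \<in> {0} \<Longrightarrow> \<phi> x = 1" "\<And>x. \<phi> x \<noteq> 0 \<Longrightarrow> x \<in> UNIV" "\<And>x. \<phi> x \<le> 1"
    by (rule group_bump[OF lc, of "{0}" UNIV]) auto
  then have \<phi>0: "0 < \<phi> 0" by simp
  have UNIV_Sub: "(UNIV :: 'a set) \<in> Sub" by (simp add: Sub_iff is_subgroup_def)
  note m = unit_haar[OF lc \<phi>(1) \<phi>0 UNIV_Sub]
  have H: "H \<in> Sub" using assms(3) by (simp add: topological_support_def topspace_chabauty)
  show ?thesis
    by (rule invariant_radon_of_symmetric[OF lc \<phi>(1) \<phi>0 m H])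
       (rule average_pairing_symmetric[OF lc \<phi>(1) \<phi>0 m(1) assms(2,3)])
qed

end
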